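(* Let $\mathbb{H}$, $\Xi$, $\mathbb{H}_{\alpha}$ be complex Hilbert spaces, let $A$ be the generator of a $C_{0}$-semigroup $G(t)$, $t\ge 0$, in $\mathbb{H}$ with domain $\mathcal{D}(A)$, and let $B \in \mathcal{L}(\Xi;\mathbb{H})$. Suppose $\mathbb{H}_{\alpha}$ is continuously and densely embedded in $\mathbb{H}$ and $\mathcal{D}(A) \subset \mathbb{H}_{\alpha}$. Let $\mathcal{F}(v,\xi)$, $v \in \mathbb{H}_{\alpha}$, $\xi\in\Xi$, be a Hermitian form $$\mathcal{F}(v,\xi) = (\mathcal{F}_{1}v,v)_{\alpha} + 2\operatorname{Re}(\mathcal{F}_{2}v,\xi)_{\Xi} + (\mathcal{F}_{3}\xi,\xi)_{\Xi},$$ where $\mathcal{F}_{1}^{*}=\mathcal{F}_{1} \in \mathcal{L}(\mathbb{H}_{\alpha})$, $\mathcal{F}_{2} \in \mathcal{L}(\mathbb{H}_{\alpha};\Xi)$, $\mathcal{F}_{3}^{*}=\mathcal{F}_{3} \in \mathcal{L}(\Xi)$. Assume that $A$ is also the generator of a $C_{0}$-semigroup in $\mathbb{H}_{\alpha}$, and that $A$ has no spectrum on the imaginary axis and the operators $(A-i\omega I)^{-1}$ are bounded in the norm of $\mathcal{L}(\mathbb{H};\mathbb{H}_{\alpha})$ uniformly in $\omega \in \mathbb{R}$. Then the following conditions are equivalent: 1. For some $\delta'>0$ we have $\mathcal{F}(-(A - i\omega I)^{-1}B\xi,\xi) \leq -\delta' |\xi|^{2}_{\Xi}$ for all $\xi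 \in \Xi$ and $\omega \in \mathbb{R}$. 2. There are $\delta>0$ and $P \in \mathcal{L}(\mathbb{H}_{\alpha})$, self-adjoint in $\mathbb{H}_{\alpha}$, such that for $V(v):=( Pv, v )_{\alpha}$ and any $T \geq 0$ $$V(v(T)) - V(v_{0}) + \int_{0}^{T} \mathcal{F}(v(s),\xi(s))\,ds \leq -\delta \int_{0}^{T}\left(|v(s)|^{2}_{\alpha}+|\xi(s)|^{2}_{\Xi}\right)ds$$ whenever $v_{0} \in \mathbb{H}_{\alpha}$, $\xi(\cdot) \in L_{2}(0,T;\Xi)$ and $v(t)=v(t,v_{0},\xi)$, $t\in[0,T]$, is the mild solution to $\dot{v}(t)=Av(t)+B\xi(t)$ with $v(0)=v_{0}$ and this solution satisfies $v(\cdot) \in C([0,T];\mathbb{H}_{\alpha})$.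
   Context: $\mathcal{L}(\mathbb{E};\mathbb{F})$ is the space of bounded linear operators from $\mathbb{E}$ to $\mathbb{F}$, $\mathcal{L}(\mathbb{E})=\mathcal{L}(\mathbb{E};\mathbb{E})$. $(\cdot,\cdot)_{\alpha}$, $|\cdot|_{\alpha}$ denote the inner product and norm of $\mathbb{H}_{\alpha}$; $(\cdot,\cdot)_{\Xi}$, $|\cdot|_{\Xi}$ those of $\Xi$. The mild solution of $\dot v = Av+B\xi$ with $v(0)=v_0$ is $v(t)=G(t)v_{0}+\int_{0}^{t}G(t-s)B\xi(s)\,ds$, a continuous $\mathbb{H}$-valued function. "$A$ is also the generator of a $C_{0}$-semigroup in $\mathbb{H}_{\alpha}$" means that $G(t)$ leaves $\mathbb{H}_{\alpha}$ invariant and restricts to a $C_{0}$-semigroup in $\mathbb{H}_{\alpha}$. *)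

theory Defs
  imports "HOL-Analysis.Analysis"
begin

text \<open>
  A complex Hilbert space is a complete real inner product space with a compatible complex
  structure. Completeness, the norm and the topology are those of the underlying real space.
  The complex inner product is linear in its first argument. No separability is assumed.
\<close>

class chilbert_space = banach + real_inner +
  fixes scaleC :: "complex \<Rightarrow> 'a \<Rightarrow> 'a"  (infixr \<open>*\<^sub>C\<close> 75)
    and cinner :: "'a \<Rightarrow> 'a \<Rightarrow> complex"
  assumes scaleC_add_right: "c *\<^sub>C (x + y) = c *\<^sub>C x + c *\<^sub>C y"
    and scaleC_add_left: "(c + d) *\<^sub>C x = c *\<^sub>C x + d *\<^sub>C x"
    and scaleC_scaleC: "c *\<^sub>C d *\<^sub>C x = (c * d) *\<^sub>C x"
    and scaleC_of_real: "complex_of_real r *\<^sub>C x = r *\<^sub>R x"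
    and cinner_commute: "cinner x y = cnj (cinner y x)"
    and cinner_add_left: "cinner (x + y) z = cinner x z + cinner y z"
    and cinner_scaleC_left: "cinner (c *\<^sub>C x) y = c * cinner x y"
    and Re_cinner: "Re (cinner x y) = inner x y"

definition bounded_clinear :: "('e::chilbert_space \<Rightarrow> 'f::chilbert_space) \<Rightarrow> bool" where
  "bounded_clinear T \<longleftrightarrow> bounded_linear T \<and> (\<forall>c x. T (c *\<^sub>C x) = c *\<^sub>C T x)"

definition is_adjoint ::
  "('e::chilbert_space \<Rightarrow> 'f::chilbert_space) \<Rightarrow> ('f \<Rightarrow> 'e) \<Rightarrow> bool" where
  "is_adjoint T S \<longleftrightarrow> (\<forall>x y. cinner (T x) y = cinner x (S y))"

definition selfadjoint :: "('e::chilbert_space \<Rightarrow> 'e) \<Rightarrow> bool" where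
  "selfadjoint T \<longleftrightarrow> bounded_clinear T \<and> is_adjoint T T"

text \<open>Only the values \<open>G t\<close> with \<open>t \<ge> 0\<close> are meaningful.\<close>

definition c0_semigroup :: "(real \<Rightarrow> 'h::chilbert_space \<Rightarrow> 'h) \<Rightarrow> bool" where
  "c0_semigroup G \<longleftrightarrow>
     (\<forall>t\<ge>0. bounded_clinear (G t)) \<and>
     (\<forall>x. G 0 x = x) \<and>
     (\<forall>s\<ge>0. \<forall>t\<ge>0. \<forall>x. G (s + t) x = G s (G t x)) \<and>
     (\<forall>x. ((\<lambda>t. G t x) \<longlongrightarrow> x) (at_right 0))"

text \<open>
  An unbounded operator is given by a domain \<open>D\<close> together with a function \<open>A\<close>
  whose values outside \<open>D\<close> are irrelevant.
\<close>

definition generates ::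
  "'h::chilbert_space set \<Rightarrow> ('h \<Rightarrow> 'h) \<Rightarrow> (real \<Rightarrow> 'h \<Rightarrow> 'h) \<Rightarrow> bool" where
  "generates D A G \<longleftrightarrow>
     D = {x. \<exists>y. ((\<lambda>h. (1 / h) *\<^sub>R (G h x - x)) \<longlongrightarrow> y) (at_right 0)} \<and>
     (\<forall>x\<in>D. ((\<lambda>h. (1 / h) *\<^sub>R (G h x - x)) \<longlongrightarrow> A x) (at_right 0))"

definition resolvent :: "'h::chilbert_space set \<Rightarrow> ('h \<Rightarrow> 'h) \<Rightarrow> complex \<Rightarrow> 'h \<Rightarrow> 'h" where
  "resolvent D A l = inv_into D (\<lambda>x. A x - l *\<^sub>C x)"

definition resolvent_set :: "'h::chilbert_space set \<Rightarrow> ('h \<Rightarrow> 'h) \<Rightarrow> complex set" where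
  "resolvent_set D A =
     {l. bij_betw (\<lambda>x. A x - l *\<^sub>C x) D UNIV \<and> bounded_clinear (resolvent D A l)}"

definition spectrum :: "'h::chilbert_space set \<Rightarrow> ('h \<Rightarrow> 'h) \<Rightarrow> complex set" where
  "spectrum D A = - resolvent_set D A"

text \<open>
  A continuously and densely embedded space is a type of its own together with the
  embedding \<open>j\<close>; its elements are identified with those of \<open>range j\<close>.
\<close>

definition dense_embedding :: "('a::chilbert_space \<Rightarrow> 'h::chilbert_space) \<Rightarrow> bool" where
  "dense_embedding j \<longleftrightarrow> bounded_clinear j \<and> inj j \<and> closure (range j) = UNIV"

definition restricts_to_c0_semigroup ::
  "('a::chilbert_space \<Rightarrow> 'h::chilbert_space) \<Rightarrow> (real \<Rightarrow> 'h \<Rightarrow> 'h) \<Rightarrow> bool" where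
  "restricts_to_c0_semigroup j G \<longleftrightarrow>
     (\<forall>t\<ge>0. G t ` range j \<subseteq> range j) \<and> c0_semigroup (\<lambda>t x. inv j (G t (j x)))"

text \<open>The resolvent regarded as an operator into the embedded space.\<close>

definition resolvent_into ::
  "('a::chilbert_space \<Rightarrow> 'h::chilbert_space) \<Rightarrow> 'h set \<Rightarrow> ('h \<Rightarrow> 'h) \<Rightarrow> complex \<Rightarrow> 'h \<Rightarrow> 'a"
  where "resolvent_into j D A l x = inv j (resolvent D A l x)"

text \<open>
  Since \<open>F1\<close> and \<open>F3\<close> are self-adjoint in the intended use, the outer two inner products are
  real, and \<open>Re\<close> only changes their type.
\<close>

definition hermitian_form ::
  "('a::chilbert_space \<Rightarrow> 'a) \<Rightarrow> ('a \<Rightarrow> 'x::chilbert_space) \<Rightarrow> ('x \<Rightarrow> 'x) \<Rightarrow> 'a \<Rightarrow> 'x \<Rightarrow> real" where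
  "hermitian_form F1 F2 F3 v \<xi> =
     Re (cinner (F1 v) v) + 2 * Re (cinner (F2 v) \<xi>) + Re (cinner (F3 \<xi>) \<xi>)"

text \<open>
  The library's \<open>measurable_on\<close> (almost everywhere limits of continuous functions) is strong
  measurability, also for values in a non-separable space. Members are functions rather than
  classes modulo null sets.
\<close>

definition L2_on :: "real \<Rightarrow> (real \<Rightarrow> 'x::chilbert_space) set" where
  "L2_on T = {\<xi>. \<xi> measurable_on {0..T} \<and> (\<lambda>s. (norm (\<xi> s))\<^sup>2) integrable_on {0..T}}"

text \<open>
  For square integrable \<open>\<xi>\<close> the integrand is Bochner integrable, and the Henstock-Kurzweil
  integral used here is its Bochner integral. The library's Bochner integral is developed
  only for second countable spaces.
\<close>

definition mild_solution ::
  "(real \<Rightarrow> 'h::chilbert_space \<Rightarrow> 'h) \<Rightarrow> ('x::chilbert_space \<Rightarrow> 'h) \<Rightarrow> 'h \<Rightarrow> (real \<Rightarrow> 'x) \<Rightarrow> real \<Rightarrow> 'h"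
  where
  "mild_solution G B v0 \<xi> t = G t v0 + integral {0..t} (\<lambda>s. G (t - s) (B (\<xi> s)))"

end

theory Submission
  imports Defs
begin

text \<open>
  Adding a control \<open>\<eta>\<close> that acts on the whole space \<open>'h\<close>, with a large penalty on \<open>\<eta>\<close>, preserves the
  frequency inequality because the resolvents are uniformly bounded into \<open>'a\<close>; and it makes every
  state \<open>x\<close> steerable to \<open>0\<close> in unit time, by \<open>v t = (1 - t) G(t) x\<close> and \<open>\<eta> t = - G(t) x\<close>. A
  trajectory from \<open>0\<close> to \<open>0\<close> extends periodically, so Parseval's identity turns the frequency
  inequality into coercivity of the payoff on such trajectories. The supremum of the payoff over all
  trajectories from \<open>x\<close> to \<open>0\<close> is therefore a bounded quadratic form of \<open>x\<close>, whose operator is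
  \<open>P\<close>, and the dynamic programming inequality is the dissipation inequality. Trajectories are
  handled in the integrated form \<open>A\<^sup>-\<^sup>1 v(t) - A\<^sup>-\<^sup>1 v(0) = \<integral> (v + A\<^sup>-\<^sup>1 f)\<close>, which is
  stable under concatenation. The converse uses the trajectories \<open>v t = e\<^sup>i\<^sup>\<omega>\<^sup>t v0\<close>.
\<close>

section \<open>Square integrable functions\<close>

text \<open>The pair (A, B) need not be controllable or stabilizable, so some states may admit no
  trajectory to 0 at all; the control \<open>\<eta>\<close> removes this obstacle. It disappears at
  the end: the dissipation inequality is applied only to trajectories with \<open>\<eta>\<close> =
  0, where its penalty vanishes. Closed loops on [0, T] replace decaying functions on a half-line
  because they have Fourier series: integration by parts leaves no boundary term, and the
  coefficient at frequency 2 pi k / T satisfies exactly the algebraic relation in the frequency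
  condition. The inverse of A exists since 0 lies on the imaginary axis, and it turns the unbounded
  evolution equation into one between bounded operators. No maximiser and no Riccati equation is
  involved. The supremum of the payoffs is finite because two transfers from the same state differ
  by a loop, on which the payoff is coercive. The margin \<open>\<delta>\<close> of the conclusion
  is put into the payoff before the supremum is taken.\<close>

text \<open>
  The library's Bochner integral needs separability, so square integrability is replaced by
  \<open>L\<^sup>2\<close>-approximability by continuous functions vanishing outside \<open>(a, b)\<close>; the error is
  controlled through an integrable majorant of its square.
\<close>

definition sq_approx :: "real \<Rightarrow> real \<Rightarrow> (real \<Rightarrow> 'e::real_normed_vector) \<Rightarrow> bool" where
  "sq_approx a b f \<longleftrightarrow> (\<forall>e>0. \<exists>g k I. continuous_on UNIV g \<and> (\<forall>t. t \<le> a \<or> b \<le> t \<longrightarrow> g t = 0) \<and>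
     (k has_integral I) {a..b} \<and> I < e \<and> (\<forall>t\<in>{a..b}. (norm (f t - g t))\<^sup>2 \<le> k t))"

lemma sq_approxE:
  assumes "sq_approx a b f" "e > 0"
  obtains g k I where "continuous_on UNIV g" "\<And>t. t \<le> a \<or> b \<le> t \<Longrightarrow> g t = 0"
    "(k has_integral I) {a..b}" "I < e" "\<And>t. t \<in> {a..b} \<Longrightarrow> (norm (f t - g t))\<^sup>2 \<le> k t"
  using assms unfolding sq_approx_def by blast

lemma norm_add_square_le: "(norm (x + y))\<^sup>2 \<le> 2 * (norm x)\<^sup>2 + 2 * (norm y)\<^sup>2"
proof -
  have "(norm (x + y))\<^sup>2 \<le> (norm x + norm y)\<^sup>2"
    by (intro power_mono norm_triangle_ineq) auto
  also have "\<dots> \<le> 2 * (norm x)\<^sup>2 + 2 * (norm y)\<^sup>2"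
    using zero_le_power2[of "norm x - norm y"] by (simp add: power2_eq_square algebra_simps)
  finally show ?thesis .
qed

text \<open>The class is closed under its own notion of convergence: two majorants combine to
  \<open>2 * k t + 2 * k' t\<close>, so each error gets a budget of \<open>e / 4\<close>. Membership
  can then be proved through intermediate functions \<open>h\<close> that are easier to
  approximate.\<close>

lemma sq_approx_trans:
  assumes "\<And>e. e > 0 \<Longrightarrow> \<exists>h k I. sq_approx a b h \<and> (k has_integral I) {a..b} \<and> I < e \<and>
     (\<forall>t\<in>{a..b}. (norm (f t - h t))\<^sup>2 \<le> k t)"
  shows "sq_approx a b f"
  unfolding sq_approx_def
proof (intro allI impI, goal_cases)
  case e: (1 e)
  obtain h k I where h: "sq_approx a b h" "(k has_integral I) {a..b}" "I < e / 4"
     "\<forall>t\<in>{a..b}. (norm (f t - h t))\<^sup>2 \<le> k t"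
    using assms[of "e / 4"] e by auto
  obtain g k' I' where g: "continuous_on UNIV g" "\<And>t. t \<le> a \<or> b \<le> t \<Longrightarrow> g t = 0"
    "(k' has_integral I') {a..b}" "I' < e / 4" "\<And>t. t \<in> {a..b} \<Longrightarrow> (norm (h t - g t))\<^sup>2 \<le> k' t"
    using sq_approxE[OF h(1), of "e / 4"] e by (metis divide_pos_pos zero_less_numeral)
  have "(norm (f t - g t))\<^sup>2 \<le> 2 * k t + 2 * k' t" if "t \<in> {a..b}" for t
    using norm_add_square_le[of "f t - h t" "h t - g t"] bspec[OF h(4) that] g(5)[OF that]
    by simp
  moreover have "((\<lambda>t. 2 * k t + 2 * k' t) has_integral (2 * I + 2 * I')) {a..b}"
    using h(2) g(3) by (intro has_integral_add has_integral_mult_right)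
  moreover have "2 * I + 2 * I' < e" using h(3) g(4) by simp
  ultimately show ?case
    using g(1,2) by blast
qed

lemma sq_approx_continuous:
  fixes f :: "real \<Rightarrow> 'e::real_normed_vector"
  assumes "continuous_on {a..b} f"
  shows "sq_approx a b f"
proof (cases "a < b")
  case False
  then have "((\<lambda>t. (norm (f t))\<^sup>2) has_integral 0) {a..b}"
    using has_integral_null_real by (auto simp: content_real_eq_0)
  with False show ?thesis
    unfolding sq_approx_def by (intro allI impI exI[of _ "\<lambda>_. 0"] exI[of _ "\<lambda>t. (norm (f t))\<^sup>2"] exI[of _ 0]) auto
next
  case True
  \<comment> \<open>A trapezoidal cutoff that vanishes outside \<open>(a, b)\<close> and reaches 1
    at distance 1/n from the ends. The clamped argument in \<open>g\<close> extends \<open>f\<close>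
    continuously to the whole line. The square error tends to 0 except at the two end points, which
    are negligible.\<close>
  define c where "c n t = max 0 (min 1 (real n * min (t - a) (b - t)))" for n t
  define g where "g n t = c n t *\<^sub>R f (max a (min b t))" for n t
  have cont_f: "continuous_on UNIV (\<lambda>t. f (max a (min b t)))"
    using True by (intro continuous_on_compose2[OF assms] continuous_intros) auto
  have cont: "continuous_on UNIV (g n)" for n
    unfolding g_def c_def by (intro continuous_intros cont_f)
  have zero: "g n t = 0" if "t \<le> a \<or> b \<le> t" for n t
  proof -
    have "real n * min (t - a) (b - t) \<le> 0" using that by (intro mult_nonneg_nonpos) auto
    then show ?thesis by (simp add: g_def c_def)
  qed
  let ?k = "\<lambda>n t. (norm (f t - g n t))\<^sup>2"
  have int: "?k n integrable_on {a..b}" for n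
    by (intro integrable_continuous_real continuous_intros assms continuous_on_subset[OF cont]) auto
  have lim: "(\<lambda>n. integral {a..b} (?k n)) \<longlonglongrightarrow> integral {a..b} (\<lambda>t. if t \<in> {a, b} then (norm (f t))\<^sup>2 else 0)"
  proof (rule dominated_convergence(2)[OF int])
    show "(\<lambda>t. (norm (f t))\<^sup>2) integrable_on {a..b}"
      by (intro integrable_continuous_real continuous_intros assms)
    show "norm (?k n t) \<le> (norm (f t))\<^sup>2" if t: "t \<in> {a..b}" for n t
    proof -
      have "f t - g n t = (1 - c n t) *\<^sub>R f t" using t by (simp add: g_def algebra_simps)
      moreover have "\<bar>1 - c n t\<bar> \<le> 1" by (simp add: c_def)
      ultimately have "norm (f t - g n t) \<le> norm (f t)"
        by (simp add: mult_left_le_one_le)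
      then show ?thesis by (simp add: power_mono)
    qed
    show "(\<lambda>n. ?k n t) \<longlonglongrightarrow> (if t \<in> {a, b} then (norm (f t))\<^sup>2 else 0)" if t: "t \<in> {a..b}" for t
    proof (cases "t \<in> {a, b}")
      case True
      then have "g n t = 0" for n using zero by auto
      then show ?thesis using True by simp
    next
      case False
      then have m: "min (t - a) (b - t) > 0" using t by auto
      obtain N where N: "1 < real N * min (t - a) (b - t)"
        using ex_less_of_nat_mult[OF m] by blast
      have "?k n t = 0" if "n \<ge> N" for n
      proof -
        have "real N * min (t - a) (b - t) \<le> real n * min (t - a) (b - t)"
          using that m by (intro mult_right_mono) auto
        then have "c n t = 1" using N by (simp add: c_def)
        then show ?thesis using t by (simp add: g_def)
      qed
      then have "eventually (\<lambda>n. ?k n t = 0) sequentially"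
        unfolding eventually_sequentially by blast
      then have "(\<lambda>n. ?k n t) \<longlonglongrightarrow> 0" by (rule tendsto_eventually)
      with False show ?thesis by simp
    qed
  qed
  have "integral {a..b} (\<lambda>t. if t \<in> {a, b} then (norm (f t))\<^sup>2 else 0) = integral {a..b} (\<lambda>t. 0)"
    by (rule integral_spike[of "{a, b}"]) auto
  with lim have lim0: "(\<lambda>n. integral {a..b} (?k n)) \<longlonglongrightarrow> 0" by simp
  show ?thesis
    unfolding sq_approx_def
  proof (intro allI impI)
    fix e :: real assume "e > 0"
    then obtain n where "integral {a..b} (?k n) < e"
      using order_tendstoD(2)[OF lim0, of e] by (auto simp: eventually_sequentially)
    then show "\<exists>g k I. continuous_on UNIV g \<and> (\<forall>t. t \<le> a \<or> b \<le> t \<longrightarrow> g t = 0) \<and>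
     (k has_integral I) {a..b} \<and> I < e \<and> (\<forall>t\<in>{a..b}. (norm (f t - g t))\<^sup>2 \<le> k t)"
      using cont zero integrable_integral[OF int] by (intro exI[of _ "g n"] exI[of _ "?k n"]) blast
  qed
qed

lemma measurable_on_real_integrable:
  fixes f :: "real \<Rightarrow> real"
  assumes "f measurable_on {a..b}" "h integrable_on {a..b}" "\<And>t. t \<in> {a..b} \<Longrightarrow> \<bar>f t\<bar> \<le> h t"
  shows "f integrable_on {a..b}"
  by (rule measurable_bounded_by_integrable_imp_integrable[of _ _ h])
     (use assms measurable_on_iff_borel_measurable[of "{a..b}" f] in auto)

text \<open>Two limits, both under integrals of real functions: \<open>f\<close> is cut off at norm
  \<open>M\<close>, and the same cutoff is then applied to the continuous functions converging to
  \<open>f\<close> almost everywhere. The cutoff gives these the common bound that dominated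
  convergence requires.\<close>

lemma L2_on_imp_sq_approx:
  fixes f :: "real \<Rightarrow> 'x::chilbert_space"
  assumes "f \<in> L2_on T"
  shows "sq_approx 0 T f"
proof (rule sq_approx_trans, goal_cases)
  case e: (1 e)
  have meas: "f measurable_on {0..T}" and int: "(\<lambda>t. (norm (f t))\<^sup>2) integrable_on {0..T}"
    using assms by (auto simp: L2_on_def)
  \<comment> \<open>The radial retraction onto the ball of radius \<open>n\<close>: continuous,
    fixing 0, and moving no vector by more than its norm.\<close>
  define p where "p n x = (1 / max 1 (norm x / n)) *\<^sub>R x" for n :: real and x :: 'x
  have p_cont: "continuous_on UNIV (p n)" if "n > 0" for n
    unfolding p_def using that by (intro continuous_intros) auto
  have p0: "p n 0 = 0" for n by (simp add: p_def)
  have p_eq: "p n x = x" if "norm x \<le> n" "n > 0" for n x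
    using that by (simp add: p_def)
  have p_bound: "norm (p n x) \<le> n" if "n > 0" for n x
  proof (cases "norm x \<le> n")
    case True then show ?thesis using that p_eq by simp
  next
    case False
    then have "max 1 (norm x / n) = norm x / n" using that by simp
    then show ?thesis using False that by (simp add: p_def)
  qed
  have p_diff: "norm (x - p n x) \<le> norm x" if "n > 0" for n x
  proof -
    have "x - p n x = (1 - 1 / max 1 (norm x / n)) *\<^sub>R x" by (simp add: p_def algebra_simps)
    moreover have "\<bar>1 - 1 / max 1 (norm x / n)\<bar> \<le> 1" by (simp add: divide_simps)
    ultimately show ?thesis by (simp add: mult_left_le_one_le)
  qed
  have int1: "(\<lambda>t. (norm (f t - p n (f t)))\<^sup>2) integrable_on {0..T}" if n: "n > 0" for n
  proof (rule measurable_on_real_integrable[OF _ int])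
    show "(\<lambda>t. (norm (f t - p n (f t)))\<^sup>2) measurable_on {0..T}"
      using measurable_on_compose_continuous_0[OF meas, of "\<lambda>x. (norm (x - p n x))\<^sup>2"]
        p_cont[OF n] p0 by (simp add: o_def continuous_intros)
    show "\<bar>(norm (f t - p n (f t)))\<^sup>2\<bar> \<le> (norm (f t))\<^sup>2" for t
      using p_diff[OF n] by (simp add: power_mono)
  qed
  have "(\<lambda>n. integral {0..T} (\<lambda>t. (norm (f t - p (Suc n) (f t)))\<^sup>2)) \<longlonglongrightarrow> integral {0..T} (\<lambda>t. 0)"
  proof (rule dominated_convergence(2)[OF _ int])
    show "norm ((norm (f t - p (Suc n) (f t)))\<^sup>2) \<le> (norm (f t))\<^sup>2" for n t
      using p_diff[of "Suc n"] by (simp add: power_mono)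
    fix t
    obtain N where "norm (f t) \<le> real N" using real_arch_simple by blast
    then have "(norm (f t - p (Suc n) (f t)))\<^sup>2 = 0" if "n \<ge> N" for n
      using p_eq[of "f t" "Suc n"] that by simp
    then show "(\<lambda>n. (norm (f t - p (Suc n) (f t)))\<^sup>2) \<longlonglongrightarrow> 0"
      by (intro tendsto_eventually) (auto simp: eventually_sequentially)
  qed (use int1 in auto)
  then have "eventually (\<lambda>n. integral {0..T} (\<lambda>t. (norm (f t - p (Suc n) (f t)))\<^sup>2) < e / 4) sequentially"
    using e by (intro order_tendstoD(2)) auto
  then obtain m where m: "integral {0..T} (\<lambda>t. (norm (f t - p (Suc m) (f t)))\<^sup>2) < e / 4"
    by (auto simp: eventually_sequentially)
  define M where "M = real (Suc m)"
  have M: "M > 0" by (simp add: M_def)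
  obtain N G where N: "negligible N" and G: "\<And>n. continuous_on UNIV (G n)"
    and lim: "\<And>t. t \<notin> N \<Longrightarrow> (\<lambda>n. G n t) \<longlonglongrightarrow> (if t \<in> {0..T} then f t else 0)"
    using meas unfolding measurable_on_def by metis
  have pG: "continuous_on S (\<lambda>t. p M (G n t))" for n S
    using continuous_on_compose2[OF p_cont[OF M] G[of n]] continuous_on_subset by blast
  define k where "k n t = (norm (p M (f t) - p M (G n t)))\<^sup>2" for n t
  have kb: "\<bar>k n t\<bar> \<le> (2 * M)\<^sup>2" for n t
  proof -
    have "norm (p M (f t) - p M (G n t)) \<le> 2 * M"
      using norm_triangle_ineq4[of "p M (f t)" "p M (G n t)"] p_bound[OF M, of "f t"] p_bound[OF M, of "G n t"]
      by linarith
    then have "(norm (p M (f t) - p M (G n t)))\<^sup>2 \<le> (2 * M)\<^sup>2" by (intro power_mono) auto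
    then show ?thesis by (simp add: k_def)
  qed
  have int2: "k n integrable_on {0..T}" for n
  proof (rule measurable_on_real_integrable)
    have mG: "G n measurable_on {0..T}"
      using measurable_on_restrict[OF continuous_imp_measurable_on[OF G], of "{0..T}"]
        measurable_on_UNIV[of "{0..T}" "G n"] by simp
    have "continuous_on UNIV (\<lambda>x. (norm (p M (fst x) - p M (snd x)))\<^sup>2)"
      by (intro continuous_intros continuous_on_compose2[OF p_cont[OF M]]) auto
    then show "k n measurable_on {0..T}"
      unfolding k_def by (intro measurable_on_combine[OF meas mG, of "\<lambda>x y. (norm (p M x - p M y))\<^sup>2"]) (auto simp: p0)
  qed (use kb in auto)
  \<comment> \<open>On the null set \<open>N\<close> the continuous functions may fail to converge;
    setting the error to 0 there does not change its integral.\<close>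
  have "(\<lambda>n. integral {0..T} (\<lambda>t. if t \<in> N then 0 else k n t)) \<longlonglongrightarrow> integral {0..T} (\<lambda>t. 0)"
  proof (rule dominated_convergence(2)[where h="\<lambda>_. (2 * M)\<^sup>2"])
    show "(\<lambda>t. if t \<in> N then 0 else k n t) integrable_on {0..T}" for n
      by (rule integrable_spike[OF int2[of n] N]) auto
    show "norm (if t \<in> N then 0 else k n t) \<le> (2 * M)\<^sup>2" for n t
      using kb[of n t] by auto
    show "(\<lambda>n. if t \<in> N then 0 else k n t) \<longlonglongrightarrow> 0" if t: "t \<in> {0..T}" for t
    proof (cases "t \<in> N")
      case False
      then have "(\<lambda>n. p M (G n t)) \<longlonglongrightarrow> p M (f t)"
        using lim[OF False] t p_cont[OF M] by (auto simp: continuous_on_def intro: tendsto_compose)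
      then have "(\<lambda>n. k n t) \<longlonglongrightarrow> (norm (p M (f t) - p M (f t)))\<^sup>2"
        unfolding k_def by (intro tendsto_intros)
      then show ?thesis using False by simp
    qed auto
  qed auto
  moreover have "integral {0..T} (\<lambda>t. if t \<in> N then 0 else k n t) = integral {0..T} (k n)" for n
    by (rule integral_spike[OF N]) auto
  ultimately have "(\<lambda>n. integral {0..T} (k n)) \<longlonglongrightarrow> 0" by simp
  then have "eventually (\<lambda>n. integral {0..T} (k n) < e / 4) sequentially"
    using e by (intro order_tendstoD(2)) auto
  then obtain n where n: "integral {0..T} (k n) < e / 4"
    by (auto simp: eventually_sequentially)
  show ?case
  proof (intro exI conjI ballI)
    show "sq_approx 0 T (\<lambda>t. p M (G n t))" by (rule sq_approx_continuous[OF pG])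
    show "((\<lambda>t. 2 * (norm (f t - p M (f t)))\<^sup>2 + 2 * k n t) has_integral
        (2 * integral {0..T} (\<lambda>t. (norm (f t - p M (f t)))\<^sup>2) + 2 * integral {0..T} (k n))) {0..T}"
      by (intro has_integral_add has_integral_mult_right integrable_integral int1 int2 M)
    show "2 * integral {0..T} (\<lambda>t. (norm (f t - p M (f t)))\<^sup>2) + 2 * integral {0..T} (k n) < e"
      using m n by (simp add: M_def)
    show "(norm (f t - p M (G n t)))\<^sup>2 \<le> 2 * (norm (f t - p M (f t)))\<^sup>2 + 2 * k n t" for t
      using norm_add_square_le[of "f t - p M (f t)" "p M (f t) - p M (G n t)"] by (simp add: k_def)
  qed
qed

text \<open>The Cauchy criterion for tagged divisions: the Riemann sums of \<open>f\<close> and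
  \<open>g\<close> differ by at most a Riemann sum of \<open>k\<close>, which is close to the small
  number \<open>I\<close>. This gives integrability in any Banach space without a measurability
  argument.\<close>

lemma integrable_by_approx:
  fixes f :: "real \<Rightarrow> 'e::banach"
  assumes "\<And>e. e > 0 \<Longrightarrow> \<exists>g k I. g integrable_on {a..b} \<and> (k has_integral I) {a..b} \<and> I < e \<and>
     (\<forall>t\<in>{a..b}. norm (f t - g t) \<le> k t)"
  shows "f integrable_on {a..b}"
  unfolding integrable_Cauchy[of f a b, unfolded cbox_interval]
proof (intro allI impI)
  fix e :: real assume e: "e > 0"
  obtain g k I where g: "g integrable_on {a..b}" "(k has_integral I) {a..b}" "I < e / 6"
     "\<forall>t\<in>{a..b}. norm (f t - g t) \<le> k t"
    using assms[of "e / 6"] e by auto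
  let ?S = "\<lambda>h D. \<Sum>(x,K)\<in>D. measure lborel K *\<^sub>R h x"
  obtain c1 where c1: "gauge c1" "\<And>D1 D2. D1 tagged_division_of {a..b} \<and> c1 fine D1 \<and>
      D2 tagged_division_of {a..b} \<and> c1 fine D2 \<Longrightarrow> norm (?S g D1 - ?S g D2) < e / 3"
    using g(1)[unfolded integrable_Cauchy[of g a b, unfolded cbox_interval]] e
    by (metis divide_pos_pos zero_less_numeral)
  obtain c2 where c2: "gauge c2" "\<And>D. D tagged_division_of {a..b} \<and> c2 fine D \<Longrightarrow> norm (?S k D - I) < e / 6"
    using g(2)[unfolded has_integral[of k I a b, unfolded cbox_interval]] e
    by (metis divide_pos_pos zero_less_numeral)
  have est: "norm (?S f D - ?S g D) < e / 3" if D: "D tagged_division_of {a..b}" "c2 fine D" for D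
  proof -
    have "norm (?S f D - ?S g D) = norm (\<Sum>(x,K)\<in>D. measure lborel K *\<^sub>R (f x - g x))"
      by (simp add: sum_subtractf[symmetric] split_def algebra_simps)
    also have "\<dots> \<le> (\<Sum>(x,K)\<in>D. measure lborel K *\<^sub>R k x)"
    proof (rule sum_norm_le)
      fix y assume y: "y \<in> D"
      obtain x K where xK: "y = (x, K)" by (cases y)
      then have "x \<in> {a..b}" using tag_in_interval[OF D(1)[folded cbox_interval], of x K] y by auto
      then show "norm (case y of (x, K) \<Rightarrow> measure lborel K *\<^sub>R (f x - g x)) \<le> (case y of (x, K) \<Rightarrow> measure lborel K *\<^sub>R k x)"
        using g(4) xK by (auto intro!: mult_left_mono)
    qed
    also have "\<dots> < e / 3" using c2(2)[of D] D g(3) by (auto simp: abs_if split: if_splits)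
    finally show ?thesis .
  qed
  show "\<exists>\<gamma>. gauge \<gamma> \<and> (\<forall>D1 D2. D1 tagged_division_of {a..b} \<and> \<gamma> fine D1 \<and>
      D2 tagged_division_of {a..b} \<and> \<gamma> fine D2 \<longrightarrow> norm (?S f D1 - ?S f D2) < e)"
  proof (intro exI conjI allI impI)
    show "gauge (\<lambda>x. c1 x \<inter> c2 x)" using c1(1) c2(1) by (rule gauge_Int)
    fix D1 D2 assume "D1 tagged_division_of {a..b} \<and> (\<lambda>x. c1 x \<inter> c2 x) fine D1 \<and>
      D2 tagged_division_of {a..b} \<and> (\<lambda>x. c1 x \<inter> c2 x) fine D2"
    then have D: "D1 tagged_division_of {a..b}" "c1 fine D1" "c2 fine D1"
       "D2 tagged_division_of {a..b}" "c1 fine D2" "c2 fine D2"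
      by (auto simp: fine_Int)
    let ?x = "?S f D1 - ?S g D1" and ?y = "?S g D1 - ?S g D2" and ?z = "?S f D2 - ?S g D2"
    have "norm (?x + ?y - ?z) \<le> norm ?x + norm ?y + norm ?z"
      using norm_triangle_ineq4[of "?x + ?y" ?z] norm_triangle_ineq[of ?x ?y] by linarith
    moreover have "?x + ?y - ?z = ?S f D1 - ?S f D2" by simp
    ultimately have "norm (?S f D1 - ?S f D2) \<le> norm ?x + norm ?y + norm ?z" by metis
    then show "norm (?S f D1 - ?S f D2) < e"
      using est[OF D(1,3)] est[OF D(4,6)] c1(2)[of D1 D2] D by fastforce
  qed
qed

lemma norm_le_weighted_square:
  fixes x :: real assumes "\<eta> > 0"
  shows "x \<le> \<eta> / 2 + x\<^sup>2 / (2 * \<eta>)"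
proof -
  have "0 \<le> (x - \<eta>)\<^sup>2 / (2 * \<eta>)" using assms by simp
  also have "\<dots> = \<eta> / 2 + x\<^sup>2 / (2 * \<eta>) - x"
    using assms by (simp add: power2_eq_square field_simps)
  finally show ?thesis by simp
qed

lemma sq_approx_L1:
  assumes "sq_approx a b f" "e > 0"
  obtains g k I where "continuous_on UNIV g" "\<And>t. t \<le> a \<or> b \<le> t \<Longrightarrow> g t = 0"
    "(k has_integral I) {a..b}" "I < e" "\<And>t. t \<in> {a..b} \<Longrightarrow> norm (f t - g t) \<le> k t"
    "\<And>t. t \<in> {a..b} \<Longrightarrow> (norm (f t - g t))\<^sup>2 \<le> k t"
proof -
  define l where "l = \<bar>b - a\<bar> + 1"
  have l: "l > 0" by (simp add: l_def)
  \<comment> \<open>\<open>h\<close> is the weight in x <= h/2 + x^2/(2h); as \<open>l\<close>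
    exceeds the length of the interval, the constant h/2 integrates to at most \<open>e / 2\<close>.
    \<open>C\<close> covers both 1/(2h) and 1, so that one majorant serves the norm and its
    square.\<close>
  define h where "h = e / l"
  have h: "h > 0" using assms l by (simp add: h_def)
  define C where "C = 1 / (2 * h) + 1"
  have C: "C > 0" using h by (simp add: C_def add_pos_pos)
  obtain g k I where g: "continuous_on UNIV g" "\<And>t. t \<le> a \<or> b \<le> t \<Longrightarrow> g t = 0"
    "(k has_integral I) {a..b}" "I < e / 2 / C" "\<And>t. t \<in> {a..b} \<Longrightarrow> (norm (f t - g t))\<^sup>2 \<le> k t"
    using sq_approxE[OF assms(1), of "e / 2 / C"] C assms(2) by (metis divide_pos_pos zero_less_numeral)
  show thesis
  proof
    show "continuous_on UNIV g" "\<And>t. t \<le> a \<or> b \<le> t \<Longrightarrow> g t = 0" by fact+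
    have "((\<lambda>t. h / 2 + C * k t) has_integral (measure lborel {a..b} *\<^sub>R (h / 2) + C * I)) {a..b}"
      by (intro has_integral_add has_integral_mult_right g has_integral_const_real)
    then show "((\<lambda>t. h / 2 + C * k t) has_integral (measure lborel {a..b} * (h / 2) + C * I)) {a..b}" by simp
    have "measure lborel {a..b} \<le> l" by (simp add: l_def content_real_if)
    then have "measure lborel {a..b} * (h / 2) \<le> l * (h / 2)"
      using h by (intro mult_right_mono) auto
    also have "\<dots> = e / 2" using l by (simp add: h_def)
    finally show "measure lborel {a..b} * (h / 2) + C * I < e" using g(4) C by (simp add: field_simps)
    fix t assume t: "t \<in> {a..b}"
    have kt: "0 \<le> k t" using g(5)[OF t] zero_le_power2 order_trans by blast
    have "norm (f t - g t) \<le> h / 2 + k t / (2 * h)"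
      using norm_le_weighted_square[OF h, of "norm (f t - g t)"] divide_right_mono[OF g(5)[OF t], of "2 * h"] h
      by simp
    then show "norm (f t - g t) \<le> h / 2 + C * k t" using kt by (simp add: C_def algebra_simps)
    have "k t \<le> C * k t" using kt h by (simp add: C_def algebra_simps)
    then show "(norm (f t - g t))\<^sup>2 \<le> h / 2 + C * k t" using g(5)[OF t] h by linarith
  qed
qed

lemma sq_approx_integrable:
  fixes f :: "real \<Rightarrow> 'e::banach"
  assumes "sq_approx a b f"
  shows "f integrable_on {a..b}"
proof (rule integrable_by_approx, goal_cases)
  case (1 e)
  then obtain g k I where g: "continuous_on UNIV g" "(k has_integral I) {a..b}" "I < e"
    "\<And>t. t \<in> {a..b} \<Longrightarrow> norm (f t - g t) \<le> k t"
    using sq_approx_L1[OF assms] by metis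
  then show ?case
    using integrable_continuous_real continuous_on_subset subset_UNIV by metis
qed

lemma sq_approx_norm2_integrable:
  fixes f :: "real \<Rightarrow> 'e::real_normed_vector"
  assumes "sq_approx a b f"
  shows "(\<lambda>t. (norm (f t))\<^sup>2) integrable_on {a..b}"
proof (rule integrable_by_approx, goal_cases)
  case e: (1 e)
  obtain g0 k0 I0 where g0: "continuous_on UNIV g0" "(k0 has_integral I0) {a..b}"
     "\<And>t. t \<in> {a..b} \<Longrightarrow> (norm (f t - g0 t))\<^sup>2 \<le> k0 t"
    using sq_approxE[OF assms zero_less_one] by metis
  have g0i: "(\<lambda>t. (norm (g0 t))\<^sup>2) integrable_on {a..b}"
    by (intro integrable_continuous_real continuous_intros continuous_on_subset[OF g0(1)]) auto
  \<comment> \<open>A crude majorant of the squared norm from one fixed approximation. It stands in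
    for \<open>(norm (f t))\<^sup>2\<close>, whose integrability is still to be shown, when
    \<open>\<eta>\<close> is chosen.\<close>
  define q where "q t = 2 * k0 t + 2 * (norm (g0 t))\<^sup>2" for t
  have qf: "(norm (f t))\<^sup>2 \<le> q t" if "t \<in> {a..b}" for t
    using norm_add_square_le[of "f t - g0 t" "g0 t"] g0(3)[OF that] by (simp add: q_def)
  obtain J where J: "(q has_integral J) {a..b}" unfolding q_def
    using has_integral_add[OF has_integral_mult_right[OF g0(2)] has_integral_mult_right[OF integrable_integral[OF g0i]]]
    by meson
  define \<eta> where "\<eta> = e / (4 * (\<bar>J\<bar> + 1))"
  have \<eta>: "\<eta> > 0" using e by (simp add: \<eta>_def add_nonneg_pos)
  have \<eta>J: "\<eta> * J < e / 2"
  proof -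
    have "\<eta> * J \<le> \<eta> * (\<bar>J\<bar> + 1)" using \<eta> by (intro mult_left_mono) auto
    also have "\<dots> = e / 4" by (simp add: \<eta>_def field_simps)
    finally show ?thesis using e by simp
  qed
  define C where "C = 1 + 1 / \<eta>"
  have C: "C > 0" using \<eta> by (simp add: C_def add_pos_pos)
  obtain g k I where g: "continuous_on UNIV g" "(k has_integral I) {a..b}" "I < e / 2 / C"
    "\<And>t. t \<in> {a..b} \<Longrightarrow> (norm (f t - g t))\<^sup>2 \<le> k t"
    using sq_approxE[OF assms, of "e / 2 / C"] C e by (metis divide_pos_pos zero_less_numeral)
  show ?case
  proof (intro exI conjI ballI)
    show "(\<lambda>t. (norm (g t))\<^sup>2) integrable_on {a..b}"
      by (intro integrable_continuous_real continuous_intros continuous_on_subset[OF g(1)]) auto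
    show "((\<lambda>t. \<eta> * q t + C * k t) has_integral (\<eta> * J + C * I)) {a..b}"
      using J g(2) by (intro has_integral_add has_integral_mult_right)
    show "\<eta> * J + C * I < e" using \<eta>J g(3) C by (simp add: field_simps)
    fix t assume t: "t \<in> {a..b}"
    define x y d where "x = norm (f t)" and "y = norm (g t)" and "d = norm (f t - g t)"
    have xy: "\<bar>x - y\<bar> \<le> d" unfolding x_def y_def d_def by (rule norm_triangle_ineq3)
    have d0: "0 \<le> d" "0 \<le> x" "0 \<le> y" by (auto simp: x_def y_def d_def)
    have "\<bar>x\<^sup>2 - y\<^sup>2\<bar> = \<bar>x - y\<bar> * (x + y)"
      using d0 by (simp add: power2_eq_square square_diff_square_factored abs_mult)
    also have "\<dots> \<le> d * (2 * x + d)"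
      using xy d0 by (intro mult_mono) auto
    also have "\<dots> = d\<^sup>2 + 2 * d * x" by (simp add: power2_eq_square algebra_simps)
    also have "2 * d * x \<le> \<eta> * x\<^sup>2 + d\<^sup>2 / \<eta>"
    proof -
      have "0 \<le> (\<eta> * x - d)\<^sup>2 / \<eta>" using \<eta> by simp
      also have "\<dots> = \<eta> * x\<^sup>2 + d\<^sup>2 / \<eta> - 2 * d * x"
        using \<eta> by (simp add: power2_eq_square field_simps)
      finally show ?thesis by simp
    qed
    finally have "\<bar>x\<^sup>2 - y\<^sup>2\<bar> \<le> \<eta> * x\<^sup>2 + C * d\<^sup>2" by (simp add: C_def algebra_simps)
    also have "\<dots> \<le> \<eta> * q t + C * k t"
      using qf[OF t] g(4)[OF t] \<eta> C by (intro add_mono mult_left_mono) (auto simp: x_def d_def)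
    finally show "norm ((norm (f t))\<^sup>2 - (norm (g t))\<^sup>2) \<le> \<eta> * q t + C * k t"
      by (simp add: x_def y_def)
  qed
qed

text \<open>Strong continuity and a common bound suffice: for continuous \<open>g\<close>, the value
  \<open>M s (g s)\<close> splits into \<open>M s (g s - g s0)\<close>, controlled by the bound, and
  \<open>M s (g s0)\<close>, controlled by strong continuity. Semigroups under an integral sign act
  in this way.\<close>

lemma sq_approx_multiplier:
  fixes f :: "real \<Rightarrow> 'e::real_normed_vector" and M :: "real \<Rightarrow> 'e \<Rightarrow> 'f::real_normed_vector"
  assumes f: "sq_approx a b f"
    and lin: "\<And>s. s \<in> {a..b} \<Longrightarrow> linear (M s)"
    and bound: "\<And>s x. s \<in> {a..b} \<Longrightarrow> norm (M s x) \<le> C * norm x"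
    and cont: "\<And>x. continuous_on {a..b} (\<lambda>s. M s x)"
  shows "sq_approx a b (\<lambda>s. M s (f s))"
proof (rule sq_approx_trans)
  define C' where "C' = C\<^sup>2 + 1"
  have C': "C' > 0" by (simp add: C'_def add_nonneg_pos)
  fix e :: real assume e: "e > 0"
  obtain g k I where g: "continuous_on UNIV g" "(k has_integral I) {a..b}" "I < e / C'"
    "\<And>t. t \<in> {a..b} \<Longrightarrow> (norm (f t - g t))\<^sup>2 \<le> k t"
    using sq_approxE[OF f, of "e / C'"] C' e by (metis divide_pos_pos)
  have "continuous_on {a..b} (\<lambda>s. M s (g s))"
    unfolding continuous_on_def
  proof
    fix s0 assume s0: "s0 \<in> {a..b}"
    have "((\<lambda>s. M s (g s - g s0)) \<longlongrightarrow> 0) (at s0 within {a..b})"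
    proof (rule Lim_null_comparison)
      show "\<forall>\<^sub>F s in at s0 within {a..b}. norm (M s (g s - g s0)) \<le> C * norm (g s - g s0)"
        using bound by (auto simp: eventually_at_filter)
      have "(g \<longlongrightarrow> g s0) (at s0 within {a..b})"
        using g(1) by (metis UNIV_I continuous_on_def tendsto_within_subset top_greatest)
      then have "((\<lambda>s. C * norm (g s - g s0)) \<longlongrightarrow> C * norm (g s0 - g s0)) (at s0 within {a..b})"
        by (intro tendsto_intros)
      then show "((\<lambda>s. C * norm (g s - g s0)) \<longlongrightarrow> 0) (at s0 within {a..b})" by simp
    qed
    moreover have "((\<lambda>s. M s (g s0)) \<longlongrightarrow> M s0 (g s0)) (at s0 within {a..b})"
      using cont s0 by (simp add: continuous_on_def)
    ultimately have "((\<lambda>s. M s (g s - g s0) + M s (g s0)) \<longlongrightarrow> 0 + M s0 (g s0)) (at s0 within {a..b})"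
      by (rule tendsto_add)
    moreover have "\<forall>\<^sub>F s in at s0 within {a..b}. M s (g s - g s0) + M s (g s0) = M s (g s)"
      using linear_diff[OF lin] by (auto simp: eventually_at_filter)
    ultimately show "((\<lambda>s. M s (g s)) \<longlongrightarrow> M s0 (g s0)) (at s0 within {a..b})"
      by (auto intro: Lim_transform_eventually)
  qed
  then have h: "sq_approx a b (\<lambda>s. M s (g s))" by (rule sq_approx_continuous)
  show "\<exists>h k I. sq_approx a b h \<and> (k has_integral I) {a..b} \<and> I < e \<and>
     (\<forall>t\<in>{a..b}. (norm (M t (f t) - h t))\<^sup>2 \<le> k t)"
  proof (intro exI conjI ballI)
    show "sq_approx a b (\<lambda>s. M s (g s))" by fact
    show "((\<lambda>t. C' * k t) has_integral (C' * I)) {a..b}" using g(2) by (rule has_integral_mult_right)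
    show "C' * I < e" using g(3) C' by (simp add: field_simps)
    fix t assume t: "t \<in> {a..b}"
    have "(norm (M t (f t) - M t (g t)))\<^sup>2 = (norm (M t (f t - g t)))\<^sup>2"
      using linear_diff[OF lin[OF t]] by simp
    also have "\<dots> \<le> (C * norm (f t - g t))\<^sup>2" using bound[OF t] by (intro power_mono) auto
    also have "\<dots> \<le> C' * (norm (f t - g t))\<^sup>2" by (simp add: C'_def power_mult_distrib algebra_simps)
    also have "\<dots> \<le> C' * k t" using g(4)[OF t] C' by (intro mult_left_mono) auto
    finally show "(norm (M t (f t) - M t (g t)))\<^sup>2 \<le> C' * k t" .
  qed
qed

lemma sq_approx_bounded_linear:
  assumes "bounded_linear L" "sq_approx a b f"
  shows "sq_approx a b (\<lambda>t. L (f t))"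
proof -
  obtain C where C: "\<And>x. norm (L x) \<le> C * norm x"
    using bounded_linear.bounded[OF assms(1)] by (metis mult.commute)
  show ?thesis
    by (rule sq_approx_multiplier[OF assms(2), of "\<lambda>_. L" C])
       (use C bounded_linear.linear[OF assms(1)] in auto)
qed

lemma sq_approx_add:
  assumes "sq_approx a b f" "sq_approx a b h"
  shows "sq_approx a b (\<lambda>t. f t + h t)"
  unfolding sq_approx_def
proof (intro allI impI, goal_cases)
  case (1 e)
  then have e4: "e / 4 > 0" by simp
  obtain g k I where g: "continuous_on UNIV g" "\<And>t. t \<le> a \<or> b \<le> t \<Longrightarrow> g t = 0"
    "(k has_integral I) {a..b}" "I < e / 4" "\<And>t. t \<in> {a..b} \<Longrightarrow> (norm (f t - g t))\<^sup>2 \<le> k t"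
    using sq_approxE[OF assms(1) e4] by metis
  obtain g' k' I' where g': "continuous_on UNIV g'" "\<And>t. t \<le> a \<or> b \<le> t \<Longrightarrow> g' t = 0"
    "(k' has_integral I') {a..b}" "I' < e / 4" "\<And>t. t \<in> {a..b} \<Longrightarrow> (norm (h t - g' t))\<^sup>2 \<le> k' t"
    using sq_approxE[OF assms(2) e4] by metis
  show ?case
  proof (intro exI conjI ballI allI impI)
    show "continuous_on UNIV (\<lambda>t. g t + g' t)" by (intro continuous_intros g g')
    show "((\<lambda>t. 2 * k t + 2 * k' t) has_integral (2 * I + 2 * I')) {a..b}"
      using g(3) g'(3) by (intro has_integral_add has_integral_mult_right)
    show "2 * I + 2 * I' < e" using g(4) g'(4) by simp
    fix t assume t: "t \<in> {a..b}"
    show "(norm (f t + h t - (g t + g' t)))\<^sup>2 \<le> 2 * k t + 2 * k' t"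
      using norm_add_square_le[of "f t - g t" "h t - g' t"] g(5)[OF t] g'(5)[OF t]
      by (simp add: add_diff_add)
  qed (simp add: g g')
qed

lemma sq_approx_minus: "sq_approx a b f \<Longrightarrow> sq_approx a b (\<lambda>t. - f t)"
  by (rule sq_approx_bounded_linear[OF bounded_linear_minus[OF bounded_linear_ident]])

lemma sq_approx_diff: "sq_approx a b f \<Longrightarrow> sq_approx a b h \<Longrightarrow> sq_approx a b (\<lambda>t. f t - h t)"
  using sq_approx_add[of a b f "\<lambda>t. - h t"] sq_approx_minus by auto

lemma sq_approx_Pair:
  assumes "sq_approx a b f" "sq_approx a b h"
  shows "sq_approx a b (\<lambda>t. (f t, h t))"
proof -
  have "sq_approx a b (\<lambda>t. (f t, 0) + (0, h t))"
    by (intro sq_approx_add sq_approx_bounded_linear[OF _ assms(1)] sq_approx_bounded_linear[OF _ assms(2)]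
        bounded_linear_Pair bounded_linear_ident bounded_linear_zero)
  then show ?thesis by simp
qed

lemma sq_approx_inner_integrable:
  fixes f h :: "real \<Rightarrow> 'e::real_inner"
  assumes "sq_approx a b f" "sq_approx a b h"
  shows "(\<lambda>t. inner (f t) (h t)) integrable_on {a..b}"
proof -
  have "inner (f t) (h t) = ((norm (f t + h t))\<^sup>2 - (norm (f t))\<^sup>2 - (norm (h t))\<^sup>2) / 2" for t
    by (simp add: power2_norm_eq_inner inner_add inner_commute)
  then show ?thesis
    by (simp only:) (intro integrable_on_divide integrable_diff sq_approx_norm2_integrable sq_approx_add assms)
qed

lemma has_integral_shift_real:
  fixes f :: "real \<Rightarrow> 'e::real_normed_vector"
  shows "((\<lambda>t. f (t - c)) has_integral I) {a + c..b + c} \<longleftrightarrow> (f has_integral I) {a..b}"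
  using has_integral_affinity_iff[of 1 f "-c" I a b] by simp

lemma sq_approx_shift:
  assumes "sq_approx a b f"
  shows "sq_approx (a + c) (b + c) (\<lambda>t. f (t - c))"
  unfolding sq_approx_def
proof (intro allI impI, goal_cases)
  case (1 e)
  then obtain g k I where g: "continuous_on UNIV g" "\<And>t. t \<le> a \<or> b \<le> t \<Longrightarrow> g t = 0"
    "(k has_integral I) {a..b}" "I < e" "\<And>t. t \<in> {a..b} \<Longrightarrow> (norm (f t - g t))\<^sup>2 \<le> k t"
    using sq_approxE[OF assms] by metis
  show ?case
  proof (intro exI conjI ballI allI impI)
    show "continuous_on UNIV (\<lambda>t. g (t - c))"
      by (intro continuous_on_compose2[OF g(1)] continuous_intros) auto
    show "((\<lambda>t. k (t - c)) has_integral I) {a + c..b + c}"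
      using g(3) by (simp add: has_integral_shift_real)
    show "(norm (f (t - c) - g (t - c)))\<^sup>2 \<le> k (t - c)" if "t \<in> {a + c..b + c}" for t
      using that by (intro g(5)) auto
    show "g (t - c) = 0" if "t \<le> a + c \<or> b + c \<le> t" for t using that by (intro g(2)) auto
  qed (use g in simp)
qed

lemma has_integral_glue:
  fixes f :: "real \<Rightarrow> 'e::banach"
  assumes "a \<le> b" "b \<le> c" "(f has_integral I) {a..b}" "(h has_integral J) {b..c}"
  shows "((\<lambda>t. if t \<le> b then f t else h t) has_integral (I + J)) {a..c}"
proof (rule has_integral_combine[OF assms(1,2)])
  show "((\<lambda>t. if t \<le> b then f t else h t) has_integral I) {a..b}"
    by (rule has_integral_eq[OF _ assms(3)]) auto
  show "((\<lambda>t. if t \<le> b then f t else h t) has_integral J) {b..c}"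
    by (rule has_integral_spike[OF _ _ assms(4), of "{b}"]) auto
qed

text \<open>Here it matters that approximants vanish outside their interval: the sum of two of them
  is continuous across \<open>b\<close> although \<open>f\<close> and \<open>h\<close> need not
  match there.\<close>

lemma sq_approx_glue:
  assumes "a \<le> b" "b \<le> c" "sq_approx a b f" "sq_approx b c h"
  shows "sq_approx a c (\<lambda>t. if t \<le> b then f t else h t)"
  unfolding sq_approx_def
proof (intro allI impI, goal_cases)
  case (1 e)
  then have e2: "e / 2 > 0" by simp
  obtain g k I where g: "continuous_on UNIV g" "\<And>t. t \<le> a \<or> b \<le> t \<Longrightarrow> g t = 0"
    "(k has_integral I) {a..b}" "I < e / 2" "\<And>t. t \<in> {a..b} \<Longrightarrow> (norm (f t - g t))\<^sup>2 \<le> k t"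
    using sq_approxE[OF assms(3) e2] by metis
  obtain g' k' I' where g': "continuous_on UNIV g'" "\<And>t. t \<le> b \<or> c \<le> t \<Longrightarrow> g' t = 0"
    "(k' has_integral I') {b..c}" "I' < e / 2" "\<And>t. t \<in> {b..c} \<Longrightarrow> (norm (h t - g' t))\<^sup>2 \<le> k' t"
    using sq_approxE[OF assms(4) e2] by metis
  show ?case
  proof (intro exI conjI ballI allI impI)
    show "continuous_on UNIV (\<lambda>t. g t + g' t)" by (intro continuous_intros g g')
    show "((\<lambda>t. if t \<le> b then k t else k' t) has_integral (I + I')) {a..c}"
      by (rule has_integral_glue[OF assms(1,2) g(3) g'(3)])
    show "I + I' < e" using g(4) g'(4) by simp
    show "(norm ((if t \<le> b then f t else h t) - (g t + g' t)))\<^sup>2 \<le> (if t \<le> b then k t else k' t)"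
      if t: "t \<in> {a..c}" for t
      using g(2)[of t] g'(2)[of t] g(5)[of t] g'(5)[of t] t by auto
    show "g t + g' t = 0" if "t \<le> a \<or> c \<le> t" for t
      using that g(2)[of t] g'(2)[of t] assms(1,2) by auto
  qed
qed

section \<open>Fourier series and Parseval\<close>

lemma scaleC_one [simp]: "(1::complex) *\<^sub>C x = x"
  using scaleC_of_real[of 1 x] by simp

lemma scaleC_zero_left [simp]: "(0::complex) *\<^sub>C x = 0"
  using scaleC_of_real[of 0 x] by simp

lemma scaleC_zero_right [simp]: "c *\<^sub>C 0 = 0"
  using scaleC_add_right[of c 0 0] by simp

lemma scaleC_minus_right [simp]: "c *\<^sub>C (- x) = - (c *\<^sub>C x)"
  using scaleC_add_right[of c x "-x"] by (simp add: add_eq_0_iff)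

lemma scaleC_minus_left [simp]: "(- c) *\<^sub>C x = - (c *\<^sub>C x)"
  using scaleC_add_left[of c "-c" x] by (simp add: add_eq_0_iff)

lemma scaleC_diff_right: "c *\<^sub>C (x - y) = c *\<^sub>C x - c *\<^sub>C (y::'a::chilbert_space)"
  using scaleC_add_right[of c x "-y"] by simp

lemma scaleC_scaleR: "c *\<^sub>C (r *\<^sub>R x) = r *\<^sub>R (c *\<^sub>C (x::'a::chilbert_space))"
  by (metis mult.commute scaleC_of_real scaleC_scaleC)

lemma cinner_scaleC_right: "cinner x (c *\<^sub>C y) = cnj c * cinner x y"
  by (metis cinner_commute cinner_scaleC_left complex_cnj_mult)

lemma inner_scaleC_left: "inner (c *\<^sub>C x) y = inner x (cnj c *\<^sub>C (y::'a::chilbert_space))"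
  by (simp add: Re_cinner[symmetric] cinner_scaleC_left cinner_scaleC_right)

lemma norm_scaleC: "norm (c *\<^sub>C x) = cmod c * norm (x::'a::chilbert_space)"
proof -
  have "(norm (c *\<^sub>C x))\<^sup>2 = inner ((cnj c * c) *\<^sub>C x) x"
    by (simp add: power2_norm_eq_inner inner_scaleC_left scaleC_scaleC inner_commute)
  also have "(cnj c * c) *\<^sub>C x = (cmod c)\<^sup>2 *\<^sub>R x"
    by (metis complex_norm_square mult.commute of_real_power scaleC_of_real)
  finally have "(norm (c *\<^sub>C x))\<^sup>2 = (cmod c * norm x)\<^sup>2"
    by (simp add: power2_norm_eq_inner power_mult_distrib)
  then show ?thesis by (simp add: power2_eq_iff_nonneg)
qed

lemma bounded_bilinear_scaleC: "bounded_bilinear (\<lambda>c (x::'a::chilbert_space). c *\<^sub>C x)"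
proof
  show "(a + a') *\<^sub>C b = a *\<^sub>C b + a' *\<^sub>C b" for a a' and b :: 'a by (rule scaleC_add_left)
  show "a *\<^sub>C (b + b') = a *\<^sub>C b + a *\<^sub>C b'" for a and b b' :: 'a by (rule scaleC_add_right)
  show "(r *\<^sub>R a) *\<^sub>C b = r *\<^sub>R a *\<^sub>C b" for r a and b :: 'a
    by (simp add: scaleR_conv_of_real scaleC_scaleC[symmetric] scaleC_of_real)
  show "a *\<^sub>C r *\<^sub>R b = r *\<^sub>R a *\<^sub>C b" for r a and b :: 'a by (rule scaleC_scaleR)
  show "\<exists>K. \<forall>a (b::'a). norm (a *\<^sub>C b) \<le> norm a * norm b * K"
    by (intro exI[of _ 1]) (simp add: norm_scaleC)
qed

lemmas continuous_on_scaleC [continuous_intros] = bounded_bilinear.continuous_on[OF bounded_bilinear_scaleC]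
lemmas bounded_linear_scaleC_right = bounded_bilinear.bounded_linear_right[OF bounded_bilinear_scaleC]
lemmas bounded_linear_scaleC_left = bounded_bilinear.bounded_linear_left[OF bounded_bilinear_scaleC]

lemma sq_approx_scaleC:
  fixes f :: "real \<Rightarrow> 'e::chilbert_space"
  assumes c: "continuous_on {a..b} c" and "sq_approx a b f"
  shows "sq_approx a b (\<lambda>t. c t *\<^sub>C f t)"
proof -
  have "bounded (c ` {a..b})"
    using c by (intro compact_imp_bounded compact_continuous_image) auto
  then obtain C where "\<forall>z\<in>c ` {a..b}. cmod z \<le> C" unfolding bounded_iff by blast
  then have C: "cmod (c t) \<le> C" if "t \<in> {a..b}" for t using that by blast
  show ?thesis
  proof (rule sq_approx_multiplier[OF assms(2), where M="\<lambda>t x. c t *\<^sub>C x" and C=C])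
    show "linear (\<lambda>x::'e. c s *\<^sub>C x)" for s
      using bounded_linear_scaleC_right bounded_linear.linear by blast
    show "norm (c s *\<^sub>C x) \<le> C * norm x" if "s \<in> {a..b}" for s and x :: 'e
      using C[OF that] by (simp add: norm_scaleC mult_right_mono)
    show "continuous_on {a..b} (\<lambda>s. c s *\<^sub>C x)" for x :: 'e
      using c by (intro continuous_intros)
  qed
qed

text \<open>State, control and auxiliary control are packed into one Hilbert space vector, so that
  the payoff is the quadratic form of a single operator and Parseval applies to it directly.\<close>

instantiation prod :: (chilbert_space, chilbert_space) chilbert_space
begin

definition scaleC_prod :: "complex \<Rightarrow> 'a \<times> 'b \<Rightarrow> 'a \<times> 'b" where
  "scaleC_prod c x = (c *\<^sub>C fst x, c *\<^sub>C snd x)"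

definition cinner_prod :: "'a \<times> 'b \<Rightarrow> 'a \<times> 'b \<Rightarrow> complex" where
  "cinner_prod x y = cinner (fst x) (fst y) + cinner (snd x) (snd y)"

instance
proof
  fix x y z :: "'a \<times> 'b" and c d :: complex and r :: real
  show "cinner x y = cnj (cinner y x)"
    using cinner_commute[of "fst x" "fst y"] cinner_commute[of "snd x" "snd y"] by (simp add: cinner_prod_def)
qed (simp_all add: scaleC_prod_def cinner_prod_def scaleC_add_right scaleC_add_left scaleC_scaleC
    scaleC_of_real scaleR_prod_def cinner_add_left cinner_scaleC_left Re_cinner inner_prod_def algebra_simps)

end

section \<open>Fourier modes and coefficients\<close>

definition fourier_mode :: "real \<Rightarrow> int \<Rightarrow> real \<Rightarrow> complex" where
  "fourier_mode T k t = cis (2 * pi * of_int k / T * t)"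

definition fourier_coeff :: "real \<Rightarrow> (real \<Rightarrow> 'e::chilbert_space) \<Rightarrow> int \<Rightarrow> 'e" where
  "fourier_coeff T f k = (1 / T) *\<^sub>R integral {0..T} (\<lambda>t. fourier_mode T (-k) t *\<^sub>C f t)"

lemma continuous_on_fourier_mode [continuous_intros]:
  "continuous_on S (fourier_mode T k)"
  unfolding fourier_mode_def cis_conv_exp by (intro continuous_intros)

lemma fourier_mode_0 [simp]: "fourier_mode T 0 t = 1" "fourier_mode T k 0 = 1"
  by (auto simp: fourier_mode_def)

lemma fourier_mode_period: "T > 0 \<Longrightarrow> fourier_mode T k T = 1"
  by (simp add: fourier_mode_def)

lemma fourier_mode_mult: "fourier_mode T k t * fourier_mode T l t = fourier_mode T (k + l) t"
  by (simp add: fourier_mode_def cis_mult add_divide_distrib ring_distribs)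

lemma fourier_mode_cnj: "cnj (fourier_mode T k t) = fourier_mode T (-k) t"
  by (simp add: fourier_mode_def cis_cnj)

lemma fourier_mode_has_vector_derivative:
  "(fourier_mode T k has_vector_derivative (\<i> * of_real (2 * pi * of_int k / T) * fourier_mode T k t)) (at t within S)"
proof -
  define w where "w = 2 * pi * of_int k / T"
  let ?c = "\<i> * of_real w"
  have "((\<lambda>z. exp (?c * z)) has_field_derivative (?c * exp (?c * of_real t))) (at (of_real t))"
    by (auto intro!: derivative_eq_intros)
  from has_vector_derivative_real_field[OF this] show ?thesis
    unfolding fourier_mode_def[abs_def] cis_conv_exp w_def[symmetric] by (simp add: mult.assoc)
qed

lemma integral_fourier_mode:
  assumes "T > 0"
  shows "(fourier_mode T k has_integral (if k = 0 then of_real T else 0)) {0..T}"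
proof (cases "k = 0")
  case True
  have "((\<lambda>t. 1::complex) has_integral of_real T) {0..T}"
    using has_integral_const_real[of "1::complex" 0 T] assms by (simp add: scaleR_conv_of_real)
  then show ?thesis using True by (simp add: fourier_mode_0[abs_def])
next
  case False
  define c where "c = \<i> * of_real (2 * pi * of_int k / T)"
  have c: "c \<noteq> 0" using False assms by (simp add: c_def)
  have "((\<lambda>t. fourier_mode T k t / c) has_vector_derivative fourier_mode T k t) (at t within {0..T})" for t
    using has_vector_derivative_divide[OF fourier_mode_has_vector_derivative[of T k t "{0..T}"], of c] c
    unfolding c_def[symmetric] by simp
  then have "(fourier_mode T k has_integral (fourier_mode T k T / c - fourier_mode T k 0 / c)) {0..T}"
    using assms by (intro fundamental_theorem_of_calculus) auto
  then show ?thesis using False fourier_mode_period[OF assms] by simp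
qed

lemma fourier_integrable:
  "sq_approx 0 T f \<Longrightarrow> (\<lambda>t. fourier_mode T k t *\<^sub>C f t) integrable_on {0..T}"
  by (intro sq_approx_integrable sq_approx_scaleC continuous_on_fourier_mode)

lemma fourier_coeff_linear:
  assumes "bounded_clinear L" "sq_approx 0 T f"
  shows "fourier_coeff T (\<lambda>t. L (f t)) k = L (fourier_coeff T f k)"
proof -
  have L: "bounded_linear L" and Lc: "\<And>c x. L (c *\<^sub>C x) = c *\<^sub>C L x"
    using assms(1) by (auto simp: bounded_clinear_def)
  have "integral {0..T} (\<lambda>t. L (fourier_mode T (-k) t *\<^sub>C f t)) = L (integral {0..T} (\<lambda>t. fourier_mode T (-k) t *\<^sub>C f t))"
    using integral_linear[OF fourier_integrable[OF assms(2)] L] by (simp add: o_def)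
  then show ?thesis by (simp add: fourier_coeff_def Lc linear_scale[OF bounded_linear.linear[OF L]])
qed

lemma fourier_coeff_add:
  assumes "sq_approx 0 T f" "sq_approx 0 T g"
  shows "fourier_coeff T (\<lambda>t. f t + g t) k = fourier_coeff T f k + fourier_coeff T g k"
  using assms by (simp add: fourier_coeff_def scaleC_add_right integral_add fourier_integrable scaleR_add_right)

lemma fourier_coeff_mode:
  assumes "T > 0"
  shows "fourier_coeff T (\<lambda>t. fourier_mode T l t *\<^sub>C c) k = (if k = l then c else 0)"
proof -
  have "((\<lambda>t. fourier_mode T (l - k) t *\<^sub>C c) has_integral ((if l - k = 0 then of_real T else 0) *\<^sub>C c)) {0..T}"
    using has_integral_linear[OF integral_fourier_mode[OF assms, of "l - k"] bounded_linear_scaleC_left[of c]]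
    unfolding o_def .
  moreover have "fourier_mode T (-k) t *\<^sub>C fourier_mode T l t *\<^sub>C c = fourier_mode T (l - k) t *\<^sub>C c" for t
    by (simp add: scaleC_scaleC fourier_mode_mult)
  ultimately have "integral {0..T} (\<lambda>t. fourier_mode T (-k) t *\<^sub>C fourier_mode T l t *\<^sub>C c) =
      (if l - k = 0 then of_real T else 0) *\<^sub>C c"
    by (simp only: integral_unique)
  then show ?thesis using assms by (auto simp: fourier_coeff_def scaleC_of_real)
qed

definition trig_sum :: "real \<Rightarrow> int set \<Rightarrow> (int \<Rightarrow> 'e::chilbert_space) \<Rightarrow> real \<Rightarrow> 'e" where
  "trig_sum T K c t = (\<Sum>k\<in>K. fourier_mode T k t *\<^sub>C c k)"

lemma continuous_on_trig_sum: "continuous_on S (trig_sum T K c)"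
  unfolding trig_sum_def by (intro continuous_intros)

lemma sq_approx_trig_sum: "sq_approx a b (trig_sum T K c)"
  by (intro sq_approx_continuous continuous_on_trig_sum)

lemma fourier_coeff_trig_sum:
  assumes "T > 0" "finite K"
  shows "fourier_coeff T (trig_sum T K c) k = (if k \<in> K then c k else 0)"
  using assms(2)
proof (induction K rule: finite_induct)
  case empty
  then show ?case by (simp add: trig_sum_def fourier_coeff_def)
next
  case (insert l K)
  have "trig_sum T (insert l K) c = (\<lambda>t. fourier_mode T l t *\<^sub>C c l + trig_sum T K c t)"
    using insert by (auto simp: trig_sum_def)
  then have "fourier_coeff T (trig_sum T (insert l K) c) k =
      fourier_coeff T (\<lambda>t. fourier_mode T l t *\<^sub>C c l) k + fourier_coeff T (trig_sum T K c) k"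
    by (simp only:) (intro fourier_coeff_add sq_approx_trig_sum sq_approx_continuous continuous_intros)
  then show ?case using insert by (auto simp: fourier_coeff_mode[OF assms(1)])
qed

lemma integral_inner_trig_sum:
  assumes "T > 0" "finite K" "sq_approx 0 T f"
  shows "((\<lambda>t. inner (f t) (trig_sum T K c t)) has_integral (T * (\<Sum>k\<in>K. inner (fourier_coeff T f k) (c k)))) {0..T}"
proof -
  have "((\<lambda>t. inner (f t) (fourier_mode T k t *\<^sub>C c k)) has_integral (T * inner (fourier_coeff T f k) (c k))) {0..T}" for k
  proof -
    have "((\<lambda>t. inner (fourier_mode T (-k) t *\<^sub>C f t) (c k)) has_integral
        inner (integral {0..T} (\<lambda>t. fourier_mode T (-k) t *\<^sub>C f t)) (c k)) {0..T}"
      using has_integral_linear[OF integrable_integral[OF fourier_integrable[OF assms(3)]] bounded_linear_inner_left]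
      by (simp add: o_def)
    moreover have "inner (fourier_mode T (-k) t *\<^sub>C f t) (c k) = inner (f t) (fourier_mode T k t *\<^sub>C c k)" for t
      by (simp add: inner_scaleC_left fourier_mode_cnj)
    ultimately show ?thesis using assms(1) by (simp add: fourier_coeff_def)
  qed
  then have "((\<lambda>t. \<Sum>k\<in>K. inner (f t) (fourier_mode T k t *\<^sub>C c k)) has_integral (\<Sum>k\<in>K. T * inner (fourier_coeff T f k) (c k))) {0..T}"
    by (rule has_integral_sum[OF assms(2)])
  then show ?thesis by (simp add: trig_sum_def inner_sum_right sum_distrib_left)
qed

text \<open>Orthogonality completes the square. Taking the Fourier coefficients for \<open>c\<close>
  gives Bessel's inequality; general \<open>c\<close> shows that no other trigonometric sum over
  \<open>K\<close> is closer to \<open>f\<close>.\<close>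

lemma integral_trig_sum_distance:
  assumes "T > 0" "finite K" "sq_approx 0 T f"
  shows "integral {0..T} (\<lambda>t. (norm (f t - trig_sum T K c t))\<^sup>2) =
    integral {0..T} (\<lambda>t. (norm (f t))\<^sup>2) - T * (\<Sum>k\<in>K. (norm (fourier_coeff T f k))\<^sup>2)
      + T * (\<Sum>k\<in>K. (norm (fourier_coeff T f k - c k))\<^sup>2)"
proof (rule integral_unique)
  let ?p = "trig_sum T K c"
  have A: "((\<lambda>t. (norm (f t))\<^sup>2 - 2 * inner (f t) (?p t) + inner (?p t) (?p t)) has_integral
     (integral {0..T} (\<lambda>t. (norm (f t))\<^sup>2) - 2 * (T * (\<Sum>k\<in>K. inner (fourier_coeff T f k) (c k)))
      + T * (\<Sum>k\<in>K. inner (fourier_coeff T ?p k) (c k)))) {0..T}"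
    by (intro has_integral_add has_integral_diff has_integral_mult_right integral_inner_trig_sum assms
        sq_approx_trig_sum integrable_integral sq_approx_norm2_integrable)
  have B: "(norm (f t))\<^sup>2 - 2 * inner (f t) (?p t) + inner (?p t) (?p t) = (norm (f t - ?p t))\<^sup>2" for t
    by (simp add: power2_norm_eq_inner inner_diff inner_commute)
  have C: "(\<Sum>k\<in>K. inner (fourier_coeff T ?p k) (c k)) = (\<Sum>k\<in>K. (norm (c k))\<^sup>2)"
    by (intro sum.cong) (simp_all add: fourier_coeff_trig_sum assms power2_norm_eq_inner)
  have D: "(\<Sum>k\<in>K. (norm (fourier_coeff T f k - c k))\<^sup>2) = (\<Sum>k\<in>K. (norm (fourier_coeff T f k))\<^sup>2)
      - 2 * (\<Sum>k\<in>K. inner (fourier_coeff T f k) (c k)) + (\<Sum>k\<in>K. (norm (c k))\<^sup>2)"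
    by (simp add: power2_norm_eq_inner inner_diff inner_commute sum_subtractf sum.distrib sum_distrib_left algebra_simps)
  show "((\<lambda>t. (norm (f t - ?p t))\<^sup>2) has_integral
     (integral {0..T} (\<lambda>t. (norm (f t))\<^sup>2) - T * (\<Sum>k\<in>K. (norm (fourier_coeff T f k))\<^sup>2)
      + T * (\<Sum>k\<in>K. (norm (fourier_coeff T f k - c k))\<^sup>2))) {0..T}"
    using A unfolding B C D by (simp add: algebra_simps)
qed

section \<open>Density of trigonometric sums\<close>

inductive trig_poly :: "real \<Rightarrow> (real \<Rightarrow> complex) \<Rightarrow> bool" for T where
  mode: "trig_poly T (\<lambda>t. c * fourier_mode T k t)"
| add: "trig_poly T p \<Longrightarrow> trig_poly T q \<Longrightarrow> trig_poly T (\<lambda>t. p t + q t)"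

lemma trig_poly_mult:
  assumes "trig_poly T p" "trig_poly T q"
  shows "trig_poly T (\<lambda>t. p t * q t)"
  using assms(1)
proof (induction rule: trig_poly.induct)
  case (mode c k)
  show ?case using assms(2)
  proof (induction rule: trig_poly.induct)
    case (mode d l)
    have "(\<lambda>t. c * fourier_mode T k t * (d * fourier_mode T l t)) = (\<lambda>t. (c * d) * fourier_mode T (k + l) t)"
      by (simp add: fun_eq_iff fourier_mode_mult[symmetric])
    then show ?case by (simp only: trig_poly.mode)
  next
    case (add p q)
    then show ?case using trig_poly.add by (simp add: distrib_left)
  qed
next
  case (add p q)
  then show ?case using trig_poly.add by (simp add: distrib_right)
qed

text \<open>Products of modes are modes, so only linear functions on the plane need an argument:
  they are combinations of \<open>z\<close> and \<open>cnj z\<close>, and conjugating mode 1 gives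
  mode -1. This carries Stone-Weierstrass on the circle over to trigonometric polynomials.\<close>

lemma trig_poly_real_polynomial:
  assumes "real_polynomial_function g"
  shows "trig_poly T (\<lambda>t. of_real (g (fourier_mode T 1 t)))"
  using assms
proof (induction rule: real_polynomial_function.induct)
  case (linear f)
  let ?a = "complex_of_real (f 1)" and ?b = "complex_of_real (f \<i>)"
  have f_eq: "of_real (f z) = (?a / 2 - \<i> * ?b / 2) * z + (?a / 2 + \<i> * ?b / 2) * cnj z" for z
  proof -
    have "f z = f (Re z *\<^sub>R 1 + Im z *\<^sub>R \<i>)"
      by (rule arg_cong[of _ _ f]) (simp add: complex_eq_iff)
    also have "\<dots> = Re z * f 1 + Im z * f \<i>"
      using linear by (simp only: linear_simps real_scaleR_def)
    finally show ?thesis by (simp add: complex_eq_iff algebra_simps)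
  qed
  have *: "(\<lambda>t. of_real (f (fourier_mode T 1 t))) = (\<lambda>t. (?a / 2 - \<i> * ?b / 2) * fourier_mode T 1 t
     + (?a / 2 + \<i> * ?b / 2) * fourier_mode T (-1) t)"
    by (rule ext) (use f_eq[of "fourier_mode T 1 _", unfolded fourier_mode_cnj] in blast)
  show ?case unfolding * by (intro trig_poly.add trig_poly.mode)
next
  case (const c)
  then show ?case using trig_poly.mode[of T "of_real c" 0] by simp
next
  case (add f g)
  then show ?case using trig_poly.add by (simp add: of_real_add)
next
  case (mult f g)
  then show ?case using trig_poly_mult by (simp add: of_real_mult)
qed

lemma trig_poly_approx:
  fixes \<phi> :: "real \<Rightarrow> real"
  assumes T: "T > 0" and cont: "continuous_on {0..T} \<phi>" and per: "\<phi> 0 = \<phi> T" and "e > 0"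
  obtains p where "trig_poly T p" "\<And>t. t \<in> {0..T} \<Longrightarrow> cmod (of_real (\<phi> t) - p t) < e"
proof -
  define \<gamma> where "\<gamma> s = \<phi> (T * s)" for s
  have "continuous_on {0..1} \<gamma>" unfolding \<gamma>_def
    using T by (intro continuous_on_compose2[OF cont] continuous_intros) (auto simp: mult_left_le)
  \<comment> \<open>The homotopy of the loop with itself is used only for its consequence on the
    circle: continuity of \<open>\<gamma>\<close> composed with the angle, including at the jump of
    \<open>Arg2pi\<close>.\<close>
  then have "homotopic_loops UNIV \<gamma> \<gamma>"
    using per by (simp add: homotopic_loops_refl path_def pathfinish_def pathstart_def \<gamma>_def)
  then have "continuous_on (sphere 0 1) (\<gamma> \<circ> (\<lambda>z. Arg2pi z / (2 * pi)))"
    using homotopic_loops_imp_homotopic_circlemaps homotopic_with_imp_continuous by blast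
  then obtain g where g: "real_polynomial_function g"
    "\<And>z. z \<in> sphere 0 1 \<Longrightarrow> \<bar>(\<gamma> \<circ> (\<lambda>z. Arg2pi z / (2 * pi))) z - g z\<bar> < e"
    using Stone_Weierstrass_real_polynomial_function[OF compact_sphere _ \<open>e > 0\<close>] by blast
  have *: "\<gamma> (Arg2pi (fourier_mode T 1 t) / (2 * pi)) = \<phi> t" if t: "t \<in> {0..T}" for t
  proof (cases "t = T")
    case True
    then have "fourier_mode T 1 t = 1" using fourier_mode_period[OF T] by simp
    moreover have "Arg2pi 1 = 0" by (rule Arg2pi_unique[of 1]) auto
    ultimately show ?thesis using True per by (simp add: \<gamma>_def)
  next
    case False
    have "Arg2pi (fourier_mode T 1 t) = 2 * pi / T * t"
      using t False T by (intro Arg2pi_unique[of 1]) (auto simp: fourier_mode_def cis_conv_exp field_simps)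
    then show ?thesis using T by (simp add: \<gamma>_def)
  qed
  have "cmod (of_real (\<phi> t) - of_real (g (fourier_mode T 1 t))) < e" if t: "t \<in> {0..T}" for t
    using g(2)[of "fourier_mode T 1 t"] *[OF t]
    by (simp add: fourier_mode_def of_real_diff[symmetric] del: of_real_diff)
  with trig_poly_real_polynomial[OF g(1)] show thesis using that by blast
qed

lemma trig_sum_mono:
  assumes "finite K'" "K \<subseteq> K'"
  shows "trig_sum T K c t = trig_sum T K' (\<lambda>k. if k \<in> K then c k else 0) t"
  unfolding trig_sum_def by (rule sum.mono_neutral_cong_left) (use assms in auto)

lemma trig_sum_add:
  assumes "finite K" "finite K'"
  shows "\<exists>c''. \<forall>t. trig_sum T K c t + trig_sum T K' c' t = trig_sum T (K \<union> K') c'' t"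
  using trig_sum_mono[of "K \<union> K'" K T c] trig_sum_mono[of "K \<union> K'" K' T c'] assms
  by (intro exI[of _ "\<lambda>k. (if k \<in> K then c k else 0) + (if k \<in> K' then c' k else 0)"])
     (simp add: trig_sum_def sum.distrib[symmetric] scaleC_add_right)

lemma trig_poly_scaleC:
  assumes "trig_poly T p"
  shows "\<exists>K c. finite K \<and> (\<forall>t. p t *\<^sub>C (x::'e::chilbert_space) = trig_sum T K c t)"
  using assms
proof (induction rule: trig_poly.induct)
  case (mode c k)
  show ?case
    by (intro exI[of _ "{k}"] exI[of _ "\<lambda>_. c *\<^sub>C x"]) (simp add: trig_sum_def scaleC_scaleC mult.commute)
next
  case (add p q)
  then obtain K c K' c' where *: "finite K" "finite K'" "\<forall>t. p t *\<^sub>C x = trig_sum T K c t" "\<forall>t. q t *\<^sub>C x = trig_sum T K' c' t"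
    by metis
  then show ?case using trig_sum_add[OF *(1,2), of T c c'] by (metis finite_UnI scaleC_add_left)
qed

lemma trig_sum_sum:
  assumes "finite X" "\<And>x. x \<in> X \<Longrightarrow> \<exists>K c. finite K \<and> (\<forall>t. h x t = trig_sum T K c t)"
  shows "\<exists>K c. finite K \<and> (\<forall>t. (\<Sum>x\<in>X. h x t) = trig_sum T K c t)"
  using assms
proof (induction X rule: finite_induct)
  case empty
  then show ?case by (intro exI[of _ "{}"]) (simp add: trig_sum_def)
next
  case (insert x X)
  then obtain K c K' c' where *: "finite K" "finite K'" "\<forall>t. h x t = trig_sum T K c t"
     "\<forall>t. (\<Sum>x\<in>X. h x t) = trig_sum T K' c' t"
    by (metis insertCI)
  then show ?case using trig_sum_add[OF *(1,2), of T c c'] insert(1,2) by (metis finite_UnI sum.insert)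
qed

text \<open>A partition of unity subordinate to a finite net of the compact range reduces the
  vector-valued case to the scalar one.\<close>

lemma trig_sum_approx_continuous:
  fixes g :: "real \<Rightarrow> 'e::chilbert_space"
  assumes T: "T > 0" and cont: "continuous_on {0..T} g" and per: "g 0 = g T" and e: "e > 0"
  obtains K c where "finite K" "\<And>t. t \<in> {0..T} \<Longrightarrow> norm (g t - trig_sum T K c t) < e"
proof -
  have e2: "e / 2 > 0" using e by simp
  have "compact (g ` {0..T})" using cont by (intro compact_continuous_image) auto
  then obtain X where X: "finite X" "g ` {0..T} \<subseteq> (\<Union>x\<in>X. ball x (e / 2))"
    using seq_compact_imp_totally_bounded[of "g ` {0..T}"] compact_imp_seq_compact e2 by metis
  define w where "w x t = max 0 (e / 2 - dist (g t) x)" for x t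
  define s where "s t = (\<Sum>x\<in>X. w x t)" for t
  have w0: "w x t \<ge> 0" for x t by (simp add: w_def)
  have s0: "s t > 0" if t: "t \<in> {0..T}" for t
  proof -
    obtain x where x: "x \<in> X" "g t \<in> ball x (e / 2)" using X(2) t by blast
    then have "w x t > 0" by (simp add: w_def dist_commute)
    then show ?thesis unfolding s_def using x(1) X(1) w0 by (intro sum_pos2) auto
  qed
  have w_cont: "continuous_on {0..T} (w x)" for x
    unfolding w_def by (intro continuous_intros cont)
  have s_cont: "continuous_on {0..T} s"
    unfolding s_def by (intro continuous_intros w_cont)
  define \<psi> where "\<psi> x t = w x t / s t" for x t
  have \<psi>_cont: "continuous_on {0..T} (\<psi> x)" for x
    unfolding \<psi>_def using s0 by (intro continuous_intros w_cont s_cont) fastforce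
  have \<psi>_per: "\<psi> x 0 = \<psi> x T" for x using per by (simp add: \<psi>_def s_def w_def)
  \<comment> \<open>The scalar errors get multiplied by \<open>norm x\<close> and summed; the extra
    1 keeps \<open>N\<close> positive and makes the total strictly smaller than
    \<open>e / 2\<close>.\<close>
  define N where "N = (\<Sum>x\<in>X. norm x) + 1"
  have N: "N > 0" by (simp add: N_def sum_nonneg add_nonneg_pos)
  have "\<exists>p. trig_poly T p \<and> (\<forall>t\<in>{0..T}. cmod (of_real (\<psi> x t) - p t) < e / 2 / N)" for x
    using trig_poly_approx[OF T \<psi>_cont \<psi>_per, of "e / 2 / N"] e2 N by (metis divide_pos_pos)
  then obtain p where p: "\<And>x. trig_poly T (p x)" "\<And>x t. t \<in> {0..T} \<Longrightarrow> cmod (of_real (\<psi> x t) - p x t) < e / 2 / N"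
    by metis
  obtain K c where K: "finite K" "\<And>t. (\<Sum>x\<in>X. p x t *\<^sub>C x) = trig_sum T K c t"
    using trig_sum_sum[OF X(1), of "\<lambda>x t. p x t *\<^sub>C x" T] trig_poly_scaleC[OF p(1)] by blast
  have "norm (g t - trig_sum T K c t) < e" if t: "t \<in> {0..T}" for t
  proof -
    have sum1: "(\<Sum>x\<in>X. \<psi> x t) = 1"
      using s0[OF t] by (simp add: \<psi>_def sum_divide_distrib[symmetric] s_def[symmetric])
    have \<psi>0: "\<psi> x t \<ge> 0" for x using w0 s0[OF t] by (simp add: \<psi>_def)
    have "norm (g t - (\<Sum>x\<in>X. \<psi> x t *\<^sub>R x)) = norm (\<Sum>x\<in>X. \<psi> x t *\<^sub>R (g t - x))"
      by (simp add: scaleR_diff_right sum_subtractf scaleR_sum_left[symmetric] sum1)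
    also have "\<dots> \<le> (\<Sum>x\<in>X. \<psi> x t * (e / 2))"
    proof (rule sum_norm_le)
      fix x
      show "norm (\<psi> x t *\<^sub>R (g t - x)) \<le> \<psi> x t * (e / 2)"
      proof (cases "w x t = 0")
        case False
        then have "dist (g t) x \<le> e / 2" by (simp add: w_def max_def split: if_splits)
        then have "\<psi> x t * norm (g t - x) \<le> \<psi> x t * (e / 2)"
          using \<psi>0 by (intro mult_left_mono) (auto simp: dist_norm)
        then show ?thesis using \<psi>0[of x] by simp
      qed (simp add: \<psi>_def)
    qed
    also have "\<dots> = e / 2" by (simp only: sum_distrib_right[symmetric] sum1 mult_1)
    finally have 1: "norm (g t - (\<Sum>x\<in>X. \<psi> x t *\<^sub>R x)) \<le> e / 2" .
    have "norm ((\<Sum>x\<in>X. \<psi> x t *\<^sub>R x) - trig_sum T K c t) = norm (\<Sum>x\<in>X. (of_real (\<psi> x t) - p x t) *\<^sub>C x)"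
      by (simp add: K(2)[symmetric] sum_subtractf[symmetric] scaleC_of_real
          bounded_bilinear.diff_left[OF bounded_bilinear_scaleC])
    also have "\<dots> \<le> (\<Sum>x\<in>X. e / 2 / N * norm x)"
    proof (rule sum_norm_le)
      show "norm ((of_real (\<psi> x t) - p x t) *\<^sub>C x) \<le> e / 2 / N * norm x" for x
        unfolding norm_scaleC using p(2)[OF t, of x] by (intro mult_right_mono) auto
    qed
    also have "\<dots> = e / 2 / N * (N - 1)" by (simp add: sum_distrib_left N_def)
    also have "\<dots> < e / 2" using e N by (simp add: field_simps)
    finally have 2: "norm ((\<Sum>x\<in>X. \<psi> x t *\<^sub>R x) - trig_sum T K c t) < e / 2" .
    show ?thesis using norm_triangle_ineq[of "g t - (\<Sum>x\<in>X. \<psi> x t *\<^sub>R x)" "(\<Sum>x\<in>X. \<psi> x t *\<^sub>R x) - trig_sum T K c t"] 1 2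
      by simp
  qed
  with K(1) show thesis using that by blast
qed

text \<open>The continuous approximants vanish at both ends of the interval, hence have the
  periodicity that uniform approximation by trigonometric sums demands.\<close>

lemma trig_sum_dense:
  fixes f :: "real \<Rightarrow> 'e::chilbert_space"
  assumes T: "T > 0" and f: "sq_approx 0 T f" and e: "e > 0"
  obtains K c where "finite K" "integral {0..T} (\<lambda>t. (norm (f t - trig_sum T K c t))\<^sup>2) < e"
proof -
  have "e / 4 > 0" using e by simp
  then obtain g k I where g: "continuous_on UNIV g" "\<And>t. t \<le> 0 \<or> T \<le> t \<Longrightarrow> g t = 0"
    "(k has_integral I) {0..T}" "I < e / 4" "\<And>t. t \<in> {0..T} \<Longrightarrow> (norm (f t - g t))\<^sup>2 \<le> k t"
    using sq_approxE[OF f] by metis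
  \<comment> \<open>Chosen so that \<open>2 * h\<^sup>2 * T = e / 2\<close>.\<close>
  define h where "h = sqrt (e / (4 * T))"
  have h: "h > 0" using e T by (simp add: h_def)
  obtain K c where K: "finite K" "\<And>t. t \<in> {0..T} \<Longrightarrow> norm (g t - trig_sum T K c t) < h"
    using trig_sum_approx_continuous[OF T _ _ h, of g] g(1,2) continuous_on_subset
    by (metis order_refl subset_UNIV)
  have "((\<lambda>t. 2 * k t + 2 * h\<^sup>2) has_integral (2 * I + 2 * h\<^sup>2 * T)) {0..T}"
    using has_integral_const_real[of "2 * h\<^sup>2" 0 T] T
    by (intro has_integral_add has_integral_mult_right g) (simp add: mult.commute)
  moreover have "(\<lambda>t. (norm (f t - trig_sum T K c t))\<^sup>2) integrable_on {0..T}"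
    by (intro sq_approx_norm2_integrable sq_approx_diff f sq_approx_trig_sum)
  moreover have "(norm (f t - trig_sum T K c t))\<^sup>2 \<le> 2 * k t + 2 * h\<^sup>2" if t: "t \<in> {0..T}" for t
  proof -
    have "(norm (g t - trig_sum T K c t))\<^sup>2 \<le> h\<^sup>2" using K(2)[OF t] by (intro power_mono) auto
    then show ?thesis
      using norm_add_square_le[of "f t - g t" "g t - trig_sum T K c t"] g(5)[OF t] by simp
  qed
  ultimately have "integral {0..T} (\<lambda>t. (norm (f t - trig_sum T K c t))\<^sup>2) \<le> 2 * I + 2 * h\<^sup>2 * T"
    using has_integral_le[OF integrable_integral] by blast
  also have "h\<^sup>2 = e / (4 * T)" using e T by (simp add: h_def)
  then have "2 * I + 2 * h\<^sup>2 * T < e" using g(4) T by (simp add: field_simps)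
  finally show thesis using that K(1) by blast
qed

text \<open>Convergence is along all finite sets of integers. Bessel's inequality bounds every
  partial sum from above. A trigonometric sum over \<open>K\<close> close to \<open>f\<close> is
  also one over any larger \<open>L\<close>, so the distance formula over \<open>L\<close> bounds
  the partial sum over \<open>L\<close> from below.\<close>

theorem parseval_norm:
  fixes f :: "real \<Rightarrow> 'e::chilbert_space"
  assumes T: "T > 0" and f: "sq_approx 0 T f"
  shows "((\<lambda>k. (norm (fourier_coeff T f k))\<^sup>2) has_sum (integral {0..T} (\<lambda>t. (norm (f t))\<^sup>2) / T)) UNIV"
  unfolding has_sum_def tendsto_iff
proof (intro allI impI)
  fix e :: real assume e: "e > 0"
  define I where "I = integral {0..T} (\<lambda>t. (norm (f t))\<^sup>2)"
  have "e * T > 0" using e T by simp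
  then obtain K c where K: "finite K" "integral {0..T} (\<lambda>t. (norm (f t - trig_sum T K c t))\<^sup>2) < e * T"
    using trig_sum_dense[OF T f] by metis
  have "dist (\<Sum>k\<in>L. (norm (fourier_coeff T f k))\<^sup>2) (I / T) < e" if L: "finite L" "K \<subseteq> L" for L
  proof -
    let ?S = "\<Sum>k\<in>L. (norm (fourier_coeff T f k))\<^sup>2"
    have "0 \<le> integral {0..T} (\<lambda>t. (norm (f t - trig_sum T L (fourier_coeff T f) t))\<^sup>2)"
      by (intro integral_nonneg sq_approx_norm2_integrable sq_approx_diff f sq_approx_trig_sum) auto
    then have 1: "T * ?S \<le> I"
      using integral_trig_sum_distance[OF T L(1) f] by (simp add: I_def)
    have "trig_sum T K c = trig_sum T L (\<lambda>k. if k \<in> K then c k else 0)"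
      using trig_sum_mono[OF L] by blast
    then have "I - T * ?S < e * T"
      using K(2) integral_trig_sum_distance[OF T L(1) f, of "\<lambda>k. if k \<in> K then c k else 0"]
        mult_nonneg_nonneg[OF less_imp_le[OF T] sum_nonneg[of L "\<lambda>k. (norm (fourier_coeff T f k - (if k \<in> K then c k else 0)))\<^sup>2"]]
      unfolding I_def by simp
    then have "I / T - ?S < e" using T by (simp add: field_simps)
    moreover have "?S \<le> I / T" using 1 T by (simp add: field_simps)
    ultimately show ?thesis by (simp add: dist_real_def)
  qed
  then show "\<forall>\<^sub>F L in finite_subsets_at_top UNIV. dist (\<Sum>k\<in>L. (norm (fourier_coeff T f k))\<^sup>2)
     (integral {0..T} (\<lambda>t. (norm (f t))\<^sup>2) / T) < e"
    unfolding eventually_finite_subsets_at_top I_def using K(1) by blast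
qed

theorem parseval_inner:
  fixes f g :: "real \<Rightarrow> 'e::chilbert_space"
  assumes T: "T > 0" and f: "sq_approx 0 T f" and g: "sq_approx 0 T g"
  shows "((\<lambda>k. inner (fourier_coeff T f k) (fourier_coeff T g k)) has_sum
    (integral {0..T} (\<lambda>t. inner (f t) (g t)) / T)) UNIV"
proof -
  let ?n = "\<lambda>h. integral {0..T} (\<lambda>t. (norm (h t :: 'e))\<^sup>2)"
  have fg: "sq_approx 0 T (\<lambda>t. f t + g t)" by (intro sq_approx_add f g)
  have polar: "inner x y = ((norm (x + y))\<^sup>2 + (- (norm x)\<^sup>2 + - (norm y)\<^sup>2)) * (1 / 2)" for x y :: 'e
    by (simp add: power2_norm_eq_inner inner_add inner_commute)
  have "((\<lambda>k. ((norm (fourier_coeff T f k + fourier_coeff T g k))\<^sup>2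
       + (- (norm (fourier_coeff T f k))\<^sup>2 + - (norm (fourier_coeff T g k))\<^sup>2)) * (1 / 2)) has_sum
      ((?n (\<lambda>t. f t + g t) / T + (- (?n f / T) + - (?n g / T))) * (1 / 2))) UNIV"
    using parseval_norm[OF T fg] parseval_norm[OF T f] parseval_norm[OF T g]
    by (intro has_sum_cmult_left has_sum_add) (simp_all add: fourier_coeff_add[OF f g] has_sum_uminus)
  moreover have "((\<lambda>t. ((norm (f t + g t))\<^sup>2 + (- (norm (f t))\<^sup>2 + - (norm (g t))\<^sup>2)) * (1 / 2)) has_integral
      ((?n (\<lambda>t. f t + g t) + (- ?n f + - ?n g)) * (1 / 2))) {0..T}"
    by (intro has_integral_mult_left has_integral_add has_integral_neg integrable_integral
        sq_approx_norm2_integrable f g fg)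
  then have "integral {0..T} (\<lambda>t. inner (f t) (g t)) = (?n (\<lambda>t. f t + g t) + (- ?n f + - ?n g)) * (1 / 2)"
    unfolding polar by (rule integral_unique)
  ultimately show ?thesis unfolding polar by (simp add: diff_divide_distrib add_divide_distrib mult.commute[of T])
qed

section \<open>The integrated frequency inequality\<close>

lemma integral_by_parts_fourier_continuous:
  fixes g :: "real \<Rightarrow> 'e::chilbert_space"
  assumes "T > 0" and g: "continuous_on {0..T} g"
  shows "integral {0..T} (\<lambda>t. fourier_mode T k t *\<^sub>C g t) = integral {0..T} g -
    (\<i> * of_real (2 * pi * of_int k / T)) *\<^sub>C integral {0..T} (\<lambda>t. fourier_mode T k t *\<^sub>C integral {0..t} g)"
proof -
  let ?c = "\<i> * of_real (2 * pi * of_int k / T)"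
  have U: "((\<lambda>t. integral {0..t} g) has_vector_derivative g t) (at t within {0..T})" if "t \<in> {0..T}" for t
    using integral_has_vector_derivative[OF g that] .
  have "((\<lambda>t. fourier_mode T k t *\<^sub>C integral {0..t} g) has_vector_derivative
      (fourier_mode T k t *\<^sub>C g t + (?c * fourier_mode T k t) *\<^sub>C integral {0..t} g)) (at t within {0..T})"
    if "t \<in> {0..T}" for t
    by (rule bounded_bilinear.has_vector_derivative[OF bounded_bilinear_scaleC fourier_mode_has_vector_derivative U[OF that]])
  then have "((\<lambda>t. fourier_mode T k t *\<^sub>C g t + (?c * fourier_mode T k t) *\<^sub>C integral {0..t} g) has_integral
      (fourier_mode T k T *\<^sub>C integral {0..T} g - fourier_mode T k 0 *\<^sub>C integral {0..0} g)) {0..T}"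
    using assms(1) by (intro fundamental_theorem_of_calculus) auto
  then have *: "((\<lambda>t. fourier_mode T k t *\<^sub>C g t + (?c * fourier_mode T k t) *\<^sub>C integral {0..t} g) has_integral
      integral {0..T} g) {0..T}"
    using fourier_mode_period[OF assms(1)] by simp
  have "continuous_on {0..T} (\<lambda>t. integral {0..t} g)"
    by (intro indefinite_integral_continuous_1 integrable_continuous_real g)
  then have "(\<lambda>t. fourier_mode T k t *\<^sub>C integral {0..t} g) integrable_on {0..T}"
    by (intro integrable_continuous_real continuous_intros)
  from has_integral_linear[OF integrable_integral[OF this] bounded_linear_scaleC_right[of ?c]]
  have "((\<lambda>t. (?c * fourier_mode T k t) *\<^sub>C integral {0..t} g) has_integral
      ?c *\<^sub>C integral {0..T} (\<lambda>t. fourier_mode T k t *\<^sub>C integral {0..t} g)) {0..T}"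
    by (simp only: o_def scaleC_scaleC)
  from has_integral_diff[OF * this] show ?thesis by (simp add: integral_unique)
qed

lemma integral_norm_bound_has_integral:
  fixes f :: "real \<Rightarrow> 'e::banach"
  assumes "f integrable_on {a..b}" "(k has_integral I) {a..b}" "\<And>t. t \<in> {a..b} \<Longrightarrow> norm (f t) \<le> k t"
  shows "norm (integral {a..b} f) \<le> I"
  using integral_norm_bound_integral[OF assms(1) _ assms(3)] assms(2) by (metis has_integral_iff)

lemma integral_norm_bound_sub:
  fixes f :: "real \<Rightarrow> 'e::banach"
  assumes f: "f integrable_on {a..b}" and k: "(k has_integral I) {a..b}"
    and le: "\<And>t. t \<in> {a..b} \<Longrightarrow> norm (f t) \<le> k t" and c: "c \<in> {a..b}"
  shows "norm (integral {a..c} f) \<le> I"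
proof -
  have ki: "k integrable_on {a..c}"
    by (rule integrable_on_subinterval[of k "{a..b}"]) (use k c in \<open>auto simp: has_integral_iff\<close>)
  have "norm (integral {a..c} f) \<le> integral {a..c} k"
    by (rule integral_norm_bound_integral[OF _ ki])
       (use integrable_on_subinterval[OF f, of a c] le c in auto)
  also have "\<dots> \<le> integral {a..b} k"
  proof (rule integral_subset_le[OF _ ki])
    show "{a..c} \<subseteq> {a..b}" using c by auto
    show "k integrable_on {a..b}" using k by blast
    show "\<forall>t\<in>{a..b}. 0 \<le> k t" using le norm_ge_zero order_trans by blast
  qed
  finally show ?thesis using k by (simp add: integral_unique)
qed

lemma norm_eq_0I_small:
  assumes "\<And>e::real. e > 0 \<Longrightarrow> norm x \<le> C * e"
  shows "x = 0"
proof -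
  have "norm x \<le> 0"
  proof (rule field_le_epsilon)
    fix e :: real assume e: "e > 0"
    have "norm x \<le> C * (e / (\<bar>C\<bar> + 1))" using e by (intro assms) auto
    also have "\<dots> \<le> (\<bar>C\<bar> + 1) * (e / (\<bar>C\<bar> + 1))" using e by (intro mult_right_mono) auto
    also have "\<dots> = e" by (simp add: field_simps)
    finally show "norm x \<le> 0 + e" by simp
  qed
  then show ?thesis by simp
qed

text \<open>The defect \<open>E\<close> of the formula is additive, vanishes on continuous functions
  and is bounded by a fixed multiple of the integral of any majorant of the norm. Approximation of
  \<open>g\<close> in mean therefore forces \<open>E g = 0\<close>.\<close>

lemma integral_by_parts_fourier:
  fixes g :: "real \<Rightarrow> 'e::chilbert_space"
  assumes T: "T > 0" and g: "sq_approx 0 T g"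
  shows "integral {0..T} (\<lambda>t. fourier_mode T k t *\<^sub>C g t) = integral {0..T} g -
    (\<i> * of_real (2 * pi * of_int k / T)) *\<^sub>C integral {0..T} (\<lambda>t. fourier_mode T k t *\<^sub>C integral {0..t} g)"
proof -
  define c where "c = \<i> * of_real (2 * pi * of_int k / T)"
  define E where "E h = integral {0..T} (\<lambda>t. fourier_mode T k t *\<^sub>C h t) - integral {0..T} h +
     c *\<^sub>C integral {0..T} (\<lambda>t. fourier_mode T k t *\<^sub>C integral {0..t} h)" for h :: "real \<Rightarrow> 'e"
  have nm: "norm (fourier_mode T k t *\<^sub>C x) = norm x" for t and x :: 'e
    by (simp add: norm_scaleC fourier_mode_def)
  have int: "h integrable_on {0..T}" "h integrable_on {0..t}" "(\<lambda>t. fourier_mode T k t *\<^sub>C h t) integrable_on {0..T}"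
    "(\<lambda>t. fourier_mode T k t *\<^sub>C integral {0..t} h) integrable_on {0..T}"
    if "sq_approx 0 T h" "t \<in> {0..T}" for h :: "real \<Rightarrow> 'e" and t
  proof -
    show 1: "h integrable_on {0..T}" by (rule sq_approx_integrable[OF that(1)])
    show "h integrable_on {0..t}" using integrable_on_subinterval[OF 1] that(2) by auto
    show "(\<lambda>t. fourier_mode T k t *\<^sub>C h t) integrable_on {0..T}" by (rule fourier_integrable[OF that(1)])
    show "(\<lambda>t. fourier_mode T k t *\<^sub>C integral {0..t} h) integrable_on {0..T}"
      by (intro integrable_continuous_real continuous_intros indefinite_integral_continuous_1 1)
  qed
  have "E g = 0"
  \<comment> \<open>The first two integrals in \<open>E\<close> contribute 1 each; in the third, the
    running integral never exceeds the total error, which gives the factor \<open>T\<close>.\<close>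
  proof (rule norm_eq_0I_small[where C="2 + cmod c * T"])
    fix e :: real assume e: "e > 0"
    obtain h l I where h: "continuous_on UNIV h" "(l has_integral I) {0..T}" "I < e"
       "\<And>t. t \<in> {0..T} \<Longrightarrow> norm (g t - h t) \<le> l t"
      using sq_approx_L1[OF g e] by metis
    have hc: "continuous_on {0..T} h" using h(1) continuous_on_subset by blast
    have hs: "sq_approx 0 T h" by (rule sq_approx_continuous[OF hc])
    define d where "d t = g t - h t" for t
    have d: "sq_approx 0 T d" unfolding d_def by (intro sq_approx_diff g hs)
    have dl: "norm (d t) \<le> l t" if "t \<in> {0..T}" for t using h(4)[OF that] by (simp add: d_def)
    have "E h = 0"
      using integral_by_parts_fourier_continuous[OF T hc, of k] by (simp add: E_def c_def)
    moreover have "E g = E d + E h"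
    proof -
      have "integral {0..t} g = integral {0..t} d + integral {0..t} h" if "t \<in> {0..T}" for t
        using integral_add[OF int(2)[OF d that] int(2)[OF hs that]] by (simp add: d_def)
      then have 1: "integral {0..T} (\<lambda>t. fourier_mode T k t *\<^sub>C integral {0..t} g) =
          integral {0..T} (\<lambda>t. fourier_mode T k t *\<^sub>C integral {0..t} d + fourier_mode T k t *\<^sub>C integral {0..t} h)"
        by (intro integral_cong) (simp add: scaleC_add_right)
      have 2: "integral {0..T} (\<lambda>t. fourier_mode T k t *\<^sub>C g t) =
          integral {0..T} (\<lambda>t. fourier_mode T k t *\<^sub>C d t + fourier_mode T k t *\<^sub>C h t)"
        by (simp add: d_def scaleC_add_right[symmetric])
      have 3: "integral {0..T} g = integral {0..T} (\<lambda>t. d t + h t)" by (simp add: d_def)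
      have "0 \<in> {0..T}" using T by simp
      note id = int[OF d this] and ih = int[OF hs this]
      show ?thesis unfolding E_def 1 2 3
        by (simp add: integral_add id ih scaleC_add_right)
    qed
    ultimately have "norm (E g) = norm (E d)" by simp
    also have "\<dots> \<le> I + I + cmod c * (T * I)"
    proof -
      have 0: "0 \<in> {0..T}" using T by simp
      have a: "norm (integral {0..T} (\<lambda>t. fourier_mode T k t *\<^sub>C d t)) \<le> I"
        by (rule integral_norm_bound_has_integral[OF int(3)[OF d 0] h(2)]) (use dl in \<open>simp add: nm\<close>)
      have b: "norm (integral {0..T} d) \<le> I"
        by (rule integral_norm_bound_has_integral[OF int(1)[OF d 0] h(2)]) (use dl in simp)
      have "norm (integral {0..T} (\<lambda>t. fourier_mode T k t *\<^sub>C integral {0..t} d)) \<le> T * I"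
      proof (rule integral_norm_bound_has_integral[OF int(4)[OF d 0]])
        show "((\<lambda>t. I) has_integral T * I) {0..T}"
          using has_integral_const_real[of I 0 T] T by simp
        show "norm (fourier_mode T k t *\<^sub>C integral {0..t} d) \<le> I" if "t \<in> {0..T}" for t
          unfolding nm using integral_norm_bound_sub[OF int(1)[OF d 0] h(2) dl that] .
      qed
      then have "norm (c *\<^sub>C integral {0..T} (\<lambda>t. fourier_mode T k t *\<^sub>C integral {0..t} d)) \<le> cmod c * (T * I)"
        unfolding norm_scaleC by (intro mult_left_mono) auto
      then show ?thesis unfolding E_def
        by (intro norm_triangle_mono order_trans[OF norm_triangle_ineq4 add_mono] a b)
    qed
    also have "\<dots> = (2 + cmod c * T) * I" by (simp add: algebra_simps)
    also have "\<dots> \<le> (2 + cmod c * T) * e" using h(3) T by (intro mult_left_mono) auto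
    finally show "norm (E g) \<le> (2 + cmod c * T) * e" .
  qed
  then show ?thesis by (simp add: E_def c_def algebra_simps)
qed

lemma sq_approx_bounded_clinear:
  "bounded_clinear L \<Longrightarrow> sq_approx a b f \<Longrightarrow> sq_approx a b (\<lambda>t. L (f t))"
  by (simp add: bounded_clinear_def sq_approx_bounded_linear)

text \<open>Closing up, \<open>K (z T) = K (z 0)\<close>, removes the boundary term when the
  trajectory equation is multiplied by a mode and integrated by parts. Each Fourier coefficient thus
  satisfies the premise of \<open>freq\<close> with \<open>\<omega>\<close> = 2 pi k / T, and
  Parseval adds up the resulting inequalities.\<close>

theorem frequency_inequality_integral:
  fixes K L :: "'w::chilbert_space \<Rightarrow> 'h::chilbert_space" and S :: "'w \<Rightarrow> 'w"
  assumes K: "bounded_clinear K" and L: "bounded_clinear L" and S: "bounded_clinear S"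
    and freq: "\<And>(\<omega>::real) z. (\<i> * of_real \<omega>) *\<^sub>C K z = L z \<Longrightarrow> inner (S z) z \<le> - \<epsilon> * (norm z)\<^sup>2"
    and T: "T \<ge> 0" and z: "sq_approx 0 T z"
    and traj: "\<And>t. t \<in> {0..T} \<Longrightarrow> K (z t) - K (z 0) = integral {0..t} (\<lambda>s. L (z s))"
    and per: "K (z T) = K (z 0)"
  shows "integral {0..T} (\<lambda>t. inner (S (z t)) (z t)) \<le> - \<epsilon> * integral {0..T} (\<lambda>t. (norm (z t))\<^sup>2)"
proof (cases "T = 0")
  case True
  then show ?thesis by simp
next
  case False
  with T have T: "T > 0" by simp
  let ?zc = "fourier_coeff T z"
  have Kz: "sq_approx 0 T (\<lambda>t. K (z t))" and Lz: "sq_approx 0 T (\<lambda>t. L (z t))" and Sz: "sq_approx 0 T (\<lambda>t. S (z t))"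
    using sq_approx_bounded_clinear[OF K z] sq_approx_bounded_clinear[OF L z] sq_approx_bounded_clinear[OF S z]
    by auto
  have "(\<i> * of_real (2 * pi * of_int k / T)) *\<^sub>C K (?zc k) = L (?zc k)" for k
  proof -
    let ?w = "\<i> * of_real (2 * pi * of_int k / T)"
    \<comment> \<open>A constant has only the zeroth Fourier coefficient, and for
      \<open>k = 0\<close> the factor \<open>?w\<close> is 0; so the constant \<open>K (z 0)\<close>
      drops out below.\<close>
    have w: "?w *\<^sub>C integral {0..T} (\<lambda>t. fourier_mode T (-k) t *\<^sub>C x) = 0" for x :: 'h
      using has_integral_linear[OF integral_fourier_mode[OF T, of "-k"] bounded_linear_scaleC_left[of x]]
      by (cases "k = 0") (simp_all add: o_def integral_unique)
    have "integral {0..T} (\<lambda>s. L (z s)) = 0" using traj[of T] per T by simp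
    then have "integral {0..T} (\<lambda>t. fourier_mode T (-k) t *\<^sub>C L (z t)) =
        ?w *\<^sub>C integral {0..T} (\<lambda>t. fourier_mode T (-k) t *\<^sub>C integral {0..t} (\<lambda>s. L (z s)))"
      using integral_by_parts_fourier[OF T Lz, of "-k"] by simp
    also have "integral {0..T} (\<lambda>t. fourier_mode T (-k) t *\<^sub>C integral {0..t} (\<lambda>s. L (z s))) =
       integral {0..T} (\<lambda>t. fourier_mode T (-k) t *\<^sub>C K (z t) - fourier_mode T (-k) t *\<^sub>C K (z 0))"
      by (intro integral_cong) (simp add: traj[symmetric] scaleC_diff_right)
    also have "\<dots> = integral {0..T} (\<lambda>t. fourier_mode T (-k) t *\<^sub>C K (z t))
       - integral {0..T} (\<lambda>t. fourier_mode T (-k) t *\<^sub>C K (z 0))"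
      by (intro integral_diff fourier_integrable Kz integrable_continuous_real continuous_intros)
    finally have "integral {0..T} (\<lambda>t. fourier_mode T (-k) t *\<^sub>C L (z t)) =
        ?w *\<^sub>C integral {0..T} (\<lambda>t. fourier_mode T (-k) t *\<^sub>C K (z t))"
      by (simp only: scaleC_diff_right w) simp
    then have "fourier_coeff T (\<lambda>t. L (z t)) k = ?w *\<^sub>C fourier_coeff T (\<lambda>t. K (z t)) k"
      by (simp only: fourier_coeff_def scaleC_scaleR)
    then show ?thesis by (simp only: fourier_coeff_linear[OF L z] fourier_coeff_linear[OF K z])
  qed
  then have mode: "inner (S (?zc k)) (?zc k) \<le> - \<epsilon> * (norm (?zc k))\<^sup>2" for k by (rule freq)
  have "integral {0..T} (\<lambda>t. inner (S (z t)) (z t)) / T \<le> - \<epsilon> * (integral {0..T} (\<lambda>t. (norm (z t))\<^sup>2) / T)"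
    by (rule has_sum_mono[OF parseval_inner[OF T Sz z] has_sum_cmult_right[OF parseval_norm[OF T z]]])
       (use mode fourier_coeff_linear[OF S z] in simp)
  then show ?thesis using T by (simp add: field_simps)
qed

section \<open>Quadratic forms and the value function\<close>

lemma parallelogram_law:
  fixes x y :: "'a::real_inner"
  shows "(norm (x + y))\<^sup>2 + (norm (x - y))\<^sup>2 = 2 * (norm x)\<^sup>2 + 2 * (norm y)\<^sup>2"
  by (simp add: power2_norm_eq_inner inner_add inner_diff inner_commute)

text \<open>The representing vector is the minimiser of \<open>\<lambda>x. (norm x)\<^sup>2 - 2 * f x\<close>; minimising sequences are
  Cauchy by the parallelogram law.\<close>

theorem riesz_representation:
  fixes f :: "'a::{real_inner, banach} \<Rightarrow> real"
  assumes f: "bounded_linear f"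
  obtains y where "\<And>x. f x = inner y x"
proof -
  interpret f: bounded_linear f by fact
  define F where "F x = (norm x)\<^sup>2 - 2 * f x" for x
  obtain C where C: "\<And>x. norm (f x) \<le> norm x * C" using f.nonneg_bounded by blast
  have low: "- C\<^sup>2 \<le> F x" for x
  proof -
    have "2 * f x \<le> 2 * (norm x * C)" using C[of x] by simp
    also have "\<dots> \<le> (norm x)\<^sup>2 + C\<^sup>2"
      using zero_le_power2[of "norm x - C"] by (simp add: power2_eq_square algebra_simps)
    finally show ?thesis by (simp add: F_def)
  qed
  define m where "m = Inf (range F)"
  have bdd: "bdd_below (range F)" using low by (intro bdd_belowI2)
  have m_le: "m \<le> F x" for x unfolding m_def by (intro cInf_lower bdd) auto
  have "\<exists>x. F x < m + 1 / Suc n" for n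
    using cInf_lessD[of "range F" "m + 1 / Suc n"] by (auto simp: m_def)
  then obtain X where X: "\<And>n. F (X n) < m + 1 / Suc n" by metis
  have dist: "(norm (x - y))\<^sup>2 \<le> 2 * (F x - m) + 2 * (F y - m)" for x y
  proof -
    have "norm ((1 / 2) *\<^sub>R (x + y)) = norm (x + y) / 2" unfolding norm_scaleR by simp
    then have "F ((1 / 2) *\<^sub>R (x + y)) = (norm (x + y))\<^sup>2 / 4 - f x - f y"
      unfolding F_def f.scaleR f.add by (simp add: power_divide add_divide_distrib)
    with m_le[of "(1 / 2) *\<^sub>R (x + y)"] have "4 * m \<le> (norm (x + y))\<^sup>2 - 4 * f x - 4 * f y" by linarith
    then show ?thesis using parallelogram_law[of x y] by (simp add: F_def)
  qed
  have "Cauchy X"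
    unfolding Cauchy_def
  proof (intro allI impI)
    fix e :: real assume e: "e > 0"
    obtain M where M: "4 / e\<^sup>2 < real M" using reals_Archimedean2 by blast
    have "dist (X p) (X q) < e" if "p \<ge> M" "q \<ge> M" for p q
    proof -
      have less: "F (X n) - m < e\<^sup>2 / 4" if "n \<ge> M" for n
      proof -
        have "4 / e\<^sup>2 < real (Suc n)" using M that by linarith
        then have "1 / real (Suc n) < e\<^sup>2 / 4" using e by (simp add: field_simps)
        then show ?thesis using X[of n] by linarith
      qed
      have "(dist (X p) (X q))\<^sup>2 < e\<^sup>2"
        using dist[of "X p" "X q"] less[OF that(1)] less[OF that(2)] by (simp add: dist_norm)
      then show ?thesis using e by (simp add: power_less_imp_less_base)
    qed
    then show "\<exists>M. \<forall>m\<ge>M. \<forall>n\<ge>M. dist (X m) (X n) < e" by blast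
  qed
  then obtain y where y: "X \<longlonglongrightarrow> y" using Cauchy_convergent_iff convergent_def by blast
  have "(\<lambda>n. F (X n)) \<longlonglongrightarrow> F y" unfolding F_def by (intro tendsto_intros f.tendsto y)
  moreover have "(\<lambda>n. m + 1 / Suc n) \<longlonglongrightarrow> m + 0" by (intro tendsto_intros LIMSEQ_Suc lim_1_over_n)
  ultimately have Fy: "F y \<le> m"
    using X by (intro LIMSEQ_le[of "\<lambda>n. F (X n)" _ "\<lambda>n. m + 1 / Suc n"]) (auto intro: less_imp_le)
  have "f x = inner y x" for x
  proof (rule ccontr)
    assume "f x \<noteq> inner y x"
    define d where "d = f x - inner y x"
    have d: "d \<noteq> 0" using \<open>f x \<noteq> _\<close> by (simp add: d_def)
    \<comment> \<open>A step along \<open>x\<close> that would lower \<open>F\<close> below its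
      minimum: the gain \<open>2 * t * d\<close> exceeds the cost
      \<open>t\<^sup>2 * (norm x)\<^sup>2\<close>. The 1 in the denominator makes the gain strictly
      larger and avoids division by 0.\<close>
    define t where "t = d / (1 + (norm x)\<^sup>2)"
    have n: "1 + (norm x)\<^sup>2 > 0" by (simp add: add_pos_nonneg)
    have "(norm (y + t *\<^sub>R x))\<^sup>2 = (norm y)\<^sup>2 + 2 * t * inner y x + t\<^sup>2 * (norm x)\<^sup>2"
      unfolding power2_norm_eq_inner
      by (simp add: inner_add inner_commute power2_eq_square algebra_simps)
    then have "F (y + t *\<^sub>R x) = F y + t\<^sup>2 * (norm x)\<^sup>2 - 2 * t * d"
      by (simp add: F_def d_def f.add f.scaleR algebra_simps)
    moreover have "F y \<le> F (y + t *\<^sub>R x)" using Fy m_le order_trans by blast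
    ultimately have "2 * t * d \<le> t\<^sup>2 * (norm x)\<^sup>2" by simp
    moreover have "d = t * (1 + (norm x)\<^sup>2)" using n by (simp add: t_def)
    ultimately have "2 * t\<^sup>2 * (1 + (norm x)\<^sup>2) \<le> t\<^sup>2 * (norm x)\<^sup>2" by (simp add: power2_eq_square algebra_simps)
    moreover have "t\<^sup>2 > 0" using d n by (simp add: t_def)
    ultimately have "2 * (1 + (norm x)\<^sup>2) \<le> (norm x)\<^sup>2"
      by (metis (no_types, opaque_lifting) mult.assoc mult.left_commute mult_le_cancel_left_pos)
    then show False using zero_le_power2[of "norm x"] unfolding distrib_left by linarith
  qed
  then show thesis using that by blast
qed

text \<open>Subtracting the linear part leaves an additive \<open>d\<close> that vanishes on the
  integers, hence depends only on the fractional part and is bounded. As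
  \<open>real n * d r = d (real n * r)\<close> stays bounded for all \<open>n\<close>,
  \<open>d\<close> is 0.\<close>

lemma additive_bounded_imp_homogeneous:
  fixes g :: "real \<Rightarrow> real"
  assumes add: "\<And>r s. g (r + s) = g r + g s" and bound: "\<And>r. \<bar>r\<bar> \<le> 1 \<Longrightarrow> \<bar>g r\<bar> \<le> D"
  shows "g r = r * g 1"
proof -
  define d where "d r = g r - r * g 1" for r
  have d_add: "d (r + s) = d r + d s" for r s by (simp add: d_def add algebra_simps)
  have d1: "d 1 = 0" by (simp add: d_def)
  have d_nat: "d (real n * r) = real n * d r" for n r
  proof (induction n)
    case 0
    show ?case using d_add[of 0 0] by simp
  next
    case (Suc n)
    then show ?case using d_add[of r "real n * r"] by (simp add: algebra_simps)
  qed
  have d_nat1: "d (real n) = 0" for n using d_nat[of n 1] d1 by simp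
  have d_int: "d (of_int i) = 0" for i
  proof (cases "i \<ge> 0")
    case True
    then show ?thesis using d_nat1[of "nat i"] by simp
  next
    case False
    then have "d (of_int i) + d (real (nat (- i))) = d 0" using d_add[of "of_int i" "real (nat (- i))"] by simp
    then show ?thesis using d_nat1 d_nat1[of 0] by simp
  qed
  have d_bound: "\<bar>d r\<bar> \<le> 2 * D" for r
  proof -
    have "d r = d (frac r) + d (of_int \<lfloor>r\<rfloor>)" using d_add[of "frac r" "of_int \<lfloor>r\<rfloor>"] by (simp add: frac_def)
    then have 1: "d r = g (frac r) - frac r * g 1" using d_int by (simp add: d_def)
    have f: "0 \<le> frac r" "frac r \<le> 1" using frac_lt_1[of r] by auto
    have "\<bar>frac r * g 1\<bar> \<le> 1 * D" unfolding abs_mult using f bound[of 1] by (intro mult_mono) auto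
    then show ?thesis using 1 bound[of "frac r"] f by linarith
  qed
  have "\<bar>d r\<bar> \<le> 0"
  proof (rule field_le_epsilon)
    fix e :: real assume e: "e > 0"
    obtain n where n: "2 * D / e < real n" using reals_Archimedean2 by blast
    have "D \<ge> 0" using bound[of 0] by simp
    then have "0 \<le> 2 * D / e" using e by simp
    then have np: "real n > 0" using n by linarith
    have "real n * \<bar>d r\<bar> \<le> 2 * D" using d_bound[of "real n * r"] by (simp add: d_nat abs_mult)
    also have "\<dots> \<le> real n * e" using n e by (simp add: field_simps)
    finally show "\<bar>d r\<bar> \<le> 0 + e" using np by simp
  qed
  then show ?thesis by (simp add: d_def)
qed

text \<open>The Jordan-von Neumann argument: the parallelogram law makes the polar form
  \<open>b\<close> biadditive, the bound on \<open>V\<close> upgrades this to real bilinearity and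
  continuity, and Riesz supplies \<open>P\<close>. Invariance of \<open>V\<close> under
  multiplication by \<i> makes \<open>P\<close> commute with \<i>, which yields complex linearity
  and symmetry in the complex inner product.\<close>

theorem quadratic_form_operator:
  fixes V :: "'a::chilbert_space \<Rightarrow> real"
  assumes par: "\<And>x y. V (x + y) + V (x - y) = 2 * V x + 2 * V y"
    and bound: "\<And>x. \<bar>V x\<bar> \<le> C * (norm x)\<^sup>2"
    and hom: "\<And>c x. V (c *\<^sub>C x) = (cmod c)\<^sup>2 * V x"
  obtains P where "selfadjoint P" "\<And>x. Re (cinner (P x) x) = V x"
proof -
  define b where "b x y = (V (x + y) - V (x - y)) / 4" for x y
  have V0: "V 0 = 0" using bound[of 0] by simp
  have Vm: "V (- x) = V x" for x using hom[of "-1" x] by simp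
  have Vd: "V (y - x) = V (x - y)" for x y using Vm[of "x - y"] by simp
  have V2: "V (2 *\<^sub>R x) = 4 * V x" for x using par[of x x] V0 by (simp add: scaleR_2)
  have b_sym: "b x y = b y x" for x y by (simp add: b_def Vd[of y x] add.commute)
  have b_xx: "b x x = V x" for x using V2[of x] V0 by (simp add: b_def scaleR_2)
  have b0: "b 0 y = 0" for y using Vm by (simp add: b_def)
  have b_par: "b (x + x') y + b (x - x') y = 2 * b x y" for x x' y
  proof -
    have "x + x' + y = x + y + x'" "x + x' - y = x - y + x'" "x - x' + y = x + y - x'" "x - x' - y = x - y - x'"
      by simp_all
    then show ?thesis
      using par[of "x + y" x'] par[of "x - y" x'] by (simp add: b_def field_simps)
  qed
  have b_2: "b (2 *\<^sub>R x) y = 2 * b x y" for x y using b_par[of x x y] b0 by (simp add: scaleR_2)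
  have b_add: "b (u + v) y = b u y + b v y" for u v y
  proof -
    have "b u y + b v y = 2 * b ((1 / 2) *\<^sub>R (u + v)) y"
      using b_par[of "(1 / 2) *\<^sub>R (u + v)" "(1 / 2) *\<^sub>R (u - v)" y]
      by (simp add: scaleR_add_right[symmetric] scaleR_diff_right[symmetric] scaleR_2[symmetric])
    then show ?thesis using b_2[of "(1 / 2) *\<^sub>R (u + v)" y] by simp
  qed
  have C0: "C * (norm x)\<^sup>2 \<ge> 0" for x :: 'a using bound[of x] by linarith
  have b_bound: "\<bar>b x y\<bar> \<le> C * ((norm x)\<^sup>2 + (norm y)\<^sup>2) / 2" for x y
  proof -
    have "4 * \<bar>b x y\<bar> \<le> C * (norm (x + y))\<^sup>2 + C * (norm (x - y))\<^sup>2"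
      using bound[of "x + y"] bound[of "x - y"] by (simp add: b_def)
    also have "\<dots> = C * (2 * (norm x)\<^sup>2 + 2 * (norm y)\<^sup>2)"
      by (simp only: distrib_left[symmetric] parallelogram_law)
    finally show ?thesis by (simp add: algebra_simps)
  qed
  have b_scale: "b (r *\<^sub>R x) y = r * b x y" for r x y
  proof -
    have "\<bar>b (s *\<^sub>R x) y\<bar> \<le> C * (norm x)\<^sup>2 / 2 + C * (norm y)\<^sup>2 / 2" if "\<bar>s\<bar> \<le> 1" for s
    proof -
      have "s\<^sup>2 \<le> 1" using that by (simp add: abs_square_le_1)
      then have "s\<^sup>2 * (C * (norm x)\<^sup>2) \<le> 1 * (C * (norm x)\<^sup>2)" using C0 by (intro mult_right_mono) auto
      then show ?thesis using b_bound[of "s *\<^sub>R x" y] by (simp add: power_mult_distrib algebra_simps)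
    qed
    moreover have "b ((s + s') *\<^sub>R x) y = b (s *\<^sub>R x) y + b (s' *\<^sub>R x) y" for s s'
      by (simp only: scaleR_add_left b_add)
    ultimately have "b (r *\<^sub>R x) y = r * b (1 *\<^sub>R x) y"
      by (intro additive_bounded_imp_homogeneous[of "\<lambda>r. b (r *\<^sub>R x) y"])
    then show ?thesis by simp
  qed
  have b_cs: "\<bar>b x y\<bar> \<le> \<bar>C\<bar> * norm x * norm y" for x y
  proof (cases "x = 0 \<or> y = 0")
    case True
    then have "b x y = 0" using b0 b_sym by metis
    then show ?thesis by simp
  next
    case False
    then have nz: "norm x > 0" "norm y > 0" by auto
    \<comment> \<open>Normalising both vectors turns the sum of squares in \<open>b_bound\<close>
      into a product of norms.\<close>
    have "\<bar>b ((1 / norm x) *\<^sub>R x) ((1 / norm y) *\<^sub>R y)\<bar> \<le> C"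
      using b_bound[of "(1 / norm x) *\<^sub>R x" "(1 / norm y) *\<^sub>R y"] nz by simp
    also have "b ((1 / norm x) *\<^sub>R x) ((1 / norm y) *\<^sub>R y) = b x y / (norm x * norm y)"
      using b_scale[of "1 / norm x" x] b_scale[of "1 / norm y" y x] b_sym[of x] by simp
    finally have "\<bar>b x y\<bar> \<le> C * (norm x * norm y)" using nz by (simp add: abs_mult field_simps)
    also have "\<dots> \<le> \<bar>C\<bar> * (norm x * norm y)" using nz by (intro mult_right_mono) auto
    finally show ?thesis by (simp add: mult.assoc)
  qed
  have "bounded_linear (b x)" for x
    by (rule bounded_linear_intro[where K="\<bar>C\<bar> * norm x"])
       (use b_add b_scale b_sym b_cs[of x] in \<open>simp_all add: algebra_simps\<close>)
  then have "\<exists>z. \<forall>y. b x y = inner z y" for x using riesz_representation by metis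
  then obtain P where P: "\<And>x y. b x y = inner (P x) y" by metis
  have P_eqI: "P x = z" if "\<And>y. b x y = inner z y" for x z
    using that P by (metis inner_eq_zero_iff inner_diff_left eq_iff_diff_eq_0)
  have P_add: "P (x + x') = P x + P x'" for x x' by (rule P_eqI) (simp add: b_add P[symmetric] inner_add)
  have P_scale: "P (r *\<^sub>R x) = r *\<^sub>R P x" for r x by (rule P_eqI) (simp add: b_scale P[symmetric])
  have b_c: "b (c *\<^sub>C x) (c *\<^sub>C y) = (cmod c)\<^sup>2 * b x y" for c x y
    by (simp add: b_def scaleC_add_right[symmetric] scaleC_diff_right[symmetric] hom algebra_simps)
  have P_i: "P (\<i> *\<^sub>C x) = \<i> *\<^sub>C P x" for x
  proof (rule P_eqI)
    fix y :: 'a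
    have "y = \<i> *\<^sub>C (- \<i>) *\<^sub>C y" unfolding scaleC_scaleC by simp
    then have "b (\<i> *\<^sub>C x) y = b x ((- \<i>) *\<^sub>C y)" using b_c[of \<i> x "(- \<i>) *\<^sub>C y"] by simp
    also have "\<dots> = inner (\<i> *\<^sub>C P x) y" by (simp add: P inner_scaleC_left)
    finally show "b (\<i> *\<^sub>C x) y = inner (\<i> *\<^sub>C P x) y" .
  qed
  have P_c: "P (c *\<^sub>C x) = c *\<^sub>C P x" for c x
  proof -
    have *: "c *\<^sub>C z = Re c *\<^sub>R z + Im c *\<^sub>R (\<i> *\<^sub>C z)" for z :: 'a
    proof -
      have "c = complex_of_real (Re c) + complex_of_real (Im c) * \<i>" by (simp add: complex_eq_iff)
      then have "c *\<^sub>C z = (complex_of_real (Re c) + complex_of_real (Im c) * \<i>) *\<^sub>C z" by simp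
      then show ?thesis by (simp only: scaleC_add_left scaleC_scaleC[symmetric] scaleC_of_real)
    qed
    show ?thesis by (simp only: *[of x] *[of "P x"] P_add P_scale P_i)
  qed
  have "bounded_linear P"
  proof (rule bounded_linear_intro[where K="\<bar>C\<bar>"])
    fix x
    have "norm (P x) * norm (P x) \<le> \<bar>C\<bar> * norm x * norm (P x)"
      using b_cs[of x "P x"] by (simp add: P power2_norm_eq_inner[symmetric] power2_eq_square)
    then show "norm (P x) \<le> norm x * \<bar>C\<bar>"
      by (cases "P x = 0") (simp_all add: mult.commute)
  qed (use P_add P_scale in auto)
  then have "bounded_clinear P" using P_c by (simp add: bounded_clinear_def)
  moreover have "is_adjoint P P"
    unfolding is_adjoint_def
  proof (intro allI)
    fix x y
    have re: "Re (cinner (P x) y) = Re (cinner x (P y))" for x y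
      using b_sym[of x y] by (simp add: Re_cinner P inner_commute)
    have "Im (cinner u w) = - Re (cinner (\<i> *\<^sub>C u) w)" for u w :: 'a by (simp add: cinner_scaleC_left)
    then have "Im (cinner (P x) y) = Im (cinner x (P y))" using re[of "\<i> *\<^sub>C x" y] by (simp add: P_i)
    with re show "cinner (P x) y = cinner x (P y)" by (simp add: complex_eq_iff)
  qed
  ultimately have "selfadjoint P" by (simp add: selfadjoint_def)
  moreover have "Re (cinner (P x) x) = V x" for x using b_xx[of x] by (simp add: Re_cinner P)
  ultimately show thesis using that by blast
qed

section \<open>The abstract linear-quadratic problem\<close>

definition null_control ::
  "('a::chilbert_space \<Rightarrow> 'h::chilbert_space) \<Rightarrow> ('a \<times> 'u::chilbert_space \<Rightarrow> 'h) \<Rightarrow> real \<Rightarrow> 'a \<Rightarrow> (real \<Rightarrow> 'a \<times> 'u) \<Rightarrow> bool" where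
  "null_control k L C x z \<longleftrightarrow> sq_approx 0 1 z \<and>
     (\<forall>t\<in>{0..1}. k (fst (z t)) - k (fst (z 0)) = integral {0..t} (\<lambda>s. L (z s))) \<and>
     fst (z 0) = x \<and> fst (z 1) = 0 \<and> integral {0..1} (\<lambda>t. (norm (z t))\<^sup>2) \<le> C * (norm x)\<^sup>2"

text \<open>The dynamics d/dt k(v) = L z, with z made of the state v and a control, expressed by
  bounded operators only. \<open>freq\<close> is coercivity on pure oscillations;
  \<open>steer\<close> gives transfers to 0 in unit time at quadratic energy cost. Together they
  make the value function finite and quadratically bounded.\<close>

locale lq_system =
  fixes k :: "'a::chilbert_space \<Rightarrow> 'h::chilbert_space"
    and L :: "'a \<times> 'u::chilbert_space \<Rightarrow> 'h"
    and S :: "'a \<times> 'u \<Rightarrow> 'a \<times> 'u" and \<epsilon> C :: real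
  assumes k: "bounded_clinear k" and L: "bounded_clinear L" and S: "bounded_clinear S"
    and eps: "\<epsilon> > 0"
    and freq: "\<And>(\<omega>::real) z. (\<i> * of_real \<omega>) *\<^sub>C k (fst z) = L z \<Longrightarrow> inner (S z) z \<le> - \<epsilon> * (norm z)\<^sup>2"
    and steer: "\<And>x. \<exists>z. null_control k L C x z"
begin

definition trajectory :: "real \<Rightarrow> (real \<Rightarrow> 'a \<times> 'u) \<Rightarrow> bool" where
  "trajectory T z \<longleftrightarrow> 0 \<le> T \<and> sq_approx 0 T z \<and>
     (\<forall>t\<in>{0..T}. k (fst (z t)) - k (fst (z 0)) = integral {0..t} (\<lambda>s. L (z s)))"

definition payoff :: "real \<Rightarrow> (real \<Rightarrow> 'a \<times> 'u) \<Rightarrow> real" where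
  "payoff T z = integral {0..T} (\<lambda>t. inner (S (z t)) (z t))"

definition energy :: "real \<Rightarrow> (real \<Rightarrow> 'a \<times> 'u) \<Rightarrow> real" where
  "energy T z = integral {0..T} (\<lambda>t. (norm (z t))\<^sup>2)"

lemma S_blin: "bounded_linear S" and L_blin: "bounded_linear L" and k_blin: "bounded_linear k"
  using S L k by (auto simp: bounded_clinear_def)

lemma S_scaleC: "S (c *\<^sub>C z) = c *\<^sub>C S z" and L_scaleC: "L (c *\<^sub>C z) = c *\<^sub>C L z"
  and k_scaleC: "k (c *\<^sub>C x) = c *\<^sub>C k x"
  using S L k unfolding bounded_clinear_def by blast+

lemma fst_scaleC: "fst (c *\<^sub>C x) = c *\<^sub>C fst x"
  by (simp add: scaleC_prod_def)

lemma payoff_integrable: "sq_approx 0 T z \<Longrightarrow> (\<lambda>t. inner (S (z t)) (z t)) integrable_on {0..T}"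
  by (intro sq_approx_inner_integrable sq_approx_bounded_linear[OF S_blin])

lemma L_integrable:
  assumes "sq_approx 0 T z" "t \<in> {0..T}"
  shows "(\<lambda>s. L (z s)) integrable_on {0..t}"
  using integrable_on_subinterval[OF sq_approx_integrable[OF sq_approx_bounded_linear[OF L_blin assms(1)]], of 0 t]
    assms(2) by auto

lemma trajectory_add:
  assumes "trajectory T z" "trajectory T w"
  shows "trajectory T (\<lambda>t. z t + w t)"
proof -
  have z: "sq_approx 0 T z" and w: "sq_approx 0 T w" using assms by (auto simp: trajectory_def)
  have "k (fst (z t + w t)) - k (fst (z 0 + w 0)) = integral {0..t} (\<lambda>s. L (z s + w s))"
    if t: "t \<in> {0..T}" for t
  proof -
    have "k (fst (z t + w t)) - k (fst (z 0 + w 0)) =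
        (k (fst (z t)) - k (fst (z 0))) + (k (fst (w t)) - k (fst (w 0)))"
      by (simp add: linear_simps[OF k_blin])
    also have "\<dots> = integral {0..t} (\<lambda>s. L (z s)) + integral {0..t} (\<lambda>s. L (w s))"
      using assms t by (simp add: trajectory_def)
    also have "\<dots> = integral {0..t} (\<lambda>s. L (z s + w s))"
      using integral_add[OF L_integrable[OF z t] L_integrable[OF w t]] by (simp add: linear_simps[OF L_blin])
    finally show ?thesis .
  qed
  then show ?thesis using assms sq_approx_add[OF z w] by (simp add: trajectory_def)
qed

lemma trajectory_scaleC:
  assumes "trajectory T z"
  shows "trajectory T (\<lambda>t. c *\<^sub>C z t)"
proof -
  have z: "sq_approx 0 T z" using assms by (auto simp: trajectory_def)
  have "k (fst (c *\<^sub>C z t)) - k (fst (c *\<^sub>C z 0)) = integral {0..t} (\<lambda>s. L (c *\<^sub>C z s))"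
    if t: "t \<in> {0..T}" for t
  proof -
    have "k (fst (c *\<^sub>C z t)) - k (fst (c *\<^sub>C z 0)) = c *\<^sub>C (k (fst (z t)) - k (fst (z 0)))"
      by (simp add: fst_scaleC k_scaleC scaleC_diff_right)
    also have "\<dots> = c *\<^sub>C integral {0..t} (\<lambda>s. L (z s))" using assms t by (simp add: trajectory_def)
    also have "\<dots> = integral {0..t} (\<lambda>s. c *\<^sub>C L (z s))"
      using integral_linear[OF L_integrable[OF z t] bounded_linear_scaleC_right[of c]] by (simp add: o_def)
    also have "\<dots> = integral {0..t} (\<lambda>s. L (c *\<^sub>C z s))" by (simp add: L_scaleC)
    finally show ?thesis .
  qed
  then show ?thesis using assms sq_approx_bounded_linear[OF bounded_linear_scaleC_right z]
    by (simp add: trajectory_def)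
qed

lemma payoff_scaleC: "payoff T (\<lambda>t. c *\<^sub>C z t) = (cmod c)\<^sup>2 * payoff T z"
proof -
  have "inner (S (c *\<^sub>C x)) (c *\<^sub>C x) = (cmod c)\<^sup>2 * inner (S x) x" for x
  proof -
    have "inner (S (c *\<^sub>C x)) (c *\<^sub>C x) = inner (S x) ((cnj c * c) *\<^sub>C x)"
      by (simp add: S_scaleC inner_scaleC_left scaleC_scaleC)
    also have "cnj c * c = of_real ((cmod c)\<^sup>2)" by (metis complex_norm_square mult.commute of_real_power)
    finally show ?thesis by (simp only: scaleC_of_real inner_scaleR_right)
  qed
  then show ?thesis by (simp add: payoff_def)
qed

lemma trajectory_minus: "trajectory T z \<Longrightarrow> trajectory T (\<lambda>t. - z t)"
  using trajectory_scaleC[of T z "-1"] by simp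

lemma trajectory_diff: "trajectory T z \<Longrightarrow> trajectory T w \<Longrightarrow> trajectory T (\<lambda>t. z t - w t)"
  using trajectory_add[OF _ trajectory_minus] by simp

lemma payoff_parallelogram:
  assumes "trajectory T z" "trajectory T w"
  shows "payoff T (\<lambda>t. z t + w t) + payoff T (\<lambda>t. z t - w t) = 2 * payoff T z + 2 * payoff T w"
proof -
  have z: "sq_approx 0 T z" and w: "sq_approx 0 T w" using assms by (auto simp: trajectory_def)
  have "payoff T (\<lambda>t. z t + w t) + payoff T (\<lambda>t. z t - w t) =
     integral {0..T} (\<lambda>t. inner (S (z t + w t)) (z t + w t) + inner (S (z t - w t)) (z t - w t))"
    unfolding payoff_def using z w
    by (intro integral_add[symmetric] payoff_integrable sq_approx_add sq_approx_diff)
  also have "\<dots> = integral {0..T} (\<lambda>t. 2 * inner (S (z t)) (z t) + 2 * inner (S (w t)) (w t))"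
    by (rule integral_cong) (simp add: linear_simps[OF S_blin] inner_add inner_diff)
  also have "\<dots> = 2 * payoff T z + 2 * payoff T w"
    unfolding payoff_def using z w
    by (simp add: integral_add integrable_on_mult_right payoff_integrable)
  finally show ?thesis .
qed

definition glue :: "real \<Rightarrow> (real \<Rightarrow> 'a \<times> 'u) \<Rightarrow> (real \<Rightarrow> 'a \<times> 'u) \<Rightarrow> real \<Rightarrow> 'a \<times> 'u" where
  "glue T z w t = (if t \<le> T then z t else w (t - T))"

lemma glue_integral:
  fixes f :: "'a \<times> 'u \<Rightarrow> 'b::banach"
  assumes "0 \<le> T" "0 \<le> T'" "(\<lambda>t. f (z t)) integrable_on {0..T}" "(\<lambda>t. f (w t)) integrable_on {0..T'}"
  shows "integral {0..T + T'} (\<lambda>t. f (glue T z w t)) = integral {0..T} (\<lambda>t. f (z t)) + integral {0..T'} (\<lambda>t. f (w t))"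
proof -
  have "((\<lambda>t. f (w (t - T))) has_integral integral {0..T'} (\<lambda>t. f (w t))) {T..T + T'}"
    using integrable_integral[OF assms(4)] has_integral_shift_real[of "\<lambda>t. f (w t)" T _ 0 T'] by (simp add: add.commute)
  from has_integral_glue[OF assms(1) _ integrable_integral[OF assms(3)] this] assms(2)
  have "((\<lambda>t. if t \<le> T then f (z t) else f (w (t - T))) has_integral
      (integral {0..T} (\<lambda>t. f (z t)) + integral {0..T'} (\<lambda>t. f (w t)))) {0..T + T'}" by simp
  then show ?thesis by (simp add: glue_def if_distrib integral_unique)
qed

lemma trajectory_glue:
  assumes z: "trajectory T z" and w: "trajectory T' w" and eq: "fst (z T) = fst (w 0)"
  shows "trajectory (T + T') (glue T z w)"
proof -
  have T: "0 \<le> T" "0 \<le> T'" and za: "sq_approx 0 T z" and wa: "sq_approx 0 T' w"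
    using z w by (auto simp: trajectory_def)
  have sq: "sq_approx 0 (T + T') (glue T z w)"
    using sq_approx_glue[OF T(1) _ za, of "T + T'" "\<lambda>t. w (t - T)"] sq_approx_shift[OF wa, of T] T
    by (simp add: glue_def[abs_def] add.commute)
  have "k (fst (glue T z w t)) - k (fst (glue T z w 0)) = integral {0..t} (\<lambda>s. L (glue T z w s))"
    if t: "t \<in> {0..T + T'}" for t
  proof (cases "t \<le> T")
    case True
    then have "integral {0..t} (\<lambda>s. L (glue T z w s)) = integral {0..t} (\<lambda>s. L (z s))"
      by (intro integral_cong) (simp add: glue_def)
    then show ?thesis using z True t T by (simp add: glue_def trajectory_def)
  next
    case False
    then have t': "t - T \<in> {0..T'}" "T \<in> {0..T}" using t T by auto
    have "integral {0..t} (\<lambda>s. L (glue T z w s)) = integral {0..T} (\<lambda>s. L (z s)) + integral {0..t - T} (\<lambda>s. L (w s))"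
      using glue_integral[OF T(1), of "t - T" L z w] t' L_integrable[OF za t'(2)] L_integrable[OF wa t'(1)] by simp
    also have "\<dots> = (k (fst (z T)) - k (fst (z 0))) + (k (fst (w (t - T))) - k (fst (w 0)))"
      using z w t' by (simp add: trajectory_def)
    finally show ?thesis using False T eq by (simp add: glue_def)
  qed
  then show ?thesis using sq T by (simp add: trajectory_def)
qed

lemma glue_ends:
  assumes "0 \<le> T" "0 \<le> T'" "fst (z T) = fst (w 0)"
  shows "glue T z w 0 = z 0" "fst (glue T z w (T + T')) = fst (w T')"
  using assms by (auto simp: glue_def)

lemma payoff_glue:
  assumes "trajectory T z" "trajectory T' w"
  shows "payoff (T + T') (glue T z w) = payoff T z + payoff T' w"
  unfolding payoff_def using assms
  by (intro glue_integral payoff_integrable) (auto simp: trajectory_def)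

lemma energy_glue:
  assumes "trajectory T z" "trajectory T' w"
  shows "energy (T + T') (glue T z w) = energy T z + energy T' w"
  unfolding energy_def using assms
  by (intro glue_integral sq_approx_norm2_integrable) (auto simp: trajectory_def)

definition transfer :: "'a \<Rightarrow> real \<Rightarrow> (real \<Rightarrow> 'a \<times> 'u) \<Rightarrow> bool" where
  "transfer x T z \<longleftrightarrow> trajectory T z \<and> fst (z 0) = x \<and> fst (z T) = 0"

lemma trajectory_zero: "0 \<le> T \<Longrightarrow> trajectory T (\<lambda>_. 0)"
  by (simp add: trajectory_def sq_approx_continuous linear_simps[OF L_blin])

text \<open>Resting at 0 without control is a trajectory of zero payoff and energy, so a transfer
  can be prolonged. Transfers with different horizons can then be added and subtracted on a common
  one.\<close>

lemma transfer_pad: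
  assumes "transfer x T z" "T \<le> T'"
  obtains w where "transfer x T' w" "payoff T' w = payoff T z" "energy T' w = energy T z"
proof
  have z: "trajectory T z" "fst (z 0) = x" "fst (z T) = 0" "0 \<le> T" using assms by (auto simp: transfer_def trajectory_def)
  have o: "trajectory (T' - T) (\<lambda>_. 0)" using assms(2) by (simp add: trajectory_zero)
  show "transfer x T' (glue T z (\<lambda>_. 0))"
    using trajectory_glue[OF z(1) o] glue_ends[of T "T' - T" z "\<lambda>_. 0"] z assms(2)
    by (simp add: transfer_def)
  show "payoff T' (glue T z (\<lambda>_. 0)) = payoff T z"
    using payoff_glue[OF z(1) o] by (simp add: payoff_def)
  show "energy T' (glue T z (\<lambda>_. 0)) = energy T z"
    using energy_glue[OF z(1) o] by (simp add: energy_def)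
qed

lemma transfer_pad2:
  assumes "transfer x T z" "transfer y T' w"
  obtains z' w' R where "transfer x R z'" "transfer y R w'" "payoff R z' = payoff T z" "payoff R w' = payoff T' w"
    "energy R z' = energy T z" "energy R w' = energy T' w"
  using transfer_pad[OF assms(1), of "max T T'"] transfer_pad[OF assms(2), of "max T T'"]
  by (metis max.cobounded1 max.cobounded2)

text \<open>A transfer starting at 0 is a closed loop, so the integrated frequency inequality
  applies. This coercivity absorbs the mixed terms in the upper bound for payoffs.\<close>

lemma payoff_loop:
  assumes "transfer 0 T z"
  shows "payoff T z \<le> - \<epsilon> * energy T z"
  unfolding payoff_def energy_def
proof (rule frequency_inequality_integral[OF _ L S freq, where K="\<lambda>z. k (fst z)"])
  show "bounded_clinear (\<lambda>z. k (fst z))"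
    using k bounded_linear_compose[OF k_blin bounded_linear_fst]
    by (auto simp: bounded_clinear_def scaleC_prod_def)
qed (use assms in \<open>auto simp: transfer_def trajectory_def\<close>)

lemma steering:
  obtains z where "transfer x 1 z" "energy 1 z \<le> C * (norm x)\<^sup>2"
  using steer[of x] that by (auto simp: null_control_def transfer_def trajectory_def energy_def)

lemma S_bound:
  obtains s where "s \<ge> 0" "\<And>x y. \<bar>inner (S x) y\<bar> \<le> s * norm x * norm y"
proof -
  obtain s where s: "s \<ge> 0" "\<And>x. norm (S x) \<le> norm x * s"
    using bounded_linear.nonneg_bounded[OF S_blin] by blast
  have "\<bar>inner (S x) y\<bar> \<le> s * norm x * norm y" for x y
  proof -
    have "\<bar>inner (S x) y\<bar> \<le> norm (S x) * norm y" by (rule Cauchy_Schwarz_ineq2)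
    also have "\<dots> \<le> (norm x * s) * norm y" by (intro mult_right_mono s) auto
    finally show ?thesis by (simp only: mult_ac)
  qed
  with s(1) show thesis using that by blast
qed

definition payoffs :: "'a \<Rightarrow> real set" where
  "payoffs x = {payoff T z | T z. transfer x T z}"

text \<open>One cheap transfer gives the lower bound. For the upper bound, the difference
  \<open>q\<close> between an arbitrary transfer and the cheap one from the same state is a loop;
  its negative payoff absorbs the mixed terms, and only the energy of the cheap transfer
  remains.\<close>

lemma payoff_bounds:
  obtains M where "\<And>x. \<exists>p\<in>payoffs x. - M * (norm x)\<^sup>2 \<le> p" "\<And>x p. p \<in> payoffs x \<Longrightarrow> p \<le> M * (norm x)\<^sup>2"
proof -
  obtain s where s: "s \<ge> 0" "\<And>x y. \<bar>inner (S x) y\<bar> \<le> s * norm x * norm y" using S_bound by metis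
  \<comment> \<open>\<open>s\<close> estimates the form on the cheap transfer;
    \<open>s\<^sup>2 / \<epsilon>\<close> remains of the mixed terms after splitting off
    \<open>\<epsilon> * (norm (q t))\<^sup>2\<close>, which is exactly what the loop estimate pays
    for.\<close>
  define D where "D = s + s\<^sup>2 / \<epsilon>"
  have D: "s \<le> D" "0 \<le> D" using s eps by (auto simp: D_def)
  have C: "0 \<le> C * (norm x)\<^sup>2" for x :: 'a
  proof -
    obtain z where z: "transfer x 1 z" "energy 1 z \<le> C * (norm x)\<^sup>2" by (rule steering)
    have "0 \<le> energy 1 z" unfolding energy_def
      using z(1) by (intro integral_nonneg sq_approx_norm2_integrable) (auto simp: transfer_def trajectory_def)
    with z show ?thesis by simp
  qed
  show thesis
  proof
    fix x
    obtain z where z: "transfer x 1 z" "energy 1 z \<le> C * (norm x)\<^sup>2" by (rule steering)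
    have zs: "sq_approx 0 1 z" using z by (auto simp: transfer_def trajectory_def)
    have "- (s * energy 1 z) = integral {0..1} (\<lambda>t. - (s * (norm (z t))\<^sup>2))" by (simp add: energy_def)
    also have "\<dots> \<le> payoff 1 z" unfolding payoff_def
    proof (intro integral_le payoff_integrable zs)
      show "(\<lambda>t. - (s * (norm (z t))\<^sup>2)) integrable_on {0..1}"
        by (intro integrable_neg integrable_on_mult_right sq_approx_norm2_integrable zs)
      show "- (s * (norm (z t))\<^sup>2) \<le> inner (S (z t)) (z t)" for t
        using s(2)[of "z t" "z t"] by (simp add: power2_eq_square)
    qed
    finally have "- (s * energy 1 z) \<le> payoff 1 z" .
    moreover have "s * energy 1 z \<le> D * (C * (norm x)\<^sup>2)"
      using D z(2) C s(1) by (intro order_trans[OF mult_left_mono[OF z(2) s(1)]] mult_right_mono) auto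
    ultimately show "\<exists>p\<in>payoffs x. - (D * C) * (norm x)\<^sup>2 \<le> p"
      using z(1) unfolding payoffs_def by (intro bexI[of _ "payoff 1 z"]) auto
  next
    fix x p assume "p \<in> payoffs x"
    then obtain T z where p: "p = payoff T z" "transfer x T z" by (auto simp: payoffs_def)
    obtain w where w: "transfer x 1 w" "energy 1 w \<le> C * (norm x)\<^sup>2" by (rule steering)
    obtain z' w' R where R: "transfer x R z'" "transfer x R w'" "payoff R z' = p" "energy R w' = energy 1 w"
      using transfer_pad2[OF p(2) w(1)] p(1) by metis
    define q where "q t = z' t - w' t" for t
    have q: "transfer 0 R q" using trajectory_diff R(1,2) by (auto simp: transfer_def q_def[abs_def])
    have sq: "sq_approx 0 R q" "sq_approx 0 R w'" "sq_approx 0 R z'"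
      using q R(1,2) by (auto simp: transfer_def trajectory_def)
    have "payoff R z' \<le> integral {0..R} (\<lambda>t. inner (S (q t)) (q t) + \<epsilon> * (norm (q t))\<^sup>2 + D * (norm (w' t))\<^sup>2)"
      unfolding payoff_def
    proof (intro integral_le payoff_integrable sq integrable_add integrable_on_mult_right sq_approx_norm2_integrable)
      fix t
      have z': "z' t = q t + w' t" by (simp add: q_def)
      have "inner (S (z' t)) (z' t) = inner (S (q t)) (q t) + inner (S (q t)) (w' t) + inner (S (w' t)) (q t) + inner (S (w' t)) (w' t)"
        unfolding z' by (simp add: linear_simps[OF S_blin] inner_add)
      also have "\<dots> \<le> inner (S (q t)) (q t) + (s * norm (q t) * norm (w' t) + s * norm (q t) * norm (w' t)) + s * (norm (w' t))\<^sup>2"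
        using s(2)[of "q t" "w' t"] s(2)[of "w' t" "q t"] s(2)[of "w' t" "w' t"]
        by (simp add: power2_eq_square abs_le_iff mult.commute mult.left_commute)
      also have "s * norm (q t) * norm (w' t) + s * norm (q t) * norm (w' t) \<le> \<epsilon> * (norm (q t))\<^sup>2 + s\<^sup>2 / \<epsilon> * (norm (w' t))\<^sup>2"
      proof -
        have "0 \<le> (\<epsilon> * norm (q t) - s * norm (w' t))\<^sup>2 / \<epsilon>" using eps by simp
        also have "\<dots> = \<epsilon> * (norm (q t))\<^sup>2 + s\<^sup>2 / \<epsilon> * (norm (w' t))\<^sup>2 - 2 * (s * norm (q t) * norm (w' t))"
          using eps by (simp add: power2_eq_square field_simps)
        finally show ?thesis by simp
      qed
      finally show "inner (S (z' t)) (z' t) \<le> inner (S (q t)) (q t) + \<epsilon> * (norm (q t))\<^sup>2 + D * (norm (w' t))\<^sup>2"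
        by (simp add: D_def algebra_simps)
    qed
    also have "\<dots> = payoff R q + \<epsilon> * energy R q + D * energy R w'"
      unfolding payoff_def energy_def
      by (simp add: integral_add integrable_add payoff_integrable integrable_on_mult_right sq_approx_norm2_integrable sq)
    also have "\<dots> \<le> D * (C * (norm x)\<^sup>2)"
      using payoff_loop[OF q] mult_left_mono[OF w(2) D(2)] R(4) by simp
    finally show "p \<le> D * C * (norm x)\<^sup>2" using R(3) by (simp add: mult.assoc)
  qed
qed

definition bellman :: "'a \<Rightarrow> real" where "bellman x = Sup (payoffs x)"

lemma payoff_le_bellman:
  assumes "transfer x T z" shows "payoff T z \<le> bellman x"
  unfolding bellman_def
proof (rule cSup_upper)
  show "payoff T z \<in> payoffs x" using assms by (auto simp: payoffs_def)
  obtain M where "\<And>x p. p \<in> payoffs x \<Longrightarrow> p \<le> M * (norm x)\<^sup>2" using payoff_bounds by metis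
  then show "bdd_above (payoffs x)" by (intro bdd_aboveI)
qed

lemma bellman_le:
  assumes "\<And>T z. transfer x T z \<Longrightarrow> payoff T z \<le> u" shows "bellman x \<le> u"
  unfolding bellman_def
proof (rule cSup_least)
  obtain z where "transfer x 1 z" using steering by metis
  then show "payoffs x \<noteq> {}" by (auto simp: payoffs_def)
qed (use assms in \<open>auto simp: payoffs_def\<close>)

lemma bellman_bound: obtains M where "\<And>x. \<bar>bellman x\<bar> \<le> M * (norm x)\<^sup>2"
proof -
  obtain M where M: "\<And>x. \<exists>p\<in>payoffs x. - M * (norm x)\<^sup>2 \<le> p" "\<And>x p. p \<in> payoffs x \<Longrightarrow> p \<le> M * (norm x)\<^sup>2"
    using payoff_bounds by metis
  have "\<bar>bellman x\<bar> \<le> M * (norm x)\<^sup>2" for x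
  proof -
    have "bellman x \<le> M * (norm x)\<^sup>2" by (rule bellman_le, rule M(2)) (auto simp: payoffs_def)
    moreover obtain T z where "transfer x T z" "- M * (norm x)\<^sup>2 \<le> payoff T z"
      using M(1)[of x] by (auto simp: payoffs_def)
    then have "- M * (norm x)\<^sup>2 \<le> bellman x" using payoff_le_bellman order_trans by blast
    ultimately show ?thesis by simp
  qed
  then show thesis using that by blast
qed

text \<open>Scaling transfers by \<open>c\<close> gives one inequality; the other is the same
  inequality for \<open>1 / c\<close> and the state \<open>c *\<^sub>C x\<close>.\<close>

lemma bellman_scaleC: "bellman (c *\<^sub>C x) = (cmod c)\<^sup>2 * bellman x"
proof (cases "c = 0")
  case True
  obtain M where "\<And>x. \<bar>bellman x\<bar> \<le> M * (norm x)\<^sup>2" using bellman_bound by blast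
  from this[of 0] True show ?thesis by simp
next
  case False
  have le: "(cmod c)\<^sup>2 * bellman x \<le> bellman (c *\<^sub>C x)" if c: "c \<noteq> 0" for c x
  proof -
    have "bellman x \<le> bellman (c *\<^sub>C x) / (cmod c)\<^sup>2"
    proof (rule bellman_le)
      fix T z assume "transfer x T z"
      then have "transfer (c *\<^sub>C x) T (\<lambda>t. c *\<^sub>C z t)"
        by (simp add: transfer_def trajectory_scaleC fst_scaleC)
      from payoff_le_bellman[OF this] show "payoff T z \<le> bellman (c *\<^sub>C x) / (cmod c)\<^sup>2"
        using c by (simp add: payoff_scaleC field_simps)
    qed
    then show ?thesis using c by (simp add: field_simps)
  qed
  have "(cmod (1 / c))\<^sup>2 * bellman (c *\<^sub>C x) \<le> bellman x"
    using le[of "1 / c" "c *\<^sub>C x"] False by (simp add: scaleC_scaleC)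
  then have "bellman (c *\<^sub>C x) \<le> (cmod c)\<^sup>2 * bellman x"
    using False by (simp add: norm_divide power_divide field_simps)
  then show ?thesis using le[OF False, of x] by simp
qed

text \<open>Since the payoff is a quadratic form and transfers form a vector space, the supremum
  inherits one inequality of the parallelogram law directly; the other one is the first
  one applied to \<open>x + y\<close> and \<open>x - y\<close>.\<close>

lemma bellman_parallelogram: "bellman (x + y) + bellman (x - y) = 2 * bellman x + 2 * bellman y"
proof -
  have le: "2 * bellman x + 2 * bellman y \<le> bellman (x + y) + bellman (x - y)" for x y
  proof -
    have "payoff T z + bellman y \<le> (bellman (x + y) + bellman (x - y)) / 2" if z: "transfer x T z" for T z
    proof -
      have "bellman y \<le> (bellman (x + y) + bellman (x - y)) / 2 - payoff T z"
      proof (rule bellman_le)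
        fix T' w assume w: "transfer y T' w"
        obtain z' w' R where R: "transfer x R z'" "transfer y R w'" "payoff R z' = payoff T z" "payoff R w' = payoff T' w"
          using transfer_pad2[OF z w] by metis
        then have tr: "trajectory R z'" "trajectory R w'" by (auto simp: transfer_def)
        have "transfer (x + y) R (\<lambda>t. z' t + w' t)" "transfer (x - y) R (\<lambda>t. z' t - w' t)"
          using R(1,2) trajectory_add[OF tr] trajectory_diff[OF tr] by (auto simp: transfer_def)
        then have "2 * payoff R z' + 2 * payoff R w' \<le> bellman (x + y) + bellman (x - y)"
          unfolding payoff_parallelogram[OF tr, symmetric] by (intro add_mono payoff_le_bellman)
        then show "payoff T' w \<le> (bellman (x + y) + bellman (x - y)) / 2 - payoff T z" using R(3,4) by (simp add: field_simps)
      qed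
      then show ?thesis by (simp add: field_simps)
    qed
    then have "bellman x \<le> (bellman (x + y) + bellman (x - y)) / 2 - bellman y"
      by (intro bellman_le) (simp add: le_diff_eq)
    then show ?thesis by (simp add: field_simps)
  qed
  have b2: "bellman (2 *\<^sub>R u) = 4 * bellman u" for u
    using bellman_scaleC[of "complex_of_real 2" u] unfolding scaleC_of_real by simp
  have "2 * bellman (x + y) + 2 * bellman (x - y) \<le> 4 * bellman x + 4 * bellman y"
    using le[of "x + y" "x - y"] b2[of x] b2[of y] by (simp add: scaleR_2)
  with le[of x y] show ?thesis by simp
qed

text \<open>Appending any transfer from the final state gives a transfer from the initial one, and
  payoffs add. Taking the supremum over the appended part gives this half of dynamic
  programming.\<close>

lemma bellman_inequality:
  assumes z: "trajectory T z"
  shows "payoff T z + bellman (fst (z T)) \<le> bellman (fst (z 0))"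
proof -
  have "bellman (fst (z T)) \<le> bellman (fst (z 0)) - payoff T z"
  proof (rule bellman_le)
    fix T' w assume w: "transfer (fst (z T)) T' w"
    then have w': "trajectory T' w" "fst (z T) = fst (w 0)" "fst (w T') = 0" by (auto simp: transfer_def)
    have "0 \<le> T" "0 \<le> T'" using z w'(1) by (auto simp: trajectory_def)
    then have "transfer (fst (z 0)) (T + T') (glue T z w)"
      using trajectory_glue[OF z w'(1,2)] glue_ends[of T T' z w] w' by (simp add: transfer_def)
    from payoff_le_bellman[OF this] show "payoff T' w \<le> bellman (fst (z 0)) - payoff T z"
      using payoff_glue[OF z w'(1)] by simp
  qed
  then show ?thesis by simp
qed

theorem lyapunov_operator:
  obtains P where "selfadjoint P" "\<And>T z. trajectory T z \<Longrightarrow>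
    Re (cinner (P (fst (z T))) (fst (z T))) - Re (cinner (P (fst (z 0))) (fst (z 0))) + payoff T z \<le> 0"
proof -
  obtain M where M: "\<And>x. \<bar>bellman x\<bar> \<le> M * (norm x)\<^sup>2" using bellman_bound by blast
  obtain P where P: "selfadjoint P" "\<And>x. Re (cinner (P x) x) = bellman x"
    using quadratic_form_operator[of bellman M, OF bellman_parallelogram M bellman_scaleC] by blast
  have "Re (cinner (P (fst (z T))) (fst (z T))) - Re (cinner (P (fst (z 0))) (fst (z 0))) + payoff T z \<le> 0"
    if "trajectory T z" for T z
    using bellman_inequality[OF that] by (simp add: P(2))
  with P(1) show thesis using that by blast
qed

end

section \<open>Strongly continuous semigroups\<close>

text \<open>Baire: the closed sets \<open>E m\<close> exhaust the space, so one of them contains a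
  ball, and differences of points of that ball transfer the bound to every direction.\<close>

theorem uniform_boundedness_sequence:
  fixes F :: "nat \<Rightarrow> 'a::banach \<Rightarrow> 'b::real_normed_vector"
  assumes lin: "\<And>n. bounded_linear (F n)" and bdd: "\<And>x. \<exists>K. \<forall>n. norm (F n x) \<le> K"
  obtains K where "\<And>n x. norm (F n x) \<le> K * norm x"
proof -
  define E where "E m = (\<Inter>n. {x. norm (F n x) \<le> real m})" for m
  have closed: "closed (E m)" for m
    unfolding E_def using lin
    by (intro closed_INT ballI closed_Collect_le continuous_intros) (auto intro: linear_continuous_on)
  have union: "\<Union>(range E) = UNIV"
  proof -
    have "\<exists>m. x \<in> E m" for x
    proof -
      obtain K where "\<forall>n. norm (F n x) \<le> K" using bdd by blast
      moreover obtain m where "K \<le> real m" using real_arch_simple by blast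
      ultimately show ?thesis by (auto simp: E_def intro: order_trans)
    qed
    then show ?thesis by blast
  qed
  have "\<exists>m. interior (E m) \<noteq> {}"
  proof (rule ccontr)
    assume "\<not> ?thesis"
    then have "euclidean interior_of \<Union>(range E) = {}"
      using closed by (intro Baire_category_alt disjI1 completely_metrizable_space_euclidean)
        (auto simp: closed_closedin[symmetric] interior_of_def interior_def)
    then show False using interior_of_topspace[of "euclidean :: 'a topology"] by (simp add: union)
  qed
  then obtain m x0 where "x0 \<in> interior (E m)" by blast
  then obtain r where r: "r > 0" "cball x0 r \<subseteq> E m"
    by (meson mem_interior_cball)
  have "norm (F n x) \<le> (2 * real m / r) * norm x" for n x
  proof (cases "x = 0")
    case True
    then show ?thesis using lin[of n] by (simp add: linear_simps)
  next
    case False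
    define y where "y = x0 + (r / norm x) *\<^sub>R x"
    have "y \<in> cball x0 r" using False r(1) by (simp add: y_def dist_norm)
    then have 1: "norm (F n y) \<le> real m" using r(2) by (auto simp: E_def)
    have "x0 \<in> E m" using r by auto
    then have 2: "norm (F n x0) \<le> real m" by (auto simp: E_def)
    have "F n y = F n x0 + (r / norm x) *\<^sub>R F n x" using lin[of n] by (simp add: y_def linear_simps)
    then have "norm ((r / norm x) *\<^sub>R F n x) \<le> 2 * real m"
      using norm_triangle_ineq4[of "F n y" "F n x0"] 1 2 by simp
    then show ?thesis using False r(1) by (simp add: field_simps)
  qed
  then show thesis using that by blast
qed

lemma c0_linear: "c0_semigroup G \<Longrightarrow> 0 \<le> t \<Longrightarrow> bounded_linear (G t)"
  by (simp add: c0_semigroup_def bounded_clinear_def)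

lemma c0_scaleC: "c0_semigroup G \<Longrightarrow> 0 \<le> t \<Longrightarrow> G t (c *\<^sub>C x) = c *\<^sub>C G t x"
  by (simp add: c0_semigroup_def bounded_clinear_def)

lemma c0_zero: "c0_semigroup G \<Longrightarrow> G 0 x = x"
  by (simp add: c0_semigroup_def)

lemma c0_add: "c0_semigroup G \<Longrightarrow> 0 \<le> s \<Longrightarrow> 0 \<le> t \<Longrightarrow> G (s + t) x = G s (G t x)"
  by (simp add: c0_semigroup_def)

lemma c0_right_continuous: "c0_semigroup G \<Longrightarrow> ((\<lambda>t. G t x) \<longlongrightarrow> x) (at_right 0)"
  by (simp add: c0_semigroup_def)

text \<open>If no bound held near 0, some times tending to 0 would carry operators of growing norm;
  yet every orbit is bounded along these times by strong continuity at 0, against uniform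
  boundedness. The semigroup law then extends the local bound in steps of length
  \<open>\<delta>\<close>.\<close>

lemma c0_bounded:
  assumes G: "c0_semigroup G"
  obtains M where "M \<ge> 1" "\<And>t x. t \<in> {0..T} \<Longrightarrow> norm (G t x) \<le> M * norm x"
proof -
  have "\<exists>\<delta>>0. \<exists>K. \<forall>t\<in>{0..\<delta>}. \<forall>x. norm (G t x) \<le> K * norm x"
  proof (rule ccontr)
    assume "\<not> ?thesis"
    then have "\<exists>t\<in>{0..1 / real (Suc n)}. \<exists>x. norm (G t x) > real n * norm x" for n
      by (meson not_le of_nat_0_less_iff zero_less_Suc zero_less_divide_1_iff)
    then obtain t x where t: "\<And>n. t n \<in> {0..1 / real (Suc n)}" and x: "\<And>n. norm (G (t n) (x n)) > real n * norm (x n)"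
      by metis
    have t_lim: "t \<longlonglongrightarrow> 0"
    proof (rule tendsto_sandwich[of "\<lambda>_. 0" _ _ "\<lambda>n. 1 / real (Suc n)"])
      show "(\<lambda>n. 1 / real (Suc n)) \<longlonglongrightarrow> 0" by (intro LIMSEQ_Suc lim_1_over_n)
    qed (use t in auto)
    have "\<exists>K. \<forall>n. norm (G (t n) y) \<le> K" for y
    proof -
      have "((\<lambda>s. G s y) \<longlongrightarrow> y) (at 0 within {0..})"
        using c0_right_continuous[OF G, of y]
        by (simp add: at_within_Ici_at_right)
      moreover have "G 0 y = y" by (rule c0_zero[OF G])
      ultimately have "((\<lambda>s. G s y) \<longlongrightarrow> G 0 y) (at 0 within {0..})" by simp
      then have "(\<lambda>n. G (t n) y) \<longlonglongrightarrow> G 0 y"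
        using t t_lim continuous_within_sequentially[of 0 "{0..}" "\<lambda>s. G s y"]
        by (auto simp: continuous_within o_def)
      then have "Bseq (\<lambda>n. G (t n) y)" by (rule convergentI[THEN convergent_imp_Bseq])
      then show ?thesis by (auto simp: Bseq_def)
    qed
    moreover have "bounded_linear (G (t n))" for n using t by (intro c0_linear[OF G]) auto
    ultimately obtain K where K: "\<And>n y. norm (G (t n) y) \<le> K * norm y"
      using uniform_boundedness_sequence[of "\<lambda>n. G (t n)"] by blast
    obtain n where "K \<le> real n" using real_arch_simple by blast
    then have "K * norm (x n) \<le> real n * norm (x n)" by (intro mult_right_mono) auto
    with K[of n "x n"] x[of n] show False by linarith
  qed
  then obtain \<delta> K where d: "\<delta> > 0" and K: "\<And>t x. t \<in> {0..\<delta>} \<Longrightarrow> norm (G t x) \<le> K * norm x" by blast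
  define L where "L = max 1 K"
  have L: "norm (G t x) \<le> L * norm x" if "t \<in> {0..\<delta>}" for t x
    using order_trans[OF K[OF that, of x] mult_right_mono[of K L "norm x"]] by (simp add: L_def)
  have L1: "L \<ge> 1" by (simp add: L_def)
  have *: "norm (G t x) \<le> L ^ Suc n * norm x" if "t \<in> {0..real (Suc n) * \<delta>}" for t n x
    using that
  proof (induction n arbitrary: t)
    case 0
    then show ?case using L by simp
  next
    case (Suc n)
    show ?case
    proof (cases "t \<le> \<delta>")
      case True
      then have "norm (G t x) \<le> L * norm x" using Suc.prems L by auto
      also have "\<dots> \<le> L ^ Suc (Suc n) * norm x"
        using L1 by (intro mult_right_mono self_le_power) auto
      finally show ?thesis .
    next
      case False
      have "G (\<delta> + (t - \<delta>)) x = G \<delta> (G (t - \<delta>) x)"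
        using False d by (intro c0_add[OF G]) auto
      then have "norm (G t x) \<le> L * norm (G (t - \<delta>) x)" using L[of \<delta> "G (t - \<delta>) x"] d by simp
      also have "\<dots> \<le> L * (L ^ Suc n * norm x)"
        using Suc.prems False L1 by (intro mult_left_mono Suc.IH) (auto simp: algebra_simps)
      finally show ?thesis by (simp add: mult.assoc)
    qed
  qed
  obtain n where n: "T / \<delta> \<le> real n" using real_arch_simple by blast
  then have "T \<le> real (Suc n) * \<delta>" using d by (simp add: field_simps)
  then have "norm (G t x) \<le> L ^ Suc n * norm x" if "t \<in> {0..T}" for t x using *[of t n x] that by auto
  moreover have "L ^ Suc n \<ge> 1" using L1 by (rule one_le_power)
  ultimately show thesis using that by blast
qed

text \<open>Right continuity at 0 gives continuity from both sides: for \<open>a < b\<close> the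
  increment is \<open>G a\<close> applied to an increment from time 0 to \<open>b - a\<close>, and
  the bound on \<open>G a\<close> is uniform.\<close>

lemma c0_continuous:
  assumes G: "c0_semigroup G"
  shows "continuous_on {0..T} (\<lambda>t. G t x)"
  unfolding continuous_on_iff
proof (intro ballI allI impI)
  obtain M where M: "M \<ge> 1" "\<And>t x. t \<in> {0..T} \<Longrightarrow> norm (G t x) \<le> M * norm x"
    using c0_bounded[OF G] by blast
  fix t e :: real assume t: "t \<in> {0..T}" and e: "e > 0"
  have "e / M > 0" using M e by simp
  then have "eventually (\<lambda>h. dist (G h x) x < e / M) (at_right 0)"
    using c0_right_continuous[OF G, of x] tendstoD by blast
  then obtain d where d: "d > 0" "\<And>h. 0 < h \<Longrightarrow> h < d \<Longrightarrow> dist (G h x) x < e / M"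
    by (auto simp: eventually_at_right_field)
  have diff: "dist (G a x) (G b x) < e" if ab: "a \<in> {0..T}" "b \<in> {0..T}" "a < b" "b < a + d" for a b
  proof -
    have "G (a + (b - a)) x = G a (G (b - a) x)" using ab by (intro c0_add[OF G]) auto
    then have "dist (G a x) (G b x) = norm (G a (x - G (b - a) x))"
      using c0_linear[OF G, of a] ab by (simp add: dist_norm linear_simps)
    also have "\<dots> \<le> M * norm (x - G (b - a) x)" by (rule M(2)[OF ab(1)])
    also have "\<dots> < M * (e / M)"
      using d(2)[of "b - a"] ab M by (intro mult_strict_left_mono) (auto simp: dist_norm norm_minus_commute)
    finally show ?thesis using M by simp
  qed
  show "\<exists>d>0. \<forall>s\<in>{0..T}. dist s t < d \<longrightarrow> dist (G s x) (G t x) < e"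
  proof (intro exI conjI ballI impI)
    show "d > 0" by fact
    fix s assume s: "s \<in> {0..T}" "dist s t < d"
    consider "s < t" | "s = t" | "t < s" by linarith
    then show "dist (G s x) (G t x) < e"
      using diff[of s t] diff[of t s] s t e by cases (auto simp: dist_real_def dist_commute)
  qed
qed

lemma c0_joint_continuous:
  fixes G :: "real \<Rightarrow> 'h::chilbert_space \<Rightarrow> 'h"
  assumes G: "c0_semigroup G" and r: "continuous_on S r" and h: "continuous_on S h"
    and rT: "\<And>p. p \<in> S \<Longrightarrow> r p \<in> {0..T}"
  shows "continuous_on S (\<lambda>p. G (r p) (h p))"
  unfolding continuous_on_def
proof
  obtain M where M: "M \<ge> 1" "\<And>t x. t \<in> {0..T} \<Longrightarrow> norm (G t x) \<le> M * norm x"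
    using c0_bounded[OF G] by blast
  fix p0 assume p0: "p0 \<in> S"
  have "((\<lambda>p. G (r p) (h p - h p0)) \<longlongrightarrow> 0) (at p0 within S)"
  proof (rule Lim_null_comparison)
    show "\<forall>\<^sub>F p in at p0 within S. norm (G (r p) (h p - h p0)) \<le> M * norm (h p - h p0)"
      using M(2) rT by (auto simp: eventually_at_filter)
    have "((\<lambda>p. M * norm (h p - h p0)) \<longlongrightarrow> M * norm (h p0 - h p0)) (at p0 within S)"
      using h p0 by (intro tendsto_intros) (auto simp: continuous_on_def)
    then show "((\<lambda>p. M * norm (h p - h p0)) \<longlongrightarrow> 0) (at p0 within S)" by simp
  qed
  moreover have "continuous_on S (\<lambda>p. G (r p) (h p0))"
    using rT by (intro continuous_on_compose2[OF c0_continuous[OF G, of T "h p0"] r]) blast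
  then have "((\<lambda>p. G (r p) (h p0)) \<longlongrightarrow> G (r p0) (h p0)) (at p0 within S)"
    using p0 by (auto simp: continuous_on_def)
  ultimately have "((\<lambda>p. G (r p) (h p - h p0) + G (r p) (h p0)) \<longlongrightarrow> 0 + G (r p0) (h p0)) (at p0 within S)"
    by (rule tendsto_add)
  moreover have "\<forall>\<^sub>F p in at p0 within S. G (r p) (h p - h p0) + G (r p) (h p0) = G (r p) (h p)"
    using c0_linear[OF G] rT by (auto simp: eventually_at_filter linear_simps)
  ultimately show "((\<lambda>p. G (r p) (h p)) \<longlongrightarrow> G (r p0) (h p0)) (at p0 within S)"
    by (auto intro: Lim_transform_eventually)
qed

section \<open>Generators, differentiable orbits and resolvents\<close>

lemma generates_limit:
  "generates D A G \<Longrightarrow> x \<in> D \<Longrightarrow> ((\<lambda>h. (1 / h) *\<^sub>R (G h x - x)) \<longlongrightarrow> A x) (at_right 0)"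
  by (auto simp: generates_def)

lemma generates_invariant:
  assumes G: "c0_semigroup G" and A: "generates D A G" and x: "x \<in> D" and t: "0 \<le> t"
  shows "G t x \<in> D" "A (G t x) = G t (A x)"
proof -
  note lin = c0_linear[OF G t]
  have "((\<lambda>h. G t ((1 / h) *\<^sub>R (G h x - x))) \<longlongrightarrow> G t (A x)) (at_right 0)"
    by (intro bounded_linear.tendsto[OF lin] generates_limit[OF A x])
  moreover have "\<forall>\<^sub>F h in at_right 0. G t ((1 / h) *\<^sub>R (G h x - x)) = (1 / h) *\<^sub>R (G h (G t x) - G t x)"
    unfolding eventually_at_right_field
  proof (intro exI[of _ 1] conjI allI impI)
    fix h :: real assume "0 < h" "h < 1"
    then have "G t (G h x) = G h (G t x)" using c0_add[OF G] t by (metis add.commute less_imp_le)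
    then show "G t ((1 / h) *\<^sub>R (G h x - x)) = (1 / h) *\<^sub>R (G h (G t x) - G t x)"
      using lin by (simp add: linear_simps)
  qed simp
  ultimately have lim: "((\<lambda>h. (1 / h) *\<^sub>R (G h (G t x) - G t x)) \<longlongrightarrow> G t (A x)) (at_right 0)"
    by (rule Lim_transform_eventually)
  then show D: "G t x \<in> D" using A by (auto simp: generates_def)
  show "A (G t x) = G t (A x)"
    using tendsto_unique[OF _ generates_limit[OF A D] lim] by simp
qed

lemma has_vector_derivative_withinI:
  fixes f :: "real \<Rightarrow> 'e::real_normed_vector"
  assumes le: "\<And>s. s \<in> S \<Longrightarrow> s \<noteq> t \<Longrightarrow> norm (f s - f t - (s - t) *\<^sub>R d) \<le> \<bar>s - t\<bar> * E s"
    and E: "(E \<longlongrightarrow> 0) (at t within S)"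
  shows "(f has_vector_derivative d) (at t within S)"
  unfolding has_vector_derivative_def has_derivative_iff_norm
proof
  show "bounded_linear (\<lambda>x. x *\<^sub>R d)" by (rule bounded_linear_scaleR_left)
  show "((\<lambda>s. norm (f s - f t - (s - t) *\<^sub>R d) / norm (s - t)) \<longlongrightarrow> 0) (at t within S)"
  proof (rule Lim_null_comparison[OF _ E])
    show "\<forall>\<^sub>F s in at t within S. norm (norm (f s - f t - (s - t) *\<^sub>R d) / norm (s - t)) \<le> E s"
      using le by (auto simp: eventually_at_filter field_simps)
  qed
qed

text \<open>The generator is a right derivative at 0. Factoring the increment through the earlier
  time \<open>min s t\<close> treats left and right quotients alike: \<open>G (min s t)\<close> acts
  on a quotient at 0, and local boundedness and strong continuity control the two summands of
  \<open>E\<close>.\<close>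

lemma generates_derivative:
  assumes G: "c0_semigroup G" and A: "generates D A G" and x: "x \<in> D" and t: "t \<in> {0..T}"
  shows "((\<lambda>t. G t x) has_vector_derivative G t (A x)) (at t within {0..T})"
proof -
  obtain M where M: "M \<ge> 1" "\<And>t x. t \<in> {0..T} \<Longrightarrow> norm (G t x) \<le> M * norm x"
    using c0_bounded[OF G] by blast
  define q where "q h = (1 / h) *\<^sub>R (G h x - x) - A x" for h
  define E where "E s = M * norm (q \<bar>s - t\<bar>) + norm (G (min s t) (A x) - G t (A x))" for s
  have quot: "norm (G s x - G t x - (s - t) *\<^sub>R G t (A x)) \<le> \<bar>s - t\<bar> * E s" if s: "s \<in> {0..T}" "s \<noteq> t" for s
  proof -
    define m h where "m = min s t" and "h = \<bar>s - t\<bar>"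
    have m: "m \<in> {0..T}" and h: "h > 0" using s t by (auto simp: m_def h_def)
    note lin = c0_linear[OF G, of m]
    have "G (m + h) x = G m (G h x)" using m h by (intro c0_add[OF G]) auto
    moreover have "h *\<^sub>R ((1 / h) *\<^sub>R (G h x - x)) = G h x - x" using h by simp
    ultimately have "G (m + h) x - G m x = h *\<^sub>R G m ((1 / h) *\<^sub>R (G h x - x))"
      using lin m by (metis linear_simps(2,5) atLeastAtMost_iff)
    moreover have "G s x - G t x = ((s - t) / h) *\<^sub>R (G (m + h) x - G m x)"
    proof (cases "s < t")
      case True
      then have "(s - t) / h = - 1" by (simp add: h_def field_simps)
      with True show ?thesis by (simp add: m_def h_def)
    next
      case False
      with s(2) show ?thesis by (simp add: m_def h_def)
    qed
    ultimately have "G s x - G t x = (s - t) *\<^sub>R G m ((1 / h) *\<^sub>R (G h x - x))" using h by simp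
    then have "G s x - G t x - (s - t) *\<^sub>R G t (A x) = (s - t) *\<^sub>R (G m (q h) + (G m (A x) - G t (A x)))"
      using lin m by (simp add: q_def linear_simps scaleR_diff_right)
    also have "norm \<dots> = \<bar>s - t\<bar> * norm (G m (q h) + (G m (A x) - G t (A x)))" by simp
    also have "\<dots> \<le> \<bar>s - t\<bar> * E s"
      unfolding E_def m_def[symmetric] h_def[symmetric]
      by (intro mult_left_mono order_trans[OF norm_triangle_ineq] add_mono M m order_refl less_imp_le[OF h])
    finally show ?thesis .
  qed
  have "(E \<longlongrightarrow> M * norm (0::'a) + norm (G t (A x) - G t (A x))) (at t within {0..T})"
    unfolding E_def
  proof (intro tendsto_intros)
    have "(q \<longlongrightarrow> A x - A x) (at_right 0)"
      unfolding q_def by (intro tendsto_intros generates_limit[OF A x])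
    moreover have "filterlim (\<lambda>s. \<bar>s - t\<bar>) (at_right 0) (at t within {0..T})"
      unfolding filterlim_at
      by (auto simp: eventually_at_filter intro!: tendsto_eq_intros)
    ultimately show "((\<lambda>s. q \<bar>s - t\<bar>) \<longlongrightarrow> 0) (at t within {0..T})"
      by (auto intro: filterlim_compose)
    have "continuous_on {0..T} (\<lambda>s. G (min s t) (A x))"
      using t by (intro c0_joint_continuous[OF G, of _ _ _ T] continuous_intros) auto
    then show "((\<lambda>s. G (min s t) (A x)) \<longlongrightarrow> G t (A x)) (at t within {0..T})"
      using bspec[OF _ t, of "\<lambda>t'. ((\<lambda>s. G (min s t) (A x)) \<longlongrightarrow> G (min t' t) (A x)) (at t' within {0..T})"]
      by (simp add: continuous_on_def)
  qed
  then have E0: "(E \<longlongrightarrow> 0) (at t within {0..T})" by simp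
  show ?thesis by (rule has_vector_derivative_withinI[OF quot E0])
qed

section \<open>Mild solutions in integrated form\<close>

lemma integral_reflect_shift:
  fixes f :: "real \<Rightarrow> 'e::real_normed_vector"
  shows "integral {a..b} (\<lambda>s. f (c - s)) = integral {c - b..c - a} f"
proof -
  have "((\<lambda>s. f (c - s)) has_integral i) {a..b} \<longleftrightarrow> (f has_integral i) {c - b..c - a}" for i
    using has_integral_shift_real[of "\<lambda>s. f (- s)" c i "a - c" "b - c"]
      has_integral_reflect_real[where f=f and i=i and a="c - b" and b="c - a"] by simp
  then show ?thesis by (simp add: integral_def integrable_on_def)
qed

lemma integral_extend_zero:
  fixes f :: "real \<Rightarrow> 'e::banach"
  assumes "a \<le> c" "c \<le> b" "f integrable_on {a..b}" "\<And>t. t \<in> {c..b} \<Longrightarrow> f t = 0"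
  shows "integral {a..b} f = integral {a..c} f"
proof -
  have "integral {c..b} f = integral {c..b} (\<lambda>_. 0)" by (rule integral_cong) (use assms(4) in auto)
  then show ?thesis using Henstock_Kurzweil_Integration.integral_combine[OF assms(1-3)] by simp
qed

lemma resolvent_set_properties:
  assumes "l \<in> resolvent_set D A"
  shows "resolvent D A l y \<in> D" "A (resolvent D A l y) - l *\<^sub>C resolvent D A l y = y"
    and "x \<in> D \<Longrightarrow> resolvent D A l (A x - l *\<^sub>C x) = x" and "bounded_clinear (resolvent D A l)"
proof -
  have bij: "bij_betw (\<lambda>x. A x - l *\<^sub>C x) D UNIV" and R: "bounded_clinear (resolvent D A l)"
    using assms by (auto simp: resolvent_set_def)
  have y: "y \<in> (\<lambda>x. A x - l *\<^sub>C x) ` D" using bij by (auto simp: bij_betw_def)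
  show "resolvent D A l y \<in> D" unfolding resolvent_def by (rule inv_into_into[OF y])
  show "A (resolvent D A l y) - l *\<^sub>C resolvent D A l y = y" unfolding resolvent_def by (rule f_inv_into_f[OF y])
  show "x \<in> D \<Longrightarrow> resolvent D A l (A x - l *\<^sub>C x) = x"
    unfolding resolvent_def using bij by (intro inv_into_f_f) (auto simp: bij_betw_def)
  show "bounded_clinear (resolvent D A l)" by (fact R)
qed

text \<open>\<open>R\<close> is the bounded inverse of the generator. Its values lie in
  \<open>D\<close>, so orbits of such values are differentiable, and the generator disappears from
  the formulas.\<close>

locale invertible_generator =
  fixes G :: "real \<Rightarrow> 'h::chilbert_space \<Rightarrow> 'h" and D :: "'h set" and A R :: "'h \<Rightarrow> 'h"
  assumes G: "c0_semigroup G" and gen: "generates D A G" and R: "bounded_clinear R"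
    and R_D: "\<And>y. R y \<in> D" and A_R: "\<And>y. A (R y) = y" and R_A: "\<And>x. x \<in> D \<Longrightarrow> R (A x) = x"
begin

lemma R_blin: "bounded_linear R" using R by (simp add: bounded_clinear_def)

lemma R_commute: "0 \<le> t \<Longrightarrow> R (G t y) = G t (R y)"
  using generates_invariant[OF G gen R_D, of t y] R_A by (metis A_R)

lemma orbit_derivative:
  "t \<in> {0..T} \<Longrightarrow> ((\<lambda>t. G t (R y)) has_vector_derivative G t y) (at t within {0..T})"
  using generates_derivative[OF G gen R_D, of t T y] by (simp add: A_R)

text \<open>Splitting off the fixed vector \<open>h r\<close> reduces one part to
  \<open>orbit_derivative\<close>. In the other part \<open>h s - h r\<close> vanishes at
  \<open>s = r\<close>, so strong continuity of \<open>G\<close> is enough for the product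
  rule.\<close>

lemma orbit_product_derivative:
  assumes r: "r \<in> {0..T}" and h: "(h has_vector_derivative h') (at r within {0..T})"
  shows "((\<lambda>r. G r (R (h r))) has_vector_derivative (G r (R h') + G r (h r))) (at r within {0..T})"
proof -
  obtain M where M: "M \<ge> 1" "\<And>t x. t \<in> {0..T} \<Longrightarrow> norm (G t x) \<le> M * norm x"
    using c0_bounded[OF G] by blast
  obtain K where K: "K \<ge> 0" "\<And>x. norm (R x) \<le> norm x * K"
    using bounded_linear.nonneg_bounded[OF R_blin] by blast
  define E where "E s = M * K * (norm (h s - h r - (s - r) *\<^sub>R h') / norm (s - r)) + norm (G s (R h') - G r (R h'))" for s
  have le: "norm (G s (R (h s - h r)) - G r (R (h r - h r)) - (s - r) *\<^sub>R G r (R h')) \<le> \<bar>s - r\<bar> * E s"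
    if s: "s \<in> {0..T}" "s \<noteq> r" for s
  proof -
    have lin: "bounded_linear (G s)" "bounded_linear (G r)" using s r by (auto intro: c0_linear[OF G])
    have "G s (R (h s - h r)) - G r (R (h r - h r)) - (s - r) *\<^sub>R G r (R h')
       = G s (R (h s - h r - (s - r) *\<^sub>R h')) + (s - r) *\<^sub>R (G s (R h') - G r (R h'))"
      using lin by (simp add: linear_simps[OF R_blin] linear_simps scaleR_diff_right)
    also have "norm \<dots> \<le> M * (norm (h s - h r - (s - r) *\<^sub>R h') * K) + \<bar>s - r\<bar> * norm (G s (R h') - G r (R h'))"
      using M by (intro order_trans[OF norm_triangle_ineq] add_mono order_trans[OF M(2)[OF s(1)]] mult_left_mono K) auto
    also have "\<dots> = \<bar>s - r\<bar> * E s" using s by (simp add: E_def field_simps)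
    finally show ?thesis .
  qed
  have "(E \<longlongrightarrow> M * K * 0 + norm (G r (R h') - G r (R h'))) (at r within {0..T})"
    unfolding E_def
  proof (intro tendsto_intros)
    show "((\<lambda>s. norm (h s - h r - (s - r) *\<^sub>R h') / norm (s - r)) \<longlongrightarrow> 0) (at r within {0..T})"
      using h by (simp add: has_vector_derivative_def has_derivative_iff_norm)
    show "((\<lambda>s. G s (R h')) \<longlongrightarrow> G r (R h')) (at r within {0..T})"
      using c0_continuous[OF G] r by (simp add: continuous_on_def)
  qed
  then have E0: "(E \<longlongrightarrow> 0) (at r within {0..T})" by simp
  have "((\<lambda>s. G s (R (h s - h r))) has_vector_derivative G r (R h')) (at r within {0..T})"
    by (rule has_vector_derivative_withinI[OF le E0])
  from has_vector_derivative_add[OF this orbit_derivative[OF r, of "h r"]]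
  have *: "((\<lambda>s. G s (R (h s - h r)) + G s (R (h r))) has_vector_derivative (G r (R h') + G r (h r))) (at r within {0..T})" .
  have "G s (R (h s)) = G s (R (h s - h r)) + G s (R (h r))" if "s \<in> {0..T}" for s
    using c0_linear[OF G, of s] that by (simp add: linear_simps[OF R_blin] linear_simps)
  from has_vector_derivative_transform[OF r this *] show ?thesis .
qed

lemma orbit_integral:
  assumes "0 \<le> t"
  shows "((\<lambda>s. G s x) has_integral (R (G t x) - R x)) {0..t}"
  using fundamental_theorem_of_calculus[OF assms orbit_derivative[of _ t x]] assms
  by (simp add: R_commute c0_zero[OF G])

text \<open>Because \<open>g\<close> vanishes at negative times, the range of integration can be
  made independent of \<open>t\<close>; the later exchange of integrals is then over a rectangle
  instead of a triangle.\<close>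

lemma convolution_eq:
  assumes g: "continuous_on UNIV g" and g0: "\<And>t. t \<le> 0 \<Longrightarrow> g t = 0" and t: "t \<in> {0..T}"
  shows "integral {0..t} (\<lambda>s. G (t - s) (g s)) = integral {0..T} (\<lambda>r. G r (g (t - r)))"
proof -
  have cont: "continuous_on {0..T} (\<lambda>r. G r (g (t - r)))"
    by (intro c0_joint_continuous[OF G, of _ _ _ T] continuous_intros continuous_on_compose2[OF g]) auto
  have "integral {0..T} (\<lambda>r. G r (g (t - r))) = integral {0..t} (\<lambda>r. G r (g (t - r)))"
    using t g0 c0_linear[OF G]
    by (intro integral_extend_zero integrable_continuous_real cont) (auto simp: linear_simps)
  also have "\<dots> = integral {0..t} (\<lambda>s. G (t - s) (g s))"
    using integral_reflect_shift[of 0 t "\<lambda>r. G r (g (t - r))" t] by simp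
  finally show ?thesis by simp
qed

text \<open>Exchanging integrals turns the integral of \<open>c\<close> into that of
  \<open>G r (H r)\<close>, which is read off from the derivative of \<open>G r (R (H r))\<close>.
  This is the integrated evolution equation for continuous forcing and zero initial state.\<close>

lemma convolution_integrated:
  assumes g: "continuous_on UNIV g" and g0: "\<And>t. t \<le> 0 \<Longrightarrow> g t = 0" and t: "\<tau> \<in> {0..T}"
  defines "c \<equiv> \<lambda>t. integral {0..t} (\<lambda>s. G (t - s) (g s))"
  shows "continuous_on {0..T} c"
    and "R (c \<tau>) = integral {0..\<tau>} c + R (integral {0..\<tau>} g)"
proof -
  have joint: "continuous_on ({0..T} \<times> cbox 0 T) (\<lambda>(t, r). G r (g (t - r)))"
    unfolding split_beta
    by (intro c0_joint_continuous[OF G, of _ _ _ T] continuous_intros continuous_on_compose2[OF g]) auto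
  have c_eq: "c t = integral (cbox 0 T) (\<lambda>r. G r (g (t - r)))" if "t \<in> {0..T}" for t
    unfolding c_def using convolution_eq[OF g g0 that] by simp
  have "continuous_on {0..T} (\<lambda>t. integral (cbox 0 T) (\<lambda>r. G r (g (t - r))))"
    by (rule integral_continuous_on_param[OF joint])
  then show "continuous_on {0..T} c" using c_eq by (simp cong: continuous_on_cong_simp)
  \<comment> \<open>The inner integral after the exchange, that of \<open>g (t - r)\<close> over
    \<open>t\<close> in [0, \<open>\<tau>\<close>], rewritten with \<open>r\<close> as a limit so
    that it can be differentiated. The two agree because \<open>g\<close> vanishes at negative
    times.\<close>
  define H where "H r = integral {r..T} (\<lambda>\<rho>. g (\<tau> - \<rho>))" for r
  have gc: "continuous_on S (\<lambda>\<rho>. g (\<tau> - \<rho>))" "continuous_on S (\<lambda>\<rho>. g (\<rho> - a))" for S a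
    by (intro continuous_on_compose2[OF g] continuous_intros; simp)+
  have H_deriv: "(H has_vector_derivative - g (\<tau> - r)) (at r within {0..T})" if "r \<in> {0..T}" for r
    unfolding H_def by (rule integral_has_vector_derivative'[OF gc(1) that])
  have H_cont: "continuous_on {0..T} H"
    using H_deriv by (intro continuous_on_vector_derivative)
  have H_eq: "integral {0..\<tau>} (\<lambda>t. g (t - r)) = H r" if r: "r \<in> {0..T}" for r
  proof -
    have "integral {0..\<tau>} (\<lambda>t. g (t - r)) = integral {r..\<tau> + r} (\<lambda>\<rho>. g (\<tau> - \<rho>))"
      using integral_reflect_shift[of r "\<tau> + r" "\<lambda>t. g (t - r)" "\<tau> + r"] by simp
    also have "\<dots> = H r"
    proof (cases "r \<le> \<tau>")
      case True
      have "integral {r..\<tau> + r} (\<lambda>\<rho>. g (\<tau> - \<rho>)) = integral {r..\<tau>} (\<lambda>\<rho>. g (\<tau> - \<rho>))"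
        using True r g0 by (intro integral_extend_zero integrable_continuous_real gc) auto
      moreover have "H r = integral {r..\<tau>} (\<lambda>\<rho>. g (\<tau> - \<rho>))"
        unfolding H_def using True t g0 by (intro integral_extend_zero integrable_continuous_real gc) auto
      ultimately show ?thesis by simp
    next
      case False
      have "integral {r..b} (\<lambda>\<rho>. g (\<tau> - \<rho>)) = integral {r..b} (\<lambda>_. 0)" for b
        by (rule integral_cong) (use False g0 in auto)
      then show ?thesis by (simp add: H_def)
    qed
    finally show ?thesis .
  qed
  have H0: "H 0 = integral {0..\<tau>} g" using H_eq[of 0] t by simp
  have HT: "H T = 0" by (simp add: H_def)
  have "((\<lambda>r. G r (R (- g (\<tau> - r))) + G r (H r)) has_integral (G T (R (H T)) - G 0 (R (H 0)))) {0..T}"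
    using t by (intro fundamental_theorem_of_calculus orbit_product_derivative H_deriv) auto
  then have 1: "((\<lambda>r. G r (R (- g (\<tau> - r))) + G r (H r)) has_integral - R (integral {0..\<tau>} g)) {0..T}"
    using c0_linear[OF G, of T] t
    by (simp add: HT H0 c0_zero[OF G] linear_simps[OF R_blin] linear_simps)
  have "(\<lambda>r. G r (g (\<tau> - r))) integrable_on {0..T}"
    by (intro integrable_continuous_real c0_joint_continuous[OF G, of _ _ _ T] continuous_intros gc) auto
  from has_integral_linear[OF integrable_integral[OF this] R_blin]
  have "((\<lambda>r. R (G r (g (\<tau> - r)))) has_integral R (c \<tau>)) {0..T}"
    using c_eq[OF t] by (simp add: o_def)
  from has_integral_add[OF 1 this]
  have "((\<lambda>r. G r (R (- g (\<tau> - r))) + G r (H r) + R (G r (g (\<tau> - r)))) has_integral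
     (- R (integral {0..\<tau>} g) + R (c \<tau>))) {0..T}" .
  moreover have "G r (R (- g (\<tau> - r))) + G r (H r) + R (G r (g (\<tau> - r))) = G r (H r)" if "r \<in> {0..T}" for r
    using that c0_linear[OF G, of r] by (simp add: R_commute linear_simps[OF R_blin] linear_simps)
  ultimately have 2: "((\<lambda>r. G r (H r)) has_integral (- R (integral {0..\<tau>} g) + R (c \<tau>))) {0..T}"
    by (rule has_integral_eq[rotated])
  have "integral {0..\<tau>} c = integral (cbox 0 \<tau>) (\<lambda>t. integral (cbox 0 T) (\<lambda>r. G r (g (t - r))))"
    unfolding cbox_interval using t by (intro integral_cong) (simp add: c_eq[unfolded cbox_interval])
  also have "\<dots> = integral (cbox 0 T) (\<lambda>r. integral (cbox 0 \<tau>) (\<lambda>t. G r (g (t - r))))"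
    using t by (intro integral_swap_continuous continuous_on_subset[OF joint]) (auto simp: cbox_Pair_eq)
  also have "\<dots> = integral {0..T} (\<lambda>r. G r (H r))"
    unfolding cbox_interval
  proof (rule integral_cong)
    fix r assume r: "r \<in> {0..T}"
    have "(\<lambda>t. g (t - r)) integrable_on {0..\<tau>}" by (intro integrable_continuous_real gc)
    from integral_linear[OF this c0_linear[OF G]] r
    show "integral {0..\<tau>} (\<lambda>t. G r (g (t - r))) = G r (H r)"
      by (simp add: o_def H_eq[OF r])
  qed
  also have "\<dots> = - R (integral {0..\<tau>} g) + R (c \<tau>)" using 2 by (rule integral_unique)
  finally show "R (c \<tau>) = integral {0..\<tau>} c + R (integral {0..\<tau>} g)" by simp
qed

text \<open>Continuous forcing is covered by \<open>convolution_integrated\<close>, the initial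
  state by \<open>orbit_integral\<close>. Square integrable forcing follows by approximation in
  mean, since each term of the integrated equation is controlled by the integral of the
  error.\<close>

theorem mild_solution_integrated:
  assumes T: "0 \<le> T" and f: "sq_approx 0 T f" and u: "continuous_on {0..T} u"
    and mild: "\<And>t. t \<in> {0..T} \<Longrightarrow> u t = G t x + integral {0..t} (\<lambda>s. G (t - s) (f s))"
    and t: "\<tau> \<in> {0..T}"
  shows "R (u \<tau>) - R (u 0) = integral {0..\<tau>} (\<lambda>s. u s + R (f s))"
proof -
  obtain M where M: "M \<ge> 1" "\<And>t x. t \<in> {0..T} \<Longrightarrow> norm (G t x) \<le> M * norm x"
    using c0_bounded[OF G] by blast
  obtain K where K: "K \<ge> 0" "\<And>x. norm (R x) \<le> norm x * K"
    using bounded_linear.nonneg_bounded[OF R_blin] by blast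
  have conv_int: "(\<lambda>s. G (t - s) (h s)) integrable_on {0..t}" if h: "sq_approx 0 T h" and t: "t \<in> {0..T}" for h t
  proof -
    \<comment> \<open>Clamping keeps the time argument nonnegative on all of \<open>{0..T}\<close>,
      where the multiplier must be linear and bounded; on \<open>{0..t}\<close> it changes
      nothing.\<close>
    have sq: "sq_approx 0 T (\<lambda>s. G (max 0 (t - s)) (h s))"
    proof (rule sq_approx_multiplier[OF h])
      show "linear (G (max 0 (t - s)))" for s
        by (intro bounded_linear.linear c0_linear[OF G]) auto
      show "norm (G (max 0 (t - s)) y) \<le> M * norm y" if "s \<in> {0..T}" for s y
        using that t by (intro M(2)) auto
      show "continuous_on {0..T} (\<lambda>s. G (max 0 (t - s)) y)" for y
        using t by (intro c0_joint_continuous[OF G, of _ _ _ T] continuous_intros) auto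
    qed
    have "(\<lambda>s. G (max 0 (t - s)) (h s)) integrable_on {0..t}"
      using integrable_on_subinterval[OF sq_approx_integrable[OF sq], of 0 t] t by auto
    then show ?thesis by (rule integrable_eq) auto
  qed
  define c where "c h t = integral {0..t} (\<lambda>s. G (t - s) (h s))" for h t
  have c_f: "c f t = u t - G t x" if "t \<in> {0..T}" for t using mild[OF that] by (simp add: c_def)
  have c_f_cont: "continuous_on {0..T} (c f)"
    using continuous_on_diff[OF u c0_continuous[OF G, of T x]] c_f by (simp cong: continuous_on_cong_simp)
  have f_int: "f integrable_on {0..T}" by (rule sq_approx_integrable[OF f])
  have sub_int: "h integrable_on {0..\<tau>}" if "h integrable_on {0..T}" for h :: "real \<Rightarrow> 'h"
    using integrable_on_subinterval[OF that] t by auto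
  have "R (c f \<tau>) - integral {0..\<tau>} (c f) - R (integral {0..\<tau>} f) = 0"
  \<comment> \<open>The three summands come from \<open>R\<close> of the convolution, from the
    integral of the convolution, and from \<open>R\<close> of the integrated forcing.\<close>
  proof (rule norm_eq_0I_small[where C="K * M + T * M + K"])
    fix e :: real assume e: "e > 0"
    obtain g k I where g: "continuous_on UNIV g" "\<And>t. t \<le> 0 \<or> T \<le> t \<Longrightarrow> g t = 0"
      and k: "(k has_integral I) {0..T}" "I < e" "\<And>t. t \<in> {0..T} \<Longrightarrow> norm (f t - g t) \<le> k t"
      using sq_approx_L1[OF f e] by metis
    have gc: "continuous_on {0..T} g" using g(1) continuous_on_subset by blast
    have gs: "sq_approx 0 T g" by (rule sq_approx_continuous[OF gc])
    have g_int: "g integrable_on {0..T}" by (intro integrable_continuous_real gc)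
    have gconv: "continuous_on {0..T} (c g)" "R (c g \<tau>) = integral {0..\<tau>} (c g) + R (integral {0..\<tau>} g)"
      unfolding c_def using convolution_integrated[OF g(1) _ t] g(2) by auto
    have c_diff: "norm (c f t - c g t) \<le> M * I" if t: "t \<in> {0..T}" for t
    proof -
      have kt: "k integrable_on {0..t}"
        by (rule integrable_on_subinterval[of k "{0..T}"]) (use k(1) t in auto)
      note Mk = integrable_on_mult_right[OF kt, of M]
      have "c f t - c g t = integral {0..t} (\<lambda>s. G (t - s) (f s) - G (t - s) (g s))"
        unfolding c_def by (intro integral_diff[symmetric] conv_int f gs t)
      also have "norm \<dots> \<le> integral {0..t} (\<lambda>s. M * k s)"
      proof (rule integral_norm_bound_integral)
        show "(\<lambda>s. G (t - s) (f s) - G (t - s) (g s)) integrable_on {0..t}"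
          by (intro integrable_diff conv_int f gs t)
        show "(\<lambda>s. M * k s) integrable_on {0..t}" by (rule Mk)
        show "norm (G (t - s) (f s) - G (t - s) (g s)) \<le> M * k s" if s: "s \<in> {0..t}" for s
        proof -
          have "norm (G (t - s) (f s) - G (t - s) (g s)) = norm (G (t - s) (f s - g s))"
            using c0_linear[OF G, of "t - s"] s by (simp add: linear_simps)
          also have "\<dots> \<le> M * norm (f s - g s)" using s t by (intro M(2)) auto
          also have "\<dots> \<le> M * k s" using s t M(1) by (intro mult_left_mono k(3)) auto
          finally show ?thesis .
        qed
      qed
      also have "\<dots> = norm (integral {0..t} (\<lambda>s. M * k s))"
      proof -
        have "0 \<le> M * k s" if "s \<in> {0..t}" for s
          using that t M(1) order_trans[OF norm_ge_zero k(3)[of s]] by (intro mult_nonneg_nonneg) auto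
        then have "0 \<le> integral {0..t} (\<lambda>s. M * k s)"
          by (rule integral_nonneg[OF Mk])
        then show ?thesis by simp
      qed
      also have "\<dots> \<le> M * I"
      proof (rule integral_norm_bound_sub[OF _ has_integral_mult_right[OF k(1)] _ t])
        show "(\<lambda>s. M * k s) integrable_on {0..T}"
          using has_integral_mult_right[OF k(1)] by blast
        show "norm (M * k s) \<le> M * k s" if "s \<in> {0..T}" for s
          using M(1) order_trans[OF norm_ge_zero k(3)[OF that]] by simp
      qed
      finally show ?thesis .
    qed
    have I0: "0 \<le> M * I" using c_diff[OF t] norm_ge_zero order_trans by blast
    have a: "norm (R (c f \<tau> - c g \<tau>)) \<le> (M * I) * K"
      using K(1) by (intro order_trans[OF K(2)] mult_right_mono c_diff t)
    have cf_int: "c f integrable_on {0..T}" "c g integrable_on {0..T}"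
      by (intro integrable_continuous_real c_f_cont gconv)+
    have b: "norm (integral {0..\<tau>} (\<lambda>s. c f s - c g s)) \<le> T * (M * I)"
    proof (rule integral_norm_bound_sub[OF _ _ c_diff t])
      show "(\<lambda>s. c f s - c g s) integrable_on {0..T}" by (intro integrable_diff cf_int)
      show "((\<lambda>t. M * I) has_integral T * (M * I)) {0..T}"
        using has_integral_const_real[of "M * I" 0 T] T by simp
    qed
    have d: "norm (R (integral {0..\<tau>} (\<lambda>s. f s - g s))) \<le> I * K"
      using K(1) by (intro order_trans[OF K(2)] mult_right_mono
          integral_norm_bound_sub[OF integrable_diff[OF f_int g_int] k(1,3) t])
    have "R (c f \<tau>) - integral {0..\<tau>} (c f) - R (integral {0..\<tau>} f) =
       R (c f \<tau> - c g \<tau>) - integral {0..\<tau>} (\<lambda>s. c f s - c g s) - R (integral {0..\<tau>} (\<lambda>s. f s - g s))"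
      using gconv(2) by (simp add: integral_diff sub_int cf_int f_int g_int linear_simps[OF R_blin])
    also have "norm \<dots> \<le> (M * I) * K + T * (M * I) + I * K"
      by (intro order_trans[OF norm_triangle_ineq4] add_mono a b d)
    also have "\<dots> = (K * M + T * M + K) * I" by (simp add: algebra_simps)
    also have "\<dots> \<le> (K * M + T * M + K) * e"
      using K(1) M(1) T k(2) by (intro mult_left_mono) (auto intro!: add_nonneg_nonneg)
    finally show "norm (R (c f \<tau>) - integral {0..\<tau>} (c f) - R (integral {0..\<tau>} f)) \<le> (K * M + T * M + K) * e" .
  qed
  then have 1: "R (c f \<tau>) = integral {0..\<tau>} (c f) + R (integral {0..\<tau>} f)" by (simp add: algebra_simps)
  have \<tau>0: "0 \<le> \<tau>" using t by simp
  note orb = orbit_integral[OF \<tau>0, of x]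
  have u0: "u 0 = x" using mild[of 0] T by (simp add: c0_zero[OF G])
  have Rf: "integral {0..\<tau>} (\<lambda>s. R (f s)) = R (integral {0..\<tau>} f)"
    using integral_linear[OF sub_int[OF f_int] R_blin] by (simp add: o_def)
  have Rf_int: "(\<lambda>s. R (f s)) integrable_on {0..\<tau>}"
    using integrable_linear[OF sub_int[OF f_int] R_blin] by (simp add: o_def)
  have u_int: "u integrable_on {0..\<tau>}" by (intro sub_int integrable_continuous_real u)
  have "integral {0..\<tau>} u = integral {0..\<tau>} (\<lambda>s. c f s + G s x)"
    using t by (intro integral_cong) (simp add: c_f)
  also have "\<dots> = integral {0..\<tau>} (c f) + (R (G \<tau> x) - R x)"
    using orb by (simp add: integral_add sub_int integrable_continuous_real c_f_cont has_integral_iff)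
  finally have "integral {0..\<tau>} (\<lambda>s. u s + R (f s)) = R (c f \<tau>) + (R (G \<tau> x) - R x)"
    using 1 by (simp add: integral_add u_int Rf_int Rf)
  also have "\<dots> = R (u \<tau>) - R (u 0)" using c_f[OF t] u0 by (simp add: linear_simps[OF R_blin])
  finally show ?thesis by simp
qed

end

section \<open>The frequency theorem\<close>

lemma bounded_clinearD: "bounded_clinear f \<Longrightarrow> bounded_linear f"
  by (simp add: bounded_clinear_def)

lemma bounded_clinear_compose: "bounded_clinear f \<Longrightarrow> bounded_clinear g \<Longrightarrow> bounded_clinear (\<lambda>x. f (g x))"
  by (auto simp: bounded_clinear_def intro: bounded_linear_compose)

lemma bounded_clinear_fst: "bounded_clinear fst" and bounded_clinear_snd: "bounded_clinear snd"
  by (auto simp: bounded_clinear_def bounded_linear_fst bounded_linear_snd scaleC_prod_def)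

lemma bounded_clinear_add: "bounded_clinear f \<Longrightarrow> bounded_clinear g \<Longrightarrow> bounded_clinear (\<lambda>x. f x + g x)"
  by (auto simp: bounded_clinear_def bounded_linear_add scaleC_add_right)

lemma bounded_clinear_scaleR: "bounded_clinear f \<Longrightarrow> bounded_clinear (\<lambda>x. r *\<^sub>R f x)"
  by (auto simp: bounded_clinear_def bounded_linear_const_scaleR scaleC_scaleR)

lemma bounded_clinear_Pair: "bounded_clinear f \<Longrightarrow> bounded_clinear g \<Longrightarrow> bounded_clinear (\<lambda>x. (f x, g x))"
  by (auto simp: bounded_clinear_def bounded_linear_Pair scaleC_prod_def)

lemma bounded_clinear_bound:
  assumes "bounded_clinear f"
  obtains K where "K \<ge> 0" "\<And>x. norm (f x) \<le> K * norm x"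
  using bounded_linear.nonneg_bounded[OF bounded_clinearD[OF assms]] by (metis mult.commute)

lemma inner_bound:
  assumes "norm u \<le> a" "norm w \<le> b"
  shows "inner u w \<le> a * b"
proof -
  have "inner u w \<le> norm u * norm w" by (rule norm_cauchy_schwarz)
  also have "\<dots> \<le> a * b" using assms by (intro mult_mono) (auto intro: order_trans[OF norm_ge_zero])
  finally show ?thesis .
qed

lemma two_mult_le:
  fixes a x y d :: real assumes "d > 0"
  shows "2 * a * x * y \<le> d * x\<^sup>2 + a\<^sup>2 / d * y\<^sup>2"
proof -
  have "0 \<le> (d * x - a * y)\<^sup>2 / d" using assms by simp
  also have "\<dots> = d * x\<^sup>2 + a\<^sup>2 / d * y\<^sup>2 - 2 * a * x * y"
    using assms by (simp add: power2_eq_square field_simps)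
  finally show ?thesis by simp
qed

locale control_system =
  fixes G :: "real \<Rightarrow> 'h::chilbert_space \<Rightarrow> 'h"
    and D :: "'h set" and A :: "'h \<Rightarrow> 'h"
    and B :: "'x::chilbert_space \<Rightarrow> 'h"
    and j :: "'a::chilbert_space \<Rightarrow> 'h"
    and F1 :: "'a \<Rightarrow> 'a" and F2 :: "'a \<Rightarrow> 'x" and F3 :: "'x \<Rightarrow> 'x"
  assumes semigroup: "c0_semigroup G" and generator: "generates D A G"
    and B: "bounded_clinear B"
    and embedding: "dense_embedding j" and D_range: "D \<subseteq> range j"
    and F1: "selfadjoint F1" and F2: "bounded_clinear F2" and F3: "selfadjoint F3"
    and restricts: "restricts_to_c0_semigroup j G"
    and axis: "\<And>\<omega>::real. \<i> * of_real \<omega> \<in> resolvent_set D A"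
    and res_linear: "\<And>\<omega>::real. bounded_clinear (resolvent_into j D A (\<i> * of_real \<omega>))"
    and res_bound: "\<exists>M. \<forall>\<omega>::real. onorm (resolvent_into j D A (\<i> * of_real \<omega>)) \<le> M"
begin

section \<open>The control system and its extension\<close>

abbreviation "R \<equiv> resolvent D A 0"
abbreviation "Ra \<omega> \<equiv> resolvent_into j D A (\<i> * of_real \<omega>)"
abbreviation "F \<equiv> hermitian_form F1 F2 F3"

lemma zero_resolvent: "0 \<in> resolvent_set D A" using axis[of 0] by simp

sublocale invertible_generator G D A R
  by unfold_locales
    (use semigroup generator resolvent_set_properties[OF zero_resolvent] in auto)

lemma F1_linear: "bounded_clinear F1" and F3_linear: "bounded_clinear F3" and j_linear: "bounded_clinear j"
  and j_inj: "inj j"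
  using F1 F3 embedding by (auto simp: selfadjoint_def dense_embedding_def)

lemmas j_blin = bounded_clinearD[OF j_linear]

lemma F_inner: "F v \<xi> = inner (F1 v) v + 2 * inner (F2 v) \<xi> + inner (F3 \<xi>) \<xi>"
  by (simp add: hermitian_form_def Re_cinner)

definition Ga :: "real \<Rightarrow> 'a \<Rightarrow> 'a" where "Ga t x = inv j (G t (j x))"

lemma Ga_semigroup: "c0_semigroup Ga"
  using restricts by (simp add: restricts_to_c0_semigroup_def Ga_def[abs_def])

lemma j_Ga: "0 \<le> t \<Longrightarrow> j (Ga t x) = G t (j x)"
  using restricts unfolding restricts_to_c0_semigroup_def Ga_def by (intro f_inv_into_f) blast

lemma resolvent_into_uniform_bound:
  obtains M where "M \<ge> 0" "\<And>(\<omega>::real) y. norm (Ra \<omega> y) \<le> M * norm y"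
proof -
  obtain M where M: "\<And>\<omega>::real. onorm (Ra \<omega>) \<le> M" using res_bound by blast
  have "norm (Ra \<omega> y) \<le> max M 0 * norm y" for \<omega> :: real and y
    using order_trans[OF onorm[OF bounded_clinearD[OF res_linear[of \<omega>]], of y]
        mult_right_mono[of "onorm (Ra \<omega>)" "max M 0" "norm y"]] M[of \<omega>] by (simp add: le_max_iff_disj)
  then show thesis using that[of "max M 0"] by simp
qed

lemma j_resolvent_into: "j (Ra \<omega> y) = resolvent D A (\<i> * of_real \<omega>) y"
  unfolding resolvent_into_def using resolvent_set_properties(1)[OF axis, of \<omega> y] D_range
  by (intro f_inv_into_f) auto

text \<open>Applying \<open>R\<close>, the inverse of A, to d/dt j v = A j v + B
  \<open>\<xi>\<close> + \<open>\<eta>\<close> gives d/dt \<open>K_op v\<close> =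
  \<open>L_op (v, \<xi>, \<eta>)\<close>, an equation between bounded operators.\<close>

definition K_op :: "'a \<Rightarrow> 'h" where "K_op v = R (j v)"

definition L_op :: "'a \<times> 'x \<times> 'h \<Rightarrow> 'h" where
  "L_op z = j (fst z) + R (B (fst (snd z)) + snd (snd z))"

text \<open>\<open>d\<close> is the dissipation margin built into the payoff, \<open>g\<close> the
  penalty on the auxiliary control. The mixed term sits in one entry instead of being symmetrised,
  since the operator enters only through its quadratic form.\<close>

definition S_op :: "real \<Rightarrow> real \<Rightarrow> 'a \<times> 'x \<times> 'h \<Rightarrow> 'a \<times> 'x \<times> 'h" where
  "S_op d g z = (F1 (fst z) + d *\<^sub>R fst z,
     2 *\<^sub>R F2 (fst z) + (F3 (fst (snd z)) + d *\<^sub>R fst (snd z)), (- g) *\<^sub>R snd (snd z))"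

lemma K_op_linear: "bounded_clinear K_op"
  unfolding K_op_def[abs_def] by (rule bounded_clinear_compose[OF R j_linear])

lemma L_op_linear: "bounded_clinear L_op"
  unfolding L_op_def[abs_def]
  by (intro bounded_clinear_add bounded_clinear_compose[OF j_linear] bounded_clinear_compose[OF R]
      bounded_clinear_compose[OF B] bounded_clinear_compose[OF bounded_clinear_fst]
      bounded_clinear_compose[OF bounded_clinear_snd] bounded_clinear_fst bounded_clinear_snd)

lemma S_op_linear: "bounded_clinear (S_op d g)"
  unfolding S_op_def[abs_def]
  by (intro bounded_clinear_Pair bounded_clinear_add bounded_clinear_scaleR bounded_clinear_compose[OF F1_linear]
      bounded_clinear_compose[OF F2] bounded_clinear_compose[OF F3_linear]
      bounded_clinear_compose[OF bounded_clinear_fst] bounded_clinear_compose[OF bounded_clinear_snd]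
      bounded_clinear_fst bounded_clinear_snd)

lemma S_op_inner: "inner (S_op d g (v, \<xi>, \<eta>)) (v, \<xi>, \<eta>) =
    F v \<xi> + d * ((norm v)\<^sup>2 + (norm \<xi>)\<^sup>2) - g * (norm \<eta>)\<^sup>2"
  by (simp add: S_op_def F_inner power2_norm_eq_inner inner_add algebra_simps)

text \<open>The mode equation exhibits \<open>j v\<close> as a value of \<open>R\<close>, hence as
  an element of \<open>D\<close>. Then \<open>A\<close> may be applied, and the resolvent recovers
  \<open>v\<close> from the two controls.\<close>

lemma mode_state:
  assumes "(\<i> * of_real \<omega>) *\<^sub>C K_op v = L_op (v, \<xi>, \<eta>)"
  shows "v = - Ra \<omega> (B \<xi>) - Ra \<omega> \<eta>"
proof -
  let ?l = "\<i> * of_real \<omega>"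
  define y where "y = ?l *\<^sub>C j v - (B \<xi> + \<eta>)"
  have "R y = ?l *\<^sub>C R (j v) - R (B \<xi> + \<eta>)"
    using R by (simp add: y_def linear_simps[OF R_blin] bounded_clinear_def)
  then have jv: "j v = R y" using assms by (simp add: K_op_def L_op_def)
  have "A (j v) = y" by (simp only: jv A_R)
  then have "A (j v) - ?l *\<^sub>C j v = - (B \<xi> + \<eta>)" by (simp add: y_def)
  then have "resolvent D A ?l (- (B \<xi> + \<eta>)) = j v"
    using resolvent_set_properties(3)[OF axis, of "j v" \<omega>] R_D jv by metis
  then have "Ra \<omega> (- (B \<xi> + \<eta>)) = v" by (simp add: resolvent_into_def j_inj)
  then show ?thesis by (simp add: linear_simps[OF bounded_clinearD[OF res_linear]])
qed

text \<open>The additional control \<open>\<eta>\<close> acting on all of \<open>'h\<close> makes the system null controllable; by the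
  uniform bound on the resolvent, a large penalty on \<open>\<eta>\<close> preserves the frequency inequality.\<close>

lemma extended_frequency_inequality:
  assumes pos: "\<delta>' > 0" and freq: "\<And>\<xi> (\<omega>::real). F (- Ra \<omega> (B \<xi>)) \<xi> \<le> - \<delta>' * (norm \<xi>)\<^sup>2"
  obtains d g where "d > 0" "\<And>(\<omega>::real) z. (\<i> * of_real \<omega>) *\<^sub>C K_op (fst z) = L_op z \<Longrightarrow>
     inner (S_op d g z) z \<le> - d * (norm z)\<^sup>2"
proof -
  obtain M where M: "M \<ge> 0" "\<And>(\<omega>::real) y. norm (Ra \<omega> y) \<le> M * norm y" using resolvent_into_uniform_bound by blast
  obtain b where b: "b \<ge> 0" "\<And>\<xi>. norm (B \<xi>) \<le> b * norm \<xi>" using bounded_clinear_bound[OF B] by blast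
  obtain f1 where f1: "f1 \<ge> 0" "\<And>v. norm (F1 v) \<le> f1 * norm v" using bounded_clinear_bound[OF F1_linear] by blast
  obtain f2 where f2: "f2 \<ge> 0" "\<And>v. norm (F2 v) \<le> f2 * norm v" using bounded_clinear_bound[OF F2] by blast
  \<comment> \<open>\<open>2 * a\<close> and \<open>c\<close> bound the mixed and the pure
    contribution of \<open>\<eta>\<close> to the form. Of \<open>\<delta>' * x\<^sup>2\<close>, one
    quarter is spent on Young's inequality for the mixed term and, by the choice of
    \<open>d\<close>, one quarter each on the margin in the payoff and the margin in the conclusion.
    \<open>g\<close> collects the resulting coefficients of \<open>y\<^sup>2\<close>, which is why
    \<open>2 * M\<^sup>2\<close> is counted twice.\<close>
  define a where "a = f1 * M * (M * b) + f2 * M"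
  define c where "c = f1 * M\<^sup>2"
  define N where "N = 2 * (M * b)\<^sup>2 + 1"
  have N: "N > 0" by (simp add: N_def add_nonneg_pos)
  define d where "d = \<delta>' / (4 * N)"
  have d: "d > 0" using pos N by (simp add: d_def)
  have dN: "d * N = \<delta>' / 4" using N by (simp add: d_def)
  define g where "g = c + a\<^sup>2 / (\<delta>' / 4) + 2 * d * (2 * M\<^sup>2) + d"
  have main: "inner (S_op d g z) z \<le> - d * (norm z)\<^sup>2" if z: "(\<i> * of_real \<omega>) *\<^sub>C K_op (fst z) = L_op z" for z and \<omega> :: real
  proof -
    obtain v \<xi> \<eta> where z_eq: "z = (v, \<xi>, \<eta>)" by (metis prod_cases3)
    define v1 v2 where "v1 = - Ra \<omega> (B \<xi>)" and "v2 = - Ra \<omega> \<eta>"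
    have v: "v = v1 + v2" using mode_state[of \<omega> v \<xi> \<eta>] z by (simp add: z_eq v1_def v2_def)
    define x y where "x = norm \<xi>" and "y = norm \<eta>"
    have xy: "x \<ge> 0" "y \<ge> 0" by (simp_all add: x_def y_def)
    have n1: "norm v1 \<le> (M * b) * x"
      using order_trans[OF M(2)[of \<omega> "B \<xi>"] mult_left_mono[OF b(2)[of \<xi>] M(1)]] by (simp add: v1_def x_def mult.assoc)
    have n2: "norm v2 \<le> M * y" using M(2)[of \<omega> \<eta>] by (simp add: v2_def y_def)
    have sym: "inner (F1 u) w = inner (F1 w) u" for u w
      using F1 by (simp add: selfadjoint_def is_adjoint_def Re_cinner[symmetric]) (metis Re_cinner inner_commute)
    have F1v2: "norm (F1 v2) \<le> f1 * (M * y)"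
      using order_trans[OF f1(2)[of v2] mult_left_mono[OF n2 f1(1)]] .
    have F2v2: "norm (F2 v2) \<le> f2 * (M * y)"
      using order_trans[OF f2(2)[of v2] mult_left_mono[OF n2 f2(1)]] .
    have "F v \<xi> = F v1 \<xi> + 2 * inner (F1 v2) v1 + inner (F1 v2) v2 + 2 * inner (F2 v2) \<xi>"
      using sym[of v1 v2]
      by (simp add: v F_inner linear_simps[OF bounded_clinearD[OF F1_linear]]
          linear_simps[OF bounded_clinearD[OF F2]] inner_add)
    also have "\<dots> \<le> - \<delta>' * x\<^sup>2 + 2 * (f1 * (M * y) * ((M * b) * x)) + f1 * (M * y) * (M * y) + 2 * (f2 * (M * y) * x)"
      using freq[of \<omega> \<xi>] by (intro add_mono mult_left_mono inner_bound F1v2 F2v2 n1 n2) (auto simp: v1_def x_def)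
    also have "\<dots> = - \<delta>' * x\<^sup>2 + 2 * a * x * y + c * y\<^sup>2"
      by (simp add: a_def c_def power2_eq_square algebra_simps)
    also have "2 * a * x * y \<le> \<delta>' / 4 * x\<^sup>2 + a\<^sup>2 / (\<delta>' / 4) * y\<^sup>2"
      using pos by (intro two_mult_le) simp
    finally have Fv: "F v \<xi> \<le> - (3 / 4) * \<delta>' * x\<^sup>2 + (c + a\<^sup>2 / (\<delta>' / 4)) * y\<^sup>2"
      by (simp add: algebra_simps)
    have "(norm v)\<^sup>2 \<le> 2 * (norm v1)\<^sup>2 + 2 * (norm v2)\<^sup>2" unfolding v by (rule norm_add_square_le)
    also have "\<dots> \<le> 2 * ((M * b) * x)\<^sup>2 + 2 * (M * y)\<^sup>2"
      using n1 n2 by (intro add_mono mult_left_mono power_mono) auto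
    also have "\<dots> = (N - 1) * x\<^sup>2 + 2 * M\<^sup>2 * y\<^sup>2" by (simp add: N_def power_mult_distrib)
    finally have "(norm v)\<^sup>2 + x\<^sup>2 \<le> N * x\<^sup>2 + 2 * M\<^sup>2 * y\<^sup>2" by (simp add: algebra_simps)
    from mult_left_mono[OF this less_imp_le[OF d]]
    have nv: "d * ((norm v)\<^sup>2 + x\<^sup>2) \<le> \<delta>' / 4 * x\<^sup>2 + d * (2 * M\<^sup>2) * y\<^sup>2"
      using dN by (simp add: distrib_left mult.assoc[symmetric])
    have "\<delta>' * x\<^sup>2 \<ge> 0" using pos by simp
    moreover have "g * y\<^sup>2 = (c + a\<^sup>2 / (\<delta>' / 4)) * y\<^sup>2 + 2 * (d * (2 * M\<^sup>2) * y\<^sup>2) + d * y\<^sup>2"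
      by (simp add: g_def algebra_simps)
    ultimately have "F v \<xi> + d * ((norm v)\<^sup>2 + x\<^sup>2) - g * y\<^sup>2 \<le> - (d * ((norm v)\<^sup>2 + x\<^sup>2)) - d * y\<^sup>2"
      using Fv nv by linarith
    moreover have "(norm z)\<^sup>2 = (norm v)\<^sup>2 + x\<^sup>2 + y\<^sup>2"
      by (simp add: z_eq norm_Pair x_def y_def)
    moreover have "inner (S_op d g z) z = F v \<xi> + d * ((norm v)\<^sup>2 + x\<^sup>2) - g * y\<^sup>2"
      unfolding z_eq x_def y_def by (rule S_op_inner)
    ultimately show ?thesis by (simp add: algebra_simps)
  qed
  show thesis using that[OF d main] .
qed

text \<open>Formally, the derivative of (1 - t) G(t) x is A applied to it minus G(t) x, so the
  control -G(t) x produces it. The orbit of \<open>x\<close> need not be differentiable, hence the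
  verification after applying \<open>R\<close>. The semigroup in \<open>'a\<close> bounds the state
  part of the energy, and the bound on \<open>j\<close> the control part.\<close>

lemma steering_exists:
  obtains C where "\<And>x. \<exists>z. null_control K_op L_op C x z"
proof -
  obtain Ma where Ma: "Ma \<ge> 1" "\<And>t x. t \<in> {0..1} \<Longrightarrow> norm (Ga t x) \<le> Ma * norm x"
    using c0_bounded[OF Ga_semigroup] by blast
  obtain b where b: "b \<ge> 0" "\<And>x. norm (j x) \<le> b * norm x" using bounded_clinear_bound[OF j_linear] by blast
  define C where "C = Ma\<^sup>2 + (b * Ma)\<^sup>2"
  have "\<exists>z. null_control K_op L_op C x z" for x
  proof -
    define z :: "real \<Rightarrow> 'a \<times> 'x \<times> 'h" where "z t = ((1 - t) *\<^sub>R Ga t x, 0, - j (Ga t x))" for t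
    have cont: "continuous_on {0..1} (\<lambda>t. Ga t x)" by (rule c0_continuous[OF Ga_semigroup])
    have z_cont: "continuous_on {0..1} z"
      unfolding z_def by (intro continuous_intros cont bounded_linear.continuous_on[OF j_blin])
    have traj: "K_op (fst (z t)) - K_op (fst (z 0)) = integral {0..t} (\<lambda>s. L_op (z s))" if t: "t \<in> {0..1}" for t
    proof -
      have "((\<lambda>s. (1 - s) *\<^sub>R G s (R (j x))) has_vector_derivative
          ((1 - s) *\<^sub>R G s (j x) + (- 1) *\<^sub>R G s (R (j x)))) (at s within {0..t})" if "s \<in> {0..t}" for s
        using that by (intro has_vector_derivative_scaleR orbit_derivative) (auto intro!: derivative_eq_intros)
      then have "((\<lambda>s. (1 - s) *\<^sub>R G s (j x) + (- 1) *\<^sub>R G s (R (j x))) has_integral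
          ((1 - t) *\<^sub>R G t (R (j x)) - (1 - 0) *\<^sub>R G 0 (R (j x)))) {0..t}"
        using t by (intro fundamental_theorem_of_calculus) auto
      moreover have "L_op (z s) = (1 - s) *\<^sub>R G s (j x) + (- 1) *\<^sub>R G s (R (j x))" if "s \<in> {0..t}" for s
        using that linear_simps[OF bounded_clinearD[OF B]]
        by (simp add: L_op_def z_def linear_simps[OF j_blin] linear_simps[OF R_blin] j_Ga R_commute)
      ultimately have "((\<lambda>s. L_op (z s)) has_integral ((1 - t) *\<^sub>R G t (R (j x)) - R (j x))) {0..t}"
        by (auto intro: has_integral_eq[rotated] simp: c0_zero[OF G])
      moreover have "K_op (fst (z t)) - K_op (fst (z 0)) = (1 - t) *\<^sub>R G t (R (j x)) - R (j x)"
        using t by (simp add: K_op_def z_def linear_simps[OF j_blin] linear_simps[OF R_blin] j_Ga R_commute c0_zero[OF G])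
      ultimately show ?thesis by (simp add: integral_unique)
    qed
    have "(norm (z t))\<^sup>2 \<le> C * (norm x)\<^sup>2" if t: "t \<in> {0..1}" for t
    proof -
      have "(norm (z t))\<^sup>2 = (\<bar>1 - t\<bar> * norm (Ga t x))\<^sup>2 + (norm (j (Ga t x)))\<^sup>2"
        by (simp add: z_def norm_Pair)
      also have "\<dots> \<le> (1 * (Ma * norm x))\<^sup>2 + (b * (Ma * norm x))\<^sup>2"
        using t Ma(2)[OF t, of x] order_trans[OF b(2)[of "Ga t x"] mult_left_mono[OF Ma(2)[OF t, of x] b(1)]]
        by (intro add_mono power_mono mult_mono) auto
      also have "\<dots> = C * (norm x)\<^sup>2" by (simp add: C_def power_mult_distrib algebra_simps)
      finally show ?thesis .
    qed
    then have "integral {0..1} (\<lambda>t. (norm (z t))\<^sup>2) \<le> integral {0..1} (\<lambda>t::real. C * (norm x)\<^sup>2)"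
      by (intro integral_le integrable_continuous_real continuous_intros z_cont)
    moreover have "fst (z 0) = x" "fst (z 1) = 0" by (simp_all add: z_def c0_zero[OF Ga_semigroup])
    ultimately show ?thesis using sq_approx_continuous[OF z_cont] traj unfolding null_control_def by (intro exI[of _ z]) auto
  qed
  then show thesis using that by blast
qed

section \<open>The two implications\<close>

definition dissipative :: "real \<Rightarrow> ('a \<Rightarrow> 'a) \<Rightarrow> bool" where
  "dissipative \<delta> P \<longleftrightarrow> (\<forall>T\<ge>0. \<forall>v0. \<forall>\<xi>\<in>L2_on T. \<forall>v.
     (\<forall>t\<in>{0..T}. j (v t) = mild_solution G B (j v0) \<xi> t) \<and> continuous_on {0..T} v \<longrightarrow>
     Re (cinner (P (v T)) (v T)) - Re (cinner (P v0) v0) + integral {0..T} (\<lambda>s. F (v s) (\<xi> s))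
       \<le> - \<delta> * integral {0..T} (\<lambda>s. (norm (v s))\<^sup>2 + (norm (\<xi> s))\<^sup>2))"

lemma dissipation_of_frequency_inequality:
  assumes pos: "\<delta>' > 0" and freq: "\<And>\<xi> (\<omega>::real). F (- Ra \<omega> (B \<xi>)) \<xi> \<le> - \<delta>' * (norm \<xi>)\<^sup>2"
  obtains \<delta> P where "\<delta> > 0" "selfadjoint P" "dissipative \<delta> P"
proof -
  obtain d g where d: "d > 0" and ineq: "\<And>(\<omega>::real) z. (\<i> * of_real \<omega>) *\<^sub>C K_op (fst z) = L_op z \<Longrightarrow>
     inner (S_op d g z) z \<le> - d * (norm z)\<^sup>2"
    using extended_frequency_inequality[OF pos freq] by metis
  obtain C where steer: "\<And>x. \<exists>z. null_control K_op L_op C x z"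
    using steering_exists by metis
  interpret lq: lq_system K_op L_op "S_op d g" d C
    by unfold_locales (fact K_op_linear L_op_linear S_op_linear d ineq steer)+
  obtain P where P: "selfadjoint P" and diss: "\<And>T z. lq.trajectory T z \<Longrightarrow>
    Re (cinner (P (fst (z T))) (fst (z T))) - Re (cinner (P (fst (z 0))) (fst (z 0))) + lq.payoff T z \<le> 0"
    using lq.lyapunov_operator by metis
  have "Re (cinner (P (v T)) (v T)) - Re (cinner (P v0) v0) + integral {0..T} (\<lambda>s. F (v s) (\<xi> s))
        \<le> - d * integral {0..T} (\<lambda>s. (norm (v s))\<^sup>2 + (norm (\<xi> s))\<^sup>2)"
    if T: "0 \<le> T" and \<xi>: "\<xi> \<in> L2_on T"
      and mild: "\<And>t. t \<in> {0..T} \<Longrightarrow> j (v t) = mild_solution G B (j v0) \<xi> t"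
      and v: "continuous_on {0..T} v" for T v0 \<xi> v
  proof -
    have \<xi>s: "sq_approx 0 T \<xi>" by (rule L2_on_imp_sq_approx[OF \<xi>])
    have vs: "sq_approx 0 T v" by (rule sq_approx_continuous[OF v])
    have "j (v 0) = j v0" using mild[of 0] T by (simp add: mild_solution_def c0_zero[OF G])
    then have v0: "v 0 = v0" using j_inj by (simp add: inj_eq)
    \<comment> \<open>The given system is the extended one with the additional control switched off.
      The penalty drops out, the payoff density becomes the form plus \<open>d\<close> times the
      energy density, and so \<open>d\<close> serves as \<open>\<delta>\<close>.\<close>
    define z where "z t = (v t, \<xi> t, 0::'h)" for t
    have "R (j (v t)) - R (j (v 0)) = integral {0..t} (\<lambda>s. j (v s) + R (B (\<xi> s)))" if t: "t \<in> {0..T}" for t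
      by (rule mild_solution_integrated[OF T sq_approx_bounded_clinear[OF B \<xi>s] bounded_linear.continuous_on[OF j_blin v] _ t])
         (use mild in \<open>simp add: mild_solution_def\<close>)
    moreover have zs: "sq_approx 0 T z"
      unfolding z_def by (intro sq_approx_Pair vs \<xi>s sq_approx_continuous continuous_intros)
    ultimately have tr: "lq.trajectory T z"
      using T by (simp add: lq.trajectory_def z_def K_op_def L_op_def)
    have q_int: "(\<lambda>t. (norm (v t))\<^sup>2 + (norm (\<xi> t))\<^sup>2) integrable_on {0..T}"
      by (intro integrable_add sq_approx_norm2_integrable vs \<xi>s)
    have pay: "inner (S_op d g (z t)) (z t) = F (v t) (\<xi> t) + d * ((norm (v t))\<^sup>2 + (norm (\<xi> t))\<^sup>2)" for t
      by (simp add: z_def S_op_inner)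
    \<comment> \<open>Integrability of the form along the solution is recovered from that of the
      payoff, where it follows from square integrability of \<open>z\<close>.\<close>
    have "(\<lambda>t. F (v t) (\<xi> t) + d * ((norm (v t))\<^sup>2 + (norm (\<xi> t))\<^sup>2)) integrable_on {0..T}"
      using lq.payoff_integrable[OF zs] by (simp add: pay)
    from integrable_diff[OF this integrable_on_mult_right[OF q_int, of d]]
    have F_int: "(\<lambda>t. F (v t) (\<xi> t)) integrable_on {0..T}" by simp
    have "lq.payoff T z = integral {0..T} (\<lambda>s. F (v s) (\<xi> s)) + d * integral {0..T} (\<lambda>s. (norm (v s))\<^sup>2 + (norm (\<xi> s))\<^sup>2)"
      unfolding lq.payoff_def pay using integral_add[OF F_int integrable_on_mult_right[OF q_int, of d]] by simp
    with diss[OF tr] show ?thesis by (simp add: z_def v0)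
  qed
  then have "dissipative d P" unfolding dissipative_def by (intro allI ballI impI) auto
  then show thesis by (rule that[OF d P])
qed

text \<open>Along a pure oscillation all quadratic quantities are constant in time: the storage
  terms cancel, and integrals over the unit interval equal their integrands. Dropping the
  nonpositive term with \<open>norm v0\<close> leaves the frequency inequality with the same
  constant.\<close>

lemma frequency_inequality_of_dissipation:
  assumes pos: "\<delta> > 0" and P: "selfadjoint P" and diss: "dissipative \<delta> P"
  shows "F (- Ra \<omega> (B \<xi>0)) \<xi>0 \<le> - \<delta> * (norm \<xi>0)\<^sup>2"
proof -
  let ?l = "\<i> * of_real \<omega>"
  \<comment> \<open>The amplitude for which \<open>?l *\<^sub>C w - A w = B \<xi>0\<close>, that is,
    for which an oscillating state and control solve the evolution equation.\<close>
  define v0 where "v0 = - Ra \<omega> (B \<xi>0)"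
  define w where "w = j v0"
  have w: "w = - resolvent D A ?l (B \<xi>0)" by (simp add: w_def v0_def linear_simps[OF j_blin] j_resolvent_into)
  have w': "w = resolvent D A ?l (- B \<xi>0)"
    using linear_neg[OF bounded_linear.linear[OF bounded_clinearD[OF resolvent_set_properties(4)[OF axis]]]]
    by (simp add: w)
  have wD: "w \<in> D" and Aw: "?l *\<^sub>C w - A w = B \<xi>0"
    using resolvent_set_properties(1,2)[OF axis[of \<omega>], of "- B \<xi>0"] unfolding w' by (simp_all add: algebra_simps)
  define e where "e t = cis (\<omega> * t)" for t
  have e1: "cmod (e t) = 1" for t by (simp add: e_def)
  have e_cont: "continuous_on S e" for S unfolding e_def cis_conv_exp by (intro continuous_intros)
  have e_deriv: "(e has_vector_derivative (?l * e t)) (at t within S)" for t S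
  proof -
    have "((\<lambda>z. exp (?l * z)) has_field_derivative (?l * exp (?l * of_real t))) (at (of_real t))"
      by (auto intro!: derivative_eq_intros)
    from has_vector_derivative_real_field[OF this] show ?thesis
      unfolding e_def[abs_def] cis_conv_exp by (simp add: mult.assoc)
  qed
  define v where "v t = e t *\<^sub>C v0" for t
  define \<xi> where "\<xi> t = e t *\<^sub>C \<xi>0" for t
  have mild: "j (v t) = mild_solution G B (j v0) \<xi> t" if t: "t \<in> {0..1}" for t
  proof -
    \<comment> \<open>Variation of constants read backwards: by the choice of \<open>w\<close>, the
      integrand of the mild solution is the exact derivative of
      \<open>e s *\<^sub>C G (t - s) w\<close>.\<close>
    have deriv: "((\<lambda>s. e s *\<^sub>C G (t - s) w) has_vector_derivative G (t - s) (B (\<xi> s))) (at s within {0..t})" if s: "s \<in> {0..t}" for s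
    proof -
      have "((\<lambda>r. G r w) has_vector_derivative G (t - s) (A w)) (at (t - s) within (\<lambda>s. t - s) ` {0..t})"
        using generates_derivative[OF G gen wD, of "t - s" t] s by simp
      moreover have "((\<lambda>s. t - s) has_vector_derivative - 1) (at s within {0..t})"
        by (auto intro!: derivative_eq_intros)
      ultimately have "((\<lambda>s. G (t - s) w) has_vector_derivative (- 1) *\<^sub>R G (t - s) (A w)) (at s within {0..t})"
        using vector_diff_chain_within[of "\<lambda>s. t - s" "- 1" s "{0..t}" "\<lambda>r. G r w"] by (simp add: o_def)
      from bounded_bilinear.has_vector_derivative[OF bounded_bilinear_scaleC e_deriv this]
      have "((\<lambda>s. e s *\<^sub>C G (t - s) w) has_vector_derivative
          (e s *\<^sub>C (- 1) *\<^sub>R G (t - s) (A w) + (?l * e s) *\<^sub>C G (t - s) w)) (at s within {0..t})" .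
      moreover have "e s *\<^sub>C (- 1) *\<^sub>R G (t - s) (A w) + (?l * e s) *\<^sub>C G (t - s) w = G (t - s) (B (\<xi> s))"
      proof -
        have ts: "0 \<le> t - s" using s by simp
        have "G (t - s) (B (\<xi> s)) = e s *\<^sub>C G (t - s) (?l *\<^sub>C w - A w)"
          using B by (simp add: Aw \<xi>_def bounded_clinear_def c0_scaleC[OF G ts])
        also have "\<dots> = e s *\<^sub>C (?l *\<^sub>C G (t - s) w - G (t - s) (A w))"
          by (simp add: linear_simps[OF c0_linear[OF G ts]] c0_scaleC[OF G ts])
        finally show ?thesis by (simp add: scaleC_diff_right scaleC_scaleC mult.commute)
      qed
      ultimately show ?thesis by simp
    qed
    have "((\<lambda>s. G (t - s) (B (\<xi> s))) has_integral (e t *\<^sub>C G (t - t) w - e 0 *\<^sub>C G (t - 0) w)) {0..t}"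
      using t by (intro fundamental_theorem_of_calculus deriv) auto
    then have "integral {0..t} (\<lambda>s. G (t - s) (B (\<xi> s))) = e t *\<^sub>C w - G t w"
      by (simp add: integral_unique c0_zero[OF G] e_def)
    then show ?thesis using j_linear by (simp add: mild_solution_def v_def bounded_clinear_def w_def)
  qed
  have \<xi>_cont: "continuous_on S \<xi>" for S unfolding \<xi>_def by (intro continuous_intros e_cont)
  have "\<xi> \<in> L2_on 1"
    unfolding L2_on_def
  proof (intro CollectI conjI)
    show "\<xi> measurable_on {0..1}"
      using measurable_on_restrict[OF continuous_imp_measurable_on[OF \<xi>_cont[of UNIV]], of "{0..1}"]
        measurable_on_UNIV[of "{0..1}" \<xi>] by simp
    show "(\<lambda>s. (norm (\<xi> s))\<^sup>2) integrable_on {0..1}"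
      by (intro integrable_continuous_real continuous_intros \<xi>_cont)
  qed
  moreover have "continuous_on {0..1} v" unfolding v_def by (intro continuous_intros e_cont)
  ultimately have main: "Re (cinner (P (v 1)) (v 1)) - Re (cinner (P v0) v0) + integral {0..1} (\<lambda>s. F (v s) (\<xi> s))
        \<le> - \<delta> * integral {0..1} (\<lambda>s. (norm (v s))\<^sup>2 + (norm (\<xi> s))\<^sup>2)"
    using diss[unfolded dissipative_def, THEN spec, THEN mp, THEN spec, THEN bspec, THEN spec, THEN mp, of 1 \<xi> v v0] mild
    by simp
  have cnj_e: "cnj (e t) * e t = 1" "e t * cnj (e t) = 1" for t
    using complex_norm_square[of "e t"] by (simp_all add: e1 mult.commute)
  have inner_e: "inner (e t *\<^sub>C x) (e t *\<^sub>C y) = inner x y" for t and x y :: "'c::chilbert_space"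
    by (simp add: inner_scaleC_left scaleC_scaleC cnj_e)
  have "F (v s) (\<xi> s) = F v0 \<xi>0" for s
    using F1_linear F2 F3_linear by (simp add: F_inner v_def \<xi>_def bounded_clinear_def inner_e)
  moreover have "Re (cinner (P (v 1)) (v 1)) = Re (cinner (P v0) v0)"
    using P by (simp add: Re_cinner v_def selfadjoint_def bounded_clinear_def inner_e)
  ultimately have "F v0 \<xi>0 \<le> - \<delta> * ((norm v0)\<^sup>2 + (norm \<xi>0)\<^sup>2)"
    using main by (simp add: v_def \<xi>_def norm_scaleC e1)
  also have "\<dots> \<le> - \<delta> * (norm \<xi>0)\<^sup>2" using pos by (simp add: algebra_simps)
  finally show ?thesis by (simp add: v0_def)
qed

end

theorem theorem1:
  fixes G :: "real \<Rightarrow> 'h::chilbert_space \<Rightarrow> 'h"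
    and D :: "'h set" and A :: "'h \<Rightarrow> 'h"
    and B :: "'x::chilbert_space \<Rightarrow> 'h"
    and j :: "'a::chilbert_space \<Rightarrow> 'h"
    and F1 :: "'a \<Rightarrow> 'a" and F2 :: "'a \<Rightarrow> 'x" and F3 :: "'x \<Rightarrow> 'x"
  assumes "c0_semigroup G" and "generates D A G"
    and "bounded_clinear B"
    and "dense_embedding j" and "D \<subseteq> range j"
    and "selfadjoint F1" and "bounded_clinear F2" and "selfadjoint F3"
    and "restricts_to_c0_semigroup j G"
    and "\<forall>\<omega>::real. \<i> * of_real \<omega> \<notin> spectrum D A"
    and "\<forall>\<omega>::real. bounded_clinear (resolvent_into j D A (\<i> * of_real \<omega>))"
    and "\<exists>M. \<forall>\<omega>::real. onorm (resolvent_into j D A (\<i> * of_real \<omega>)) \<le> M"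
  shows
    "(\<exists>\<delta>'>0. \<forall>\<xi>. \<forall>\<omega>::real.
        hermitian_form F1 F2 F3 (- resolvent_into j D A (\<i> * of_real \<omega>) (B \<xi>)) \<xi>
          \<le> - \<delta>' * (norm \<xi>)\<^sup>2)
     \<longleftrightarrow>
     (\<exists>\<delta>>0. \<exists>P. selfadjoint P \<and>
        (let V = (\<lambda>v. Re (cinner (P v) v)) in
         \<forall>T\<ge>0. \<forall>v0. \<forall>\<xi>\<in>L2_on T. \<forall>v.
           (\<forall>t\<in>{0..T}. j (v t) = mild_solution G B (j v0) \<xi> t) \<and> continuous_on {0..T} v \<longrightarrow>
           V (v T) - V v0 + integral {0..T} (\<lambda>s. hermitian_form F1 F2 F3 (v s) (\<xi> s))
             \<le> - \<delta> * integral {0..T} (\<lambda>s. (norm (v s))\<^sup>2 + (norm (\<xi> s))\<^sup>2)))"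
    (is "?freq \<longleftrightarrow> ?diss")
proof -
  interpret control_system G D A B j F1 F2 F3
    by unfold_locales (use assms in \<open>auto simp: spectrum_def\<close>)
  have diss: "?diss \<longleftrightarrow> (\<exists>\<delta>>0. \<exists>P. selfadjoint P \<and> dissipative \<delta> P)"
    unfolding Let_def dissipative_def ..
  show ?thesis
    unfolding diss
    using dissipation_of_frequency_inequality frequency_inequality_of_dissipation by metis
qed

end
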